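(* It is undecidable to determine whether the $\omega$-language of a given real-time 1-blind-counter Büchi automaton is an effective $\Delta^1_1$-set. Likewise, for a given integer $n\ge1$, it is undecidable whether it is an arithmetical $\Sigma^0_n$-set, and undecidable whether it is an arithmetical $\Pi^0_n$-set.
   Context: A real-time 1-blind-counter Büchi automaton is a finite-state automaton over a finite alphabet reading one letter per step, whose transitions add $-1,0,+1$ to one non-negative integer counter (a run blocks if the counter would become negative) but never test it for zero; runs start with counter $0$; an $\omega$-word is accepted if some run visits an accepting state infinitely often. An $\omega$-language $L\subseteq\Sigma^\omega$ is arithmetical $\Sigma^0_n$ iff there is a recursive relation $R\subseteq\mathbb{N}^{n-1}\times\Sigma^\star$ with $L=\{\sigma\mid\exists a_1Q_2a_2\dots Q_na_n\ (a_1,\dots,a_{n-1},\sigma[a_n+1])\in R\}$; $\Pi^0_n$ sets are complements of $\Sigma^0_n$ sets; effective $\Delta^1_1$ is the lightface class $\Sigma^1_1\cap\Pi^1_1$. *)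

theory Defs
  imports Main "HOL-Library.Nat_Bijection"
begin

datatype recf = Zf | Sf | Proj nat | Comp recf "recf list" | Prec recf recf | Mn recf

inductive eval :: "recf \<Rightarrow> nat list \<Rightarrow> nat \<Rightarrow> bool" where
  ev_Z: "eval Zf xs 0"
| ev_S: "eval Sf (x # xs) (Suc x)"
| ev_Proj: "i < length xs \<Longrightarrow> eval (Proj i) xs (xs ! i)"
| ev_Comp: "list_all2 (\<lambda>g y. eval g xs y) gs ys \<Longrightarrow> eval f ys z \<Longrightarrow> eval (Comp f gs) xs z"
| ev_Prec0: "eval f xs y \<Longrightarrow> eval (Prec f g) (0 # xs) y"
| ev_PrecS: "eval (Prec f g) (n # xs) y \<Longrightarrow> eval g (y # n # xs) z
             \<Longrightarrow> eval (Prec f g) (Suc n # xs) z"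
| ev_Mn: "eval f (n # xs) 0 \<Longrightarrow> (\<forall>m<n. \<exists>y. eval f (m # xs) y \<and> y \<noteq> 0)
          \<Longrightarrow> eval (Mn f) xs n"

definition recursive_set :: "nat set \<Rightarrow> bool" where
  "recursive_set D \<longleftrightarrow> (\<exists>p. \<forall>x. eval p [x] (if x \<in> D then 1 else 0))"

definition omega_words :: "nat \<Rightarrow> (nat \<Rightarrow> nat) set" where
  "omega_words k = {\<sigma>. \<forall>i. \<sigma> i < k}"

definition prefix :: "(nat \<Rightarrow> nat) \<Rightarrow> nat \<Rightarrow> nat list" where
  "prefix \<sigma> m = map \<sigma> [0..<m]"

text \<open>BCA k nq q0 T F: alphabet {0..<k}, states {0..<nq}, initial state q0,
  transitions (p, a, d, q) reading letter a from p to q and adding d - 1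
  (d in {0,1,2}, i.e. counter update in {-1,0,+1}) to the counter, accepting states F.\<close>
datatype bca = BCA (alph: nat) (nst: nat) (init: nat)
                   (trans: "(nat \<times> nat \<times> nat \<times> nat) list") (acc: "nat list")

definition wf_bca :: "bca \<Rightarrow> bool" where
  "wf_bca A \<longleftrightarrow> alph A \<ge> 1 \<and> init A < nst A
     \<and> (\<forall>(p, a, d, q) \<in> set (trans A). p < nst A \<and> a < alph A \<and> d \<le> 2 \<and> q < nst A)
     \<and> (\<forall>q \<in> set (acc A). q < nst A)"

text \<open>A run: state sequence rho and (non-negative) counter values c, counter starts at 0;
  a step blocks if the counter would become negative (counter values are naturals).\<close>
definition is_run :: "bca \<Rightarrow> (nat \<Rightarrow> nat) \<Rightarrow> (nat \<Rightarrow> nat) \<Rightarrow> (nat \<Rightarrow> nat) \<Rightarrow> bool" where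
  "is_run A \<sigma> \<rho> c \<longleftrightarrow> \<rho> 0 = init A \<and> c 0 = 0 \<and>
     (\<forall>i. \<exists>d. (\<rho> i, \<sigma> i, d, \<rho> (Suc i)) \<in> set (trans A)
               \<and> int (c (Suc i)) = int (c i) + int d - 1)"

definition lang :: "bca \<Rightarrow> (nat \<Rightarrow> nat) set" where
  "lang A = {\<sigma> \<in> omega_words (alph A).
     \<exists>\<rho> c. is_run A \<sigma> \<rho> c \<and> (\<exists>\<^sub>\<infinity>i. \<rho> i \<in> set (acc A))}"

fun code_tr :: "nat \<times> nat \<times> nat \<times> nat \<Rightarrow> nat" where
  "code_tr (p, a, d, q) = list_encode [p, a, d, q]"

definition code_bca :: "bca \<Rightarrow> nat" where
  "code_bca A = list_encode [alph A, nst A, init A,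
     list_encode (map code_tr (trans A)), list_encode (acc A)]"

definition decidable_bca_prop :: "(bca \<Rightarrow> bool) \<Rightarrow> bool" where
  "decidable_bca_prop P \<longleftrightarrow>
     (\<exists>D. recursive_set D \<and> (\<forall>A. wf_bca A \<longrightarrow> (code_bca A \<in> D \<longleftrightarrow> P A)))"

fun alt :: "bool \<Rightarrow> nat \<Rightarrow> (nat list \<Rightarrow> bool) \<Rightarrow> bool" where
  "alt e 0 P = P []"
| "alt e (Suc n) P = (if e then (\<exists>a. alt (\<not> e) n (\<lambda>as. P (a # as)))
                        else (\<forall>a. alt (\<not> e) n (\<lambda>as. P (a # as))))"

text \<open>Sigma^0_n (n >= 1): there is a recursive relation R on N^(n-1) x Sigma^* with
  L = {sigma | exists a1 Q2 a2 ... Qn an. (a1,...,a(n-1), sigma[an+1]) in R}.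
  Tuples and words are coded with list_encode.\<close>
definition arith_Sigma :: "nat \<Rightarrow> nat \<Rightarrow> (nat \<Rightarrow> nat) set \<Rightarrow> bool" where
  "arith_Sigma n k L \<longleftrightarrow> (\<exists>R. recursive_set R \<and>
     L = {\<sigma> \<in> omega_words k. alt True n (\<lambda>as.
            list_encode [list_encode (butlast as), list_encode (prefix \<sigma> (last as + 1))] \<in> R)})"

definition arith_Pi :: "nat \<Rightarrow> nat \<Rightarrow> (nat \<Rightarrow> nat) set \<Rightarrow> bool" where
  "arith_Pi n k L \<longleftrightarrow> L \<subseteq> omega_words k \<and> arith_Sigma n k (omega_words k - L)"

text \<open>Lightface Sigma^1_1 (Kleene normal form):
  L = {sigma | exists tau in N^N. forall m. (sigma[m], tau[m]) in R}, R recursive.\<close>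
definition Sigma11 :: "nat \<Rightarrow> (nat \<Rightarrow> nat) set \<Rightarrow> bool" where
  "Sigma11 k L \<longleftrightarrow> (\<exists>R. recursive_set R \<and>
     L = {\<sigma> \<in> omega_words k. \<exists>\<tau>::nat \<Rightarrow> nat. \<forall>m.
            list_encode [list_encode (prefix \<sigma> m), list_encode (prefix \<tau> m)] \<in> R})"

definition Pi11 :: "nat \<Rightarrow> (nat \<Rightarrow> nat) set \<Rightarrow> bool" where
  "Pi11 k L \<longleftrightarrow> L \<subseteq> omega_words k \<and> Sigma11 k (omega_words k - L)"

definition Delta11 :: "nat \<Rightarrow> (nat \<Rightarrow> nat) set \<Rightarrow> bool" where
  "Delta11 k L \<longleftrightarrow> Sigma11 k L \<and> Pi11 k L"

end

(* Blind counter automata detect, on a word coding a sequence of counter values as blocks 1^v t,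
   every illegitimate decrease of a value at once, but an illegitimate increase only in the long
   run: starting from a guessed counter value c, the automaton repeatedly pays a value v <= c and
   later regains its successor minus one, which is possible infinitely often iff infinitely many
   values below some bound increase illegitimately.  The words considered consist of infinitely many
   simulations ("rounds") of a register machine, limited by a fuel whose initial value has to tend to
   infinity.  If the machine halts, every word is accepted: from some round on, the values occurring
   in the halting computation are exact, so the simulation reaches the halting state.
   If it does not halt, correct words of unbounded rounds are rejected by all these tests.  Their
   rounds are then closed by blocks 1^p that insert the n-th element of a linear order on the
   naturals at position p, and a counter following a position accepts iff the order is ill-founded.
   If the complement of the language were analytic, the Kleene-Brouwer order of the tree of
   attempts to witness that the word itself lies in the complement could be used for this order; by
   a recursion along the prefixes this is no circularity, and the word would be accepted iff it
   is not.  Hence the language is either the set of all words or has a non-analytic complement, and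
   which is the case is undecidable since the machine may be given the code of (the main part of)
   the automaton as its input. *)

theory Submission
  imports Defs "HOL-Library.Countable" "HOL-Library.Infinite_Set"
begin

section \<open>Register machines computing recursive functions\<close>

text \<open>A blind counter can certify only inequalities \<open>c >= v\<close>, so every test
  spends the counter on one block and recovers it from a later one. This is why each insertion
  position is written twice, before a letter 2 and before a letter 3: subtracting the first copy
  proves that it is at most the counter, and the second copy restores the counter. It is also why an
  increase shows only as a transaction without loss, and only below the guessed value; this suffices
  because a halting computation is bounded. Fuel makes rounds finite although the machine diverges,
  and round n of a correct word gets fuel n, so that no guessed value can profit from short rounds
  forever. Self-reference meets the obstacle that states checking the input would belong to the code
  that they check. Therefore the input is the code \<open>X\<close> of the transition list
  \<open>base\<close> alone, which is fixed before \<open>X\<close> is. The states that count the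
  input block are determined by \<open>X\<close> and lie beyond those of \<open>base\<close>,
  because a list code exceeds its entries; hence the code of the whole automaton is a computable
  function of \<open>X\<close>.\<close>

datatype instr = Inc nat | While nat "instr list"

text \<open>A machine state is a continuation, the list of instructions that remain, so a loop body
  is simply prepended to its loop; \<open>While\<close> decrements its register on each entry into
  the body. Splitting a step into \<open>target\<close>, \<open>reg\<close> and \<open>delta\<close>
  separates the finite control from the register values, as the automaton requires.\<close>

fun target :: "instr list \<Rightarrow> bool \<Rightarrow> instr list" where
  "target [] b = []"
| "target (Inc r # K) b = K"
| "target (While r p # K) b = (if b then p @ While r p # K else K)"

fun reg :: "instr list \<Rightarrow> nat" where
  "reg [] = 0"
| "reg (Inc r # K) = r"
| "reg (While r p # K) = r"

fun delta :: "instr list \<Rightarrow> bool \<Rightarrow> int" where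
  "delta [] b = 0"
| "delta (Inc r # K) b = 1"
| "delta (While r p # K) b = (if b then -1 else 0)"

definition mstep :: "instr list \<times> (nat \<Rightarrow> nat) \<Rightarrow> instr list \<times> (nat \<Rightarrow> nat)" where
  "mstep = (\<lambda>(K, s). let v = s (reg K) in
     (target K (v > 0), s(reg K := nat (int v + delta K (v > 0)))))"

definition halts :: "instr list \<Rightarrow> (nat \<Rightarrow> nat) \<Rightarrow> bool" where
  "halts p s \<longleftrightarrow> (\<exists>n. fst ((mstep ^^ n) (p, s)) = [])"

abbreviation input :: "nat \<Rightarrow> nat \<Rightarrow> nat" where
  "input x \<equiv> \<lambda>i. if i = 0 then x else 0"

text \<open>Quantifying over the continuation \<open>K\<close> is what makes programs
  composable.\<close>

definition transforms :: "instr list \<Rightarrow> (nat \<Rightarrow> nat) \<Rightarrow> (nat \<Rightarrow> nat) \<Rightarrow> bool" where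
  "transforms p s s' \<longleftrightarrow> (\<forall>K. \<exists>n. (mstep ^^ n) (p @ K, s) = (K, s'))"

lemma mstep_simps [simp]:
  "mstep ([], s) = ([], s)"
  "mstep (Inc r # K, s) = (K, s(r := Suc (s r)))"
  "mstep (While r p # K, s) =
     (if s r = 0 then (K, s) else (p @ While r p # K, s(r := s r - 1)))"
  by (auto simp: mstep_def Let_def nat_add_distrib nat_diff_distrib')

lemma mstep_Nil: "(mstep ^^ n) ([], s) = ([], s)"
  by (induction n) auto

lemma transforms_eq: "transforms p s s' \<Longrightarrow> s' = s'' \<Longrightarrow> transforms p s s''"
  by simp

lemma transforms_Nil: "transforms [] s s"
  by (auto simp: transforms_def intro: exI[of _ 0])

lemma transforms_append:
  assumes "transforms p s s1" "transforms q s1 s2"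
  shows "transforms (p @ q) s s2"
  unfolding transforms_def
proof
  fix K
  obtain m where "(mstep ^^ m) (p @ (q @ K), s) = (q @ K, s1)"
    using assms(1) unfolding transforms_def by blast
  moreover obtain n where "(mstep ^^ n) (q @ K, s1) = (K, s2)"
    using assms(2) unfolding transforms_def by blast
  ultimately have "(mstep ^^ (n + m)) ((p @ q) @ K, s) = (K, s2)"
    by (simp add: funpow_add)
  then show "\<exists>n. (mstep ^^ n) ((p @ q) @ K, s) = (K, s2)" ..
qed

lemma transforms_Inc: "transforms [Inc r] s (s(r := Suc (s r)))"
  by (auto simp: transforms_def intro!: exI[of _ "Suc 0"])

lemma transforms_While_0: "s r = 0 \<Longrightarrow> transforms [While r p] s s"
  by (auto simp: transforms_def intro!: exI[of _ "Suc 0"])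

lemma transforms_While_Suc:
  assumes "s r = Suc m" "transforms p (s(r := m)) s1" "transforms [While r p] s1 s2"
  shows "transforms [While r p] s s2"
  unfolding transforms_def
proof
  fix K
  have "transforms (p @ [While r p]) (s(r := m)) s2"
    using assms(2,3) by (rule transforms_append)
  then obtain n where "(mstep ^^ n) ((p @ [While r p]) @ K, s(r := m)) = (K, s2)"
    unfolding transforms_def by blast
  with assms(1) have "(mstep ^^ (Suc n)) ([While r p] @ K, s) = (K, s2)"
    by (simp add: funpow_Suc_right del: funpow.simps)
  then show "\<exists>n. (mstep ^^ n) ([While r p] @ K, s) = (K, s2)" ..
qed

lemma transforms_clear: "transforms [While r []] s (s(r := 0))"
proof (induction "s r" arbitrary: s)
  case 0
  then show ?case by (intro transforms_eq[OF transforms_While_0]) auto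
next
  case (Suc m)
  from Suc(1)[of "s(r := m)"] show ?case
    by (intro transforms_While_Suc[of s r m, OF Suc(2)[symmetric] transforms_Nil]) simp
qed

lemma transforms_move:
  assumes "r \<noteq> d"
  shows "transforms [While r [Inc d]] s (s(r := 0, d := s d + s r))"
proof (induction "s r" arbitrary: s)
  case 0
  then have "s(r := 0, d := s d + s r) = s" by auto
  with 0 show ?case by (intro transforms_eq[OF transforms_While_0]) auto
next
  case (Suc m)
  let ?s = "(s(r := m))(d := Suc (s d))"
  have "transforms [Inc d] (s(r := m)) ?s"
    using transforms_Inc[of d "s(r := m)"] assms by simp
  moreover have "transforms [While r [Inc d]] ?s (?s(r := 0, d := ?s d + ?s r))"
    by (rule Suc(1)) (use assms in simp)
  moreover have "?s(r := 0, d := ?s d + ?s r) = s(r := 0, d := s d + s r)"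
    using assms Suc(2)[symmetric] by auto
  ultimately show ?case
    by (intro transforms_While_Suc[of s r m, OF Suc(2)[symmetric]]) simp_all
qed

text \<open>A loop destroys the register that it tests, so a copy needs the scratch register
  \<open>t\<close> from which the original is restored.\<close>

lemma transforms_copy:
  assumes "a \<noteq> d" "a \<noteq> t" "d \<noteq> t" "s t = 0"
  shows "transforms ([While a [Inc d, Inc t]] @ [While t [Inc a]]) s (s(d := s d + s a))"
proof -
  have 1: "transforms [While a [Inc d, Inc t]] s (s(a := 0, d := s d + s a, t := s t + s a))" for s
  proof (induction "s a" arbitrary: s)
    case 0
    then have "s(a := 0, d := s d + s a, t := s t + s a) = s" by auto
    with 0 show ?case by (intro transforms_eq[OF transforms_While_0]) auto
  next
    case (Suc m)
    let ?s = "s(a := m, d := Suc (s d), t := Suc (s t))"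
    have "transforms ([Inc d] @ [Inc t]) (s(a := m)) ?s"
      using transforms_append[OF transforms_Inc[of d "s(a := m)"] transforms_Inc[of t]] assms by simp
    moreover have "transforms [While a [Inc d, Inc t]] ?s
        (?s(a := 0, d := ?s d + ?s a, t := ?s t + ?s a))"
      by (rule Suc(1)) (use assms in simp)
    moreover have "?s(a := 0, d := ?s d + ?s a, t := ?s t + ?s a)
        = s(a := 0, d := s d + s a, t := s t + s a)"
      using assms Suc(2)[symmetric] by auto
    ultimately show ?case
      by (intro transforms_While_Suc[of s a m, OF Suc(2)[symmetric]]) simp_all
  qed
  let ?s = "s(a := 0, d := s d + s a, t := s t + s a)"
  have "transforms [While t [Inc a]] ?s (?s(t := 0, a := ?s a + ?s t))"
    by (rule transforms_move) (use assms in simp)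
  moreover have "?s(t := 0, a := ?s a + ?s t) = s(d := s d + s a)"
    using assms by auto
  ultimately show ?thesis by (intro transforms_append[OF 1[of s]]) (simp only:)
qed

text \<open>The arguments survive, and the registers from \<open>n\<close> on are scratch space that
  is zero before and after, so calls nest by raising \<open>n\<close>. Nothing is claimed where
  \<open>f\<close> is undefined.\<close>

definition implements :: "instr list \<Rightarrow> recf \<Rightarrow> nat list \<Rightarrow> nat \<Rightarrow> nat \<Rightarrow> bool" where
  "implements p f as d n \<longleftrightarrow> (\<forall>s y. eval f (map s as) y \<longrightarrow> s d = 0 \<longrightarrow> (\<forall>i\<ge>n. s i = 0)
     \<longrightarrow> transforms p s (s(d := y)))"

lemma implementsD:
  assumes "implements p f as d n" "eval f xs y" "map s as = xs" "s d = 0" "\<And>i. i \<ge> n \<Longrightarrow> s i = 0"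
  shows "transforms p s (s(d := y))"
  using assms unfolding implements_def by blast

definition compilable :: "recf \<Rightarrow> bool" where
  "compilable f \<longleftrightarrow> (\<forall>as d n. d < n \<longrightarrow> d \<notin> set as \<longrightarrow> (\<forall>a\<in>set as. a < n) \<longrightarrow>
     (\<exists>p. implements p f as d n))"

lemma compilableD:
  assumes "compilable f" "d < n" "d \<notin> set as" "\<And>a. a \<in> set as \<Longrightarrow> a < n"
  obtains p where "implements p f as d n"
  using assms unfolding compilable_def by blast

lemma compilable_copy:
  assumes "d < n" "d \<notin> set as" "\<forall>a\<in>set as. a < n" "i < length as" "s d = 0" "\<forall>i\<ge>n. s i = 0"
  shows "transforms ([While (as!i) [Inc d, Inc n]] @ [While n [Inc (as!i)]]) s (s(d := map s as ! i))"
proof -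
  have "as ! i \<in> set as" using assms(4) by simp
  then have "as ! i \<noteq> d" "as ! i \<noteq> n" using assms(2,3) by auto
  then show ?thesis using transforms_copy[of "as!i" d n s] assms by simp
qed

section \<open>Compilation by induction on the recursive function\<close>

inductive_cases eval_ZfE: "eval Zf xs y"
inductive_cases eval_SfE: "eval Sf xs y"
inductive_cases eval_ProjE: "eval (Proj i) xs y"
inductive_cases eval_CompE: "eval (Comp f gs) xs y"
inductive_cases eval_Prec0E: "eval (Prec f g) (0 # xs) y"
inductive_cases eval_PrecSE: "eval (Prec f g) (Suc k # xs) y"
inductive_cases eval_PrecE: "eval (Prec f g) xs y"
inductive_cases eval_MnE: "eval (Mn f) xs y"

lemma compilable_Zf: "compilable Zf"
  unfolding compilable_def implements_def
  by (auto elim!: eval_ZfE intro!: exI[of _ "[]"] transforms_eq[OF transforms_Nil])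

lemma compilable_Sf: "compilable Sf"
  unfolding compilable_def
proof (intro allI impI)
  fix as :: "nat list" and d n
  assume *: "d < n" "d \<notin> set as" "\<forall>a\<in>set as. a < n"
  let ?p = "[While (as!0) [Inc d, Inc n]] @ [While n [Inc (as!0)]]"
  have "implements (?p @ [Inc d]) Sf as d n"
    unfolding implements_def
  proof (intro allI impI)
    fix s y assume e: "eval Sf (map s as) y" and s: "s d = 0" "\<forall>i\<ge>n. s i = 0"
    from e obtain x xs where x: "map s as = x # xs" "y = Suc x" by (auto elim: eval_SfE)
    then have l: "0 < length as" by (cases as) auto
    show "transforms (?p @ [Inc d]) s (s(d := y))"
      using transforms_append[OF compilable_copy[OF * l s] transforms_Inc[of d]] x by simp
  qed
  then show "\<exists>p. implements p Sf as d n" ..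
qed

lemma compilable_Proj: "compilable (Proj i)"
  unfolding compilable_def
proof (intro allI impI)
  fix as :: "nat list" and d n
  assume *: "d < n" "d \<notin> set as" "\<forall>a\<in>set as. a < n"
  have "implements ([While (as!i) [Inc d, Inc n]] @ [While n [Inc (as!i)]]) (Proj i) as d n"
    unfolding implements_def
  proof (intro allI impI)
    fix s y assume e: "eval (Proj i) (map s as) y" and s: "s d = 0" "\<forall>i\<ge>n. s i = 0"
    then have l: "i < length as" and "y = map s as ! i" by (auto elim: eval_ProjE)
    then show "transforms ([While (as!i) [Inc d, Inc n]] @ [While n [Inc (as!i)]]) s (s(d := y))"
      using compilable_copy[OF * l s] by simp
  qed
  then show "\<exists>p. implements p (Proj i) as d n" ..
qed

lemma transforms_clear_list: "\<exists>p. \<forall>s. transforms p s (\<lambda>i. if i \<in> set as then 0 else s i)"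
proof (induction as)
  case Nil
  then show ?case by (auto intro: exI[of _ "[]"] transforms_Nil)
next
  case (Cons a as)
  then obtain p where p: "\<And>s. transforms p s (\<lambda>i. if i \<in> set as then 0 else s i)" by blast
  have "transforms ([While a []] @ p) s (\<lambda>i. if i \<in> set (a # as) then 0 else s i)" for s
  proof -
    have "(\<lambda>i. if i \<in> set as then 0 else (s(a := 0)) i) = (\<lambda>i. if i \<in> set (a # as) then 0 else s i)"
      by auto
    then show ?thesis by (intro transforms_append[OF transforms_clear[of a s] transforms_eq[OF p]])
  qed
  then show ?case by blast
qed

text \<open>Induction from the right end: each result stays in the lowest scratch register, and the
  next call begins its scratch space one register higher.\<close>

lemma implements_list:
  assumes "\<forall>g\<in>set gs. compilable g" "\<forall>a\<in>set as. a < n" "n + length gs \<le> N"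
  shows "\<exists>p. \<forall>s ys. list_all2 (\<lambda>g y. eval g (map s as) y) gs ys \<longrightarrow> (\<forall>i\<ge>n. s i = 0) \<longrightarrow>
     transforms p s (\<lambda>i. if n \<le> i \<and> i < n + length gs then ys ! (i - n) else s i)"
  using assms(1,3)
proof (induction gs rule: rev_induct)
  case Nil
  then show ?case by (auto intro!: exI[of _ "[]"] transforms_eq[OF transforms_Nil])
next
  case (snoc g gs)
  from snoc.IH snoc.prems obtain p where p: "\<And>s ys. list_all2 (\<lambda>g y. eval g (map s as) y) gs ys \<Longrightarrow>
      (\<forall>i\<ge>n. s i = 0) \<Longrightarrow>
     transforms p s (\<lambda>i. if n \<le> i \<and> i < n + length gs then ys ! (i - n) else s i)" by force
  have g: "compilable g" using snoc.prems by simp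
  let ?d = "n + length gs"
  have "\<forall>a\<in>set as. a < Suc ?d" "?d \<notin> set as" using assms(2) by force+
  then obtain q where q: "implements q g as ?d (Suc ?d)"
    using compilableD[OF g, of ?d "Suc ?d" as] by blast
  show ?case
  proof (intro exI[of _ "p @ q"] allI impI)
    fix s ys assume e: "list_all2 (\<lambda>g y. eval g (map s as) y) (gs @ [g]) ys" and z: "\<forall>i\<ge>n. s i = 0"
    then obtain ys' y where ys: "ys = ys' @ [y]" "list_all2 (\<lambda>g y. eval g (map s as) y) gs ys'"
      "eval g (map s as) y"
      by (auto simp: list_all2_append1 list_all2_Cons1)
    then have l: "length ys' = length gs" by (simp add: list_all2_lengthD)
    let ?s = "\<lambda>i. if n \<le> i \<and> i < n + length gs then ys' ! (i - n) else s i"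
    have "map ?s as = map s as" using assms(2) by auto
    then have "transforms q ?s (?s(?d := y))"
      by (rule implementsD[OF q ys(3)]) (use z in auto)
    moreover have "?s(?d := y) = (\<lambda>i. if n \<le> i \<and> i < n + length (gs @ [g]) then ys ! (i - n) else s i)"
      using l by (auto simp: ys nth_append fun_eq_iff)
    ultimately show "transforms (p @ q) s (\<lambda>i. if n \<le> i \<and> i < n + length (gs @ [g]) then ys ! (i - n) else s i)"
      by (intro transforms_append[OF p[OF ys(2) z]]) (simp only:)
  qed
qed

lemma compilable_Comp:
  assumes f: "compilable f" and gs: "\<forall>g\<in>set gs. compilable g"
  shows "compilable (Comp f gs)"
  unfolding compilable_def
proof (intro allI impI)
  fix as :: "nat list" and d n
  assume *: "d < n" "d \<notin> set as" "\<forall>a\<in>set as. a < n"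
  let ?N = "n + length gs"
  let ?bs = "[n..<?N]"
  obtain p where p: "\<And>s ys. list_all2 (\<lambda>g y. eval g (map s as) y) gs ys \<Longrightarrow> (\<forall>i\<ge>n. s i = 0) \<Longrightarrow>
     transforms p s (\<lambda>i. if n \<le> i \<and> i < ?N then ys ! (i - n) else s i)"
    using implements_list[OF gs *(3) order_refl] by blast
  obtain q where q: "implements q f ?bs d ?N"
    by (rule compilableD[OF f, of d ?N ?bs]) (use *(1) in auto)
  obtain r where r: "\<And>s. transforms r s (\<lambda>i. if i \<in> set ?bs then 0 else s i)"
    using transforms_clear_list by blast
  have "implements (p @ q @ r) (Comp f gs) as d n"
    unfolding implements_def
  proof (intro allI impI)
    fix s y assume e: "eval (Comp f gs) (map s as) y" and s: "s d = 0" "\<forall>i\<ge>n. s i = 0"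
    then obtain ys where ys: "list_all2 (\<lambda>g y. eval g (map s as) y) gs ys" "eval f ys y"
      by (auto elim: eval_CompE)
    then have l: "length ys = length gs" by (simp add: list_all2_lengthD)
    let ?s = "\<lambda>i. if n \<le> i \<and> i < ?N then ys ! (i - n) else s i"
    have "map ?s ?bs = ys" by (rule nth_equalityI) (auto simp: l)
    then have "transforms q ?s (?s(d := y))"
      by (rule implementsD[OF q ys(2)]) (use s *(1) in auto)
    moreover have "(\<lambda>i. if i \<in> set ?bs then 0 else (?s(d := y)) i) = s(d := y)"
      using *(1) s by (auto simp: fun_eq_iff)
    ultimately show "transforms (p @ q @ r) s (s(d := y))"
      by (intro transforms_append[OF p[OF ys(1) s(2)]] transforms_append[OF _ transforms_eq[OF r[of "?s(d := y)"]]])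
  qed
  then show "\<exists>p. implements p (Comp f gs) as d n" ..
qed

lemma eval_Prec_trace:
  "eval (Prec f g) (k # xs) y \<Longrightarrow>
    \<exists>Y. Y k = y \<and> eval f xs (Y 0) \<and> (\<forall>i<k. eval g (Y i # i # xs) (Y (Suc i)))"
proof (induction k arbitrary: y)
  case 0
  then show ?case by (auto elim!: eval_Prec0E intro!: exI[of _ "\<lambda>_. y"])
next
  case (Suc k)
  from Suc.prems obtain z where z: "eval (Prec f g) (k # xs) z" "eval g (z # k # xs) y"
    by (auto elim: eval_PrecSE)
  from Suc.IH[OF z(1)] obtain Y where "Y k = z" "eval f xs (Y 0)"
    "\<forall>i<k. eval g (Y i # i # xs) (Y (Suc i))" by blast
  with z(2) show ?case by (intro exI[of _ "Y(Suc k := y)"]) (auto simp: less_Suc_eq)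
qed

lemma compilable_Prec:
  assumes f: "compilable f" and g: "compilable g"
  shows "compilable (Prec f g)"
  unfolding compilable_def
proof (intro allI impI)
  fix as :: "nat list" and d n
  assume *: "d < n" "d \<notin> set as" "\<forall>a\<in>set as. a < n"
  show "\<exists>p. implements p (Prec f g) as d n"
  proof (cases as)
    case Nil
    then have "implements [] (Prec f g) as d n" unfolding implements_def by (auto elim: eval_PrecE)
    then show ?thesis ..
  next
    case (Cons a bs)
    \<comment> \<open>\<open>cnt\<close> counts upwards as the recursion argument of
      \<open>g\<close>, \<open>rem\<close> is a copy of the argument that the loop consumes,
      \<open>ac\<close> holds the current value, and \<open>tmp\<close> receives the next one
      because \<open>g\<close> must not write into its own argument.\<close>
    define cnt where "cnt = n"
    define ac where "ac = n + 1"
    define tmp where "tmp = n + 2"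
    define rem where "rem = n + 3"
    define N where "N = n + 4"
    note defs = cnt_def ac_def tmp_def rem_def N_def
    have bs: "a < n" "\<forall>b\<in>set bs. b < n" "a \<noteq> d" "d \<notin> set bs" using * Cons by auto
    obtain pf where pf: "implements pf f bs ac N"
      by (rule compilableD[OF f, of ac N bs]) (use bs(2) in \<open>auto simp: defs dest!: bspec\<close>)
    obtain pg where pg: "implements pg g (ac # cnt # bs) tmp N"
      by (rule compilableD[OF g, of tmp N "ac # cnt # bs"])
        (use bs(2) in \<open>auto simp: defs dest!: bspec\<close>)
    let ?body = "pg @ [While ac []] @ [While tmp [Inc ac]] @ [Inc cnt]"
    let ?cp = "[While a [Inc rem, Inc N]] @ [While N [Inc a]]"
    let ?p = "?cp @ pf @ [While rem ?body] @ [While ac [Inc d]] @ [While cnt []]"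
    have "implements ?p (Prec f g) as d n"
      unfolding implements_def
    proof (intro allI impI)
      fix s y assume e: "eval (Prec f g) (map s as) y" and s: "s d = 0" "\<forall>i\<ge>n. s i = 0"
      define k where "k = s a"
      let ?xs = "map s bs"
      from e Cons have "eval (Prec f g) (k # ?xs) y" by (simp add: k_def)
      from eval_Prec_trace[OF this] obtain Y where Y: "Y k = y" "eval f ?xs (Y 0)"
        "\<And>i. i < k \<Longrightarrow> eval g (Y i # i # ?xs) (Y (Suc i))" by blast
      have z: "s cnt = 0" "s ac = 0" "s tmp = 0" "s rem = 0" "\<forall>i\<ge>N. s i = 0"
        using s(2) by (auto simp: defs)
      define S where "S i = s(rem := k - i, ac := Y i, cnt := i)" for i
      have 1: "transforms ?cp s (s(rem := k))"
        using transforms_copy[of a rem N s] bs(1) z by (auto simp: defs k_def)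
      have mp: "map (s(rem := k)) bs = ?xs" using bs by (auto simp: defs)
      have "transforms pf (s(rem := k)) ((s(rem := k))(ac := Y 0))"
        by (rule implementsD[OF pf Y(2) mp]) (use z in \<open>auto simp: defs\<close>)
      moreover have "(s(rem := k))(ac := Y 0) = S 0" using z by (auto simp: S_def fun_eq_iff defs)
      ultimately have 2: "transforms pf (s(rem := k)) (S 0)" by simp
      have body: "transforms ?body ((S i)(rem := k - Suc i)) (S (Suc i))" if "i < k" for i
      proof -
        let ?s = "(S i)(rem := k - Suc i)"
        have "map ?s (ac # cnt # bs) = Y i # i # ?xs"
          using bs by (auto simp: defs S_def)
        then have a: "transforms pg ?s (?s(tmp := Y (Suc i)))"
          by (rule implementsD[OF pg Y(3)[OF that]]) (use z in \<open>auto simp: S_def defs\<close>)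
        let ?t = "?s(tmp := Y (Suc i), ac := 0)"
        have b: "transforms [While ac []] (?s(tmp := Y (Suc i))) ?t"
          by (rule transforms_clear)
        have c: "transforms [While tmp [Inc ac]] ?t (?t(tmp := 0, ac := ?t ac + ?t tmp))"
          by (rule transforms_move) (simp add: defs)
        have d: "transforms [Inc cnt] (?t(tmp := 0, ac := ?t ac + ?t tmp))
          ((?t(tmp := 0, ac := ?t ac + ?t tmp))(cnt := Suc i))"
          using transforms_Inc[of cnt "?t(tmp := 0, ac := ?t ac + ?t tmp)"] by (simp add: S_def defs)
        have "(?t(tmp := 0, ac := ?t ac + ?t tmp))(cnt := Suc i) = S (Suc i)"
          using z by (auto simp: S_def defs fun_eq_iff)
        with d have d: "transforms [Inc cnt] (?t(tmp := 0, ac := ?t ac + ?t tmp)) (S (Suc i))"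
          by (simp only:)
        show ?thesis
          by (rule transforms_append[OF a transforms_append[OF b transforms_append[OF c d]]])
      qed
      have 3: "transforms [While rem ?body] (S i) (S k)" if "i \<le> k" for i
        using that
      proof (induction rule: inc_induct)
        case base
        show ?case by (rule transforms_While_0) (simp add: S_def defs)
      next
        case (step i)
        have "S i rem = Suc (k - Suc i)" using step by (simp add: S_def defs)
        from transforms_While_Suc[of "S i" rem, OF this body[OF step(2)] step(3)] show ?case .
      qed
      let ?u = "(S k)(ac := 0, d := S k d + S k ac)"
      have 4: "transforms [While ac [Inc d]] (S k) ?u"
        by (rule transforms_move) (use * in \<open>simp add: defs\<close>)
      have "?u(cnt := 0) = s(d := y)"
        using Y(1) z s * by (auto simp: S_def defs fun_eq_iff)
      with transforms_clear[of cnt ?u] have 5: "transforms [While cnt []] ?u (s(d := y))"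
        by (simp only:)
      show "transforms ?p s (s(d := y))"
        by (rule transforms_append[OF 1 transforms_append[OF 2
              transforms_append[OF 3[of 0] transforms_append[OF 4 5]]]]) simp
    qed
    then show ?thesis ..
  qed
qed

lemma compilable_Mn:
  assumes f: "compilable f"
  shows "compilable (Mn f)"
  unfolding compilable_def
proof (intro allI impI)
  fix as :: "nat list" and d n
  assume *: "d < n" "d \<notin> set as" "\<forall>a\<in>set as. a < n"
  define tmp where "tmp = n + 1"
  define N where "N = n + 2"
  note defs = tmp_def N_def
  obtain pf where pf: "implements pf f (n # as) tmp N"
    by (rule compilableD[OF f, of tmp N "n # as"]) (use * in \<open>auto simp: defs dest!: bspec\<close>)
  let ?body = "[While tmp []] @ [Inc n] @ pf"
  let ?p = "pf @ [While tmp ?body] @ [While n [Inc d]]"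
  have "implements ?p (Mn f) as d n"
    unfolding implements_def
  proof (intro allI impI)
    fix s k assume e: "eval (Mn f) (map s as) k" and s: "s d = 0" "\<forall>i\<ge>n. s i = 0"
    let ?xs = "map s as"
    from e have k: "eval f (k # ?xs) 0" "\<forall>m<k. \<exists>y. eval f (m # ?xs) y \<and> y \<noteq> 0"
      by (auto elim: eval_MnE)
    from k(2) obtain Y' where Y': "\<And>m. m < k \<Longrightarrow> eval f (m # ?xs) (Y' m) \<and> Y' m \<noteq> 0" by metis
    define Y where "Y = Y'(k := 0)"
    have Y: "eval f (m # ?xs) (Y m)" if "m \<le> k" for m using that k(1) Y' by (auto simp: Y_def)
    have Yk: "Y k = 0" "\<And>m. m < k \<Longrightarrow> Y m \<noteq> 0" using Y' by (auto simp: Y_def)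
    define S where "S i = s(n := i, tmp := Y i)" for i
    have call: "transforms pf (s(n := i)) (S i)" if "i \<le> k" for i
    proof -
      have "map (s(n := i)) (n # as) = i # ?xs" using * by auto
      then show ?thesis
        unfolding S_def by (rule implementsD[OF pf Y[OF that]]) (use s in \<open>auto simp: defs\<close>)
    qed
    have 1: "transforms pf s (S 0)" using call[of 0] s(2) by (simp add: fun_upd_idem)
    have loop: "transforms [While tmp ?body] (S i) (S k)" if "i \<le> k" for i
      using that
    proof (induction rule: inc_induct)
      case base
      show ?case by (rule transforms_While_0) (simp add: S_def defs Yk)
    next
      case (step i)
      obtain m where m: "S i tmp = Suc m" using Yk(2)[OF step(2)] by (auto simp: S_def gr0_conv_Suc)
      let ?s = "(S i)(tmp := m)"
      have z: "s tmp = 0" using s by (simp add: defs)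
      have "?s(tmp := 0) = s(n := i)" using z by (auto simp: S_def defs)
      with transforms_clear[of tmp ?s] have a: "transforms [While tmp []] ?s (s(n := i))" by (simp only:)
      have b: "transforms [Inc n] (s(n := i)) (s(n := Suc i))"
        using transforms_Inc[of n "s(n := i)"] by simp
      have "transforms ?body ?s (S (Suc i))"
        by (rule transforms_append[OF a transforms_append[OF b call]]) (use step in simp)
      from transforms_While_Suc[of "S i" tmp, OF m this step(3)] show ?case .
    qed
    have "transforms [While n [Inc d]] (S k) ((S k)(n := 0, d := S k d + S k n))"
      by (rule transforms_move) (use * in simp)
    moreover have "(S k)(n := 0, d := S k d + S k n) = s(d := k)"
      using s * Yk(1) by (auto simp: S_def defs fun_eq_iff)
    ultimately have 2: "transforms [While n [Inc d]] (S k) (s(d := k))" by (simp only:)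
    show "transforms ?p s (s(d := k))"
      by (rule transforms_append[OF 1 transforms_append[OF loop 2]]) simp
  qed
  then show "\<exists>p. implements p (Mn f) as d n" ..
qed

lemma compilable: "compilable f"
  by (induction f) (auto intro: compilable_Zf compilable_Sf compilable_Proj compilable_Comp
      compilable_Prec compilable_Mn)

lemma diverges:
  assumes "s r > 0"
  shows "\<exists>K s'. K \<noteq> [] \<and> (mstep ^^ n) ([While r [Inc r]], s) = (K, s')"
proof -
  have "\<exists>s'. (mstep ^^ n) ([While r [Inc r]], s) = ([While r [Inc r]], s') \<and> s' r > 0
     \<or> (mstep ^^ n) ([While r [Inc r]], s) = ([Inc r, While r [Inc r]], s')"
    by (induction n) (use assms in auto)
  then show ?thesis by auto
qed

text \<open>Turns an answer into halting behaviour: the value is computed into register 1, and a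
  final loop that undoes its own decrement runs forever exactly if the value is nonzero.\<close>

lemma machine_for_zero_test:
  assumes h: "\<And>x. eval f [x] (h x)"
  shows "\<exists>p. \<forall>x. halts p (input x) \<longleftrightarrow> h x = 0"
proof -
  obtain p where p: "implements p f [0] 1 2"
    by (rule compilableD[OF compilable, of 1 2 "[0]" f]) auto
  have "halts (p @ [While 1 [Inc 1]]) (input x) \<longleftrightarrow> h x = 0" for x
  proof -
    let ?s = "input x"
    let ?q = "[While 1 [Inc 1]]"
    let ?t = "?s(1 := h x)"
    have "transforms p ?s ?t" by (rule implementsD[OF p h]) auto
    then obtain m where m: "(mstep ^^ m) (p @ ?q, ?s) = (?q, ?t)"
      unfolding transforms_def by blast
    show ?thesis
    proof
      assume "halts (p @ ?q) ?s"
      then obtain n where n: "fst ((mstep ^^ n) (p @ ?q, ?s)) = []" unfolding halts_def by blast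
      \<comment> \<open>A halted state is fixed, so it stays halted for \<open>m\<close> more steps;
        counted in the other order, the same steps first arrive at the loop.\<close>
      have "(mstep ^^ (m + n)) (p @ ?q, ?s) = (mstep ^^ m) ((mstep ^^ n) (p @ ?q, ?s))"
        by (simp add: funpow_add)
      then have 1: "fst ((mstep ^^ (n + m)) (p @ ?q, ?s)) = []"
        using n mstep_Nil[of m] by (cases "(mstep ^^ n) (p @ ?q, ?s)") (simp add: add.commute)
      show "h x = 0"
      proof (rule ccontr)
        assume "h x \<noteq> 0"
        then have "?t 1 > 0" by simp
        from diverges[of ?t 1 n, OF this] m 1 show False
          by (auto simp: funpow_add simp del: fun_upd_apply)
      qed
    next
      assume h0: "h x = 0"
      have "fst (mstep (?q, ?t)) = []" using h0 by simp
      then have "fst ((mstep ^^ (Suc m)) (p @ ?q, ?s)) = []" using m by simp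
      then show "halts (p @ ?q) ?s" unfolding halts_def by blast
    qed
  qed
  then show ?thesis by blast
qed

section \<open>Computing the code of an automaton from the code of its fixed part\<close>

definition computable :: "nat \<Rightarrow> (nat list \<Rightarrow> nat) \<Rightarrow> bool" where
  "computable k f \<longleftrightarrow> (\<exists>p. \<forall>xs. length xs = k \<longrightarrow> eval p xs (f xs))"

lemma computable_nth: "i < k \<Longrightarrow> computable k (\<lambda>xs. xs ! i)"
  unfolding computable_def by (auto intro!: exI[of _ "Proj i"] ev_Proj)

lemma computable_comp1:
  assumes "computable 1 (\<lambda>xs. F (xs ! 0))" "computable k f"
  shows "computable k (\<lambda>xs. F (f xs))"
proof -
  obtain p q where "\<And>xs. length xs = 1 \<Longrightarrow> eval p xs (F (xs ! 0))"
    and "\<And>xs. length xs = k \<Longrightarrow> eval q xs (f xs)"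
    using assms unfolding computable_def by blast
  then have "length xs = k \<longrightarrow> eval (Comp p [q]) xs (F (f xs))" for xs
    by (auto intro!: ev_Comp[where ys = "[f xs]"]) (metis One_nat_def length_Cons list.size(3) nth_Cons_0)
  then show ?thesis unfolding computable_def by blast
qed

lemma computable_comp2:
  assumes "computable 2 (\<lambda>xs. F (xs ! 0) (xs ! 1))" "computable k f" "computable k g"
  shows "computable k (\<lambda>xs. F (f xs) (g xs))"
proof -
  obtain p q r where p: "\<And>xs. length xs = 2 \<Longrightarrow> eval p xs (F (xs ! 0) (xs ! 1))"
    and "\<And>xs. length xs = k \<Longrightarrow> eval q xs (f xs)" "\<And>xs. length xs = k \<Longrightarrow> eval r xs (g xs)"
    using assms unfolding computable_def by blast
  then have "length xs = k \<longrightarrow> eval (Comp p [q, r]) xs (F (f xs) (g xs))" for xs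
    using p[of "[f xs, g xs]"] by (auto intro!: ev_Comp[where ys = "[f xs, g xs]"])
  then show ?thesis unfolding computable_def by blast
qed

lemma computable_Suc:
  assumes "computable k f"
  shows "computable k (\<lambda>xs. Suc (f xs))"
proof -
  have "computable 1 (\<lambda>xs. Suc (xs ! 0))"
    unfolding computable_def by (auto intro!: exI[of _ Sf] ev_S simp: length_Suc_conv)
  from computable_comp1[OF this assms] show ?thesis .
qed

lemma computable_const: "computable k (\<lambda>xs. c)"
proof (induction c)
  case 0
  show ?case unfolding computable_def by (auto intro: exI[of _ Zf] ev_Z)
next
  case (Suc c)
  then show ?case by (rule computable_Suc)
qed

lemma computable_rec:
  assumes "computable k f" "computable (Suc (Suc k)) g"
  shows "computable (Suc k) (\<lambda>xs. rec_nat (f (tl xs)) (\<lambda>n y. g (y # n # tl xs)) (hd xs))"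
proof -
  obtain p q where p: "\<And>xs. length xs = k \<Longrightarrow> eval p xs (f xs)"
    and q: "\<And>xs. length xs = Suc (Suc k) \<Longrightarrow> eval q xs (g xs)"
    using assms unfolding computable_def by blast
  have "eval (Prec p q) (m # xs) (rec_nat (f xs) (\<lambda>n y. g (y # n # xs)) m)"
    if "length xs = k" for m xs
    by (induction m) (use that p q in \<open>auto intro!: ev_Prec0 ev_PrecS\<close>)
  then have "length xs = Suc k \<longrightarrow>
      eval (Prec p q) xs (rec_nat (f (tl xs)) (\<lambda>n y. g (y # n # tl xs)) (hd xs))" for xs
    by (cases xs) auto
  then show ?thesis unfolding computable_def by blast
qed

lemma computable_cong:
  "computable k f \<Longrightarrow> (\<And>xs. length xs = k \<Longrightarrow> f xs = g xs) \<Longrightarrow> computable k g"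
  unfolding computable_def by metis

lemma computable_add:
  assumes "computable k f" "computable k g"
  shows "computable k (\<lambda>xs. f xs + g xs)"
proof -
  have 1: "computable (Suc (Suc 0)) (\<lambda>xs. rec_nat (tl xs ! 0) (\<lambda>n y. Suc ((y # n # tl xs) ! 0)) (hd xs))"
    by (rule computable_rec[where f = "\<lambda>xs. xs ! 0" and g = "\<lambda>xs. Suc (xs ! 0)"])
      (auto intro: computable_Suc computable_nth)
  have 2: "rec_nat b (\<lambda>n y. Suc ((y # n # zs) ! 0)) a = a + b" for a b :: nat and zs
    by (induction a) auto
  have "computable 2 (\<lambda>xs. xs ! 0 + xs ! 1)"
    unfolding numeral_2_eq_2 by (rule computable_cong[OF 1]) (use 2 in \<open>auto simp: length_Suc_conv\<close>)
  from computable_comp2[OF this assms] show ?thesis .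
qed

lemma computable_prod_encode:
  assumes "computable k f" "computable k g"
  shows "computable k (\<lambda>xs. prod_encode (f xs, g xs))"
proof -
  have 1: "computable (Suc 0) (\<lambda>xs. rec_nat 0 (\<lambda>n y. (y # n # tl xs) ! 0 + Suc ((y # n # tl xs) ! 1)) (hd xs))"
    by (rule computable_rec[where f = "\<lambda>xs. 0" and g = "\<lambda>xs. xs ! 0 + Suc (xs ! 1)"])
      (intro computable_add computable_Suc computable_nth computable_const; simp)+
  have 2: "rec_nat 0 (\<lambda>n y. (y # n # zs) ! 0 + Suc ((y # n # zs) ! 1)) a = triangle a" for a zs
    by (induction a) auto
  have t: "computable 1 (\<lambda>xs. triangle (xs ! 0))"
    unfolding One_nat_def by (rule computable_cong[OF 1]) (use 2 in \<open>auto simp: length_Suc_conv\<close>)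
  have "computable k (\<lambda>xs. triangle (f xs + g xs) + f xs)"
    by (intro computable_add computable_comp1[OF t] assms)
  then show ?thesis by (simp add: prod_encode_def)
qed

definition cons_code :: "nat \<Rightarrow> nat \<Rightarrow> nat" where
  "cons_code x y = Suc (prod_encode (x, y))"

lemma list_encode_Cons: "list_encode (x # xs) = cons_code x (list_encode xs)"
  by (simp add: cons_code_def)

lemma computable_cons_code:
  "computable k f \<Longrightarrow> computable k g \<Longrightarrow> computable k (\<lambda>xs. cons_code (f xs) (g xs))"
  unfolding cons_code_def by (intro computable_Suc computable_prod_encode)

text \<open>State numbers: 0 is an accepting sink, 5 is entered at the beginning of an input block,
  and \<open>X + i\<close> is the state after \<open>i\<close> tally letters of that block; the sink is reached
  iff the block is not \<open>1\<^sup>X 0\<close>.\<close>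
fun chain :: "nat \<Rightarrow> (nat \<times> nat \<times> nat \<times> nat) list \<Rightarrow> nat \<Rightarrow> (nat \<times> nat \<times> nat \<times> nat) list" where
  "chain X base 0 = base"
| "chain X base (Suc i) = (X + i, 1, 1, X + Suc i) # (X + i, 0, 1, 0) # chain X base i"

text \<open>State \<open>X + X\<close> can read 1 but not 0, so among the blocks ending in 0 the
  check gets stuck only on the one with exactly \<open>X\<close> tally letters. The third entry 1 of
  a transition codes the counter change 0.\<close>

definition with_input :: "nat \<Rightarrow> (nat \<times> nat \<times> nat \<times> nat) list \<Rightarrow> bca" where
  "with_input X base = BCA 4 (3 * X + 10) 6
     ((5, 1, 1, X + 1) # (5, 0, 1, 0) # (X + X, 1, 1, 0) # chain X base X) [0, 1, 2, 3, 4]"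

definition code_trans :: "(nat \<times> nat \<times> nat \<times> nat) list \<Rightarrow> nat" where
  "code_trans ts = list_encode (map code_tr ts)"

lemma code_trans_Cons:
  "code_trans ((p, a, d, q) # ts) =
     cons_code (cons_code p (cons_code a (cons_code d (cons_code q 0)))) (code_trans ts)"
  by (simp add: code_trans_def cons_code_def)

text \<open>\<open>X\<close> serves both as the offset of the state numbers and as the initial value
  of the recursion, being the code of the list that is extended. This double role makes the code of
  the automaton depend on \<open>X\<close> alone.\<close>

definition code_chain :: "nat \<Rightarrow> nat \<Rightarrow> nat" where
  "code_chain X = rec_nat X (\<lambda>i y.
     cons_code (cons_code (X + i) (cons_code 1 (cons_code 1 (cons_code (X + Suc i) 0))))
    (cons_code (cons_code (X + i) (cons_code 0 (cons_code 1 (cons_code 0 0)))) y))"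

lemma code_trans_chain: "code_trans base = X \<Longrightarrow> code_trans (chain X base i) = code_chain X i"
  by (induction i) (simp_all add: code_chain_def code_trans_Cons)

lemma computable_code_chain:
  assumes "computable k f" "computable k g"
  shows "computable k (\<lambda>xs. code_chain (f xs) (g xs))"
proof -
  let ?g = "\<lambda>xs. cons_code (cons_code (xs ! 2 + xs ! 1) (cons_code 1 (cons_code 1 (cons_code (xs ! 2 + Suc (xs ! 1)) 0))))
    (cons_code (cons_code (xs ! 2 + xs ! 1) (cons_code 0 (cons_code 1 (cons_code 0 0)))) (xs ! 0))"
  have 1: "computable (Suc (Suc 0)) (\<lambda>xs. rec_nat (tl xs ! 0) (\<lambda>n y. ?g (y # n # tl xs)) (hd xs))"
    by (rule computable_rec[where f = "\<lambda>xs. xs ! 0" and g = ?g])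
      (intro computable_cons_code computable_add computable_Suc computable_nth computable_const; simp)+
  have "computable 2 (\<lambda>xs. code_chain (xs ! 1) (xs ! 0))"
    unfolding numeral_2_eq_2
    by (rule computable_cong[OF 1]) (auto simp: length_Suc_conv code_chain_def)
  from computable_comp2[OF this assms(2,1)] show ?thesis .
qed

definition code_with_input :: "nat \<Rightarrow> nat" where
  "code_with_input X =
     cons_code 4 (cons_code (X + (X + (X + 10))) (cons_code 6 (cons_code
      (cons_code (cons_code 5 (cons_code 1 (cons_code 1 (cons_code (X + 1) 0))))
      (cons_code (cons_code 5 (cons_code 0 (cons_code 1 (cons_code 0 0))))
      (cons_code (cons_code (X + X) (cons_code 1 (cons_code 1 (cons_code 0 0))))
       (code_chain X X)))) (cons_code (list_encode [0, 1, 2, 3, 4]) 0))))"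

lemma code_bca_with_input:
  assumes "code_trans base = X"
  shows "code_bca (with_input X base) = code_with_input X"
  using code_trans_chain[OF assms, of X]
  by (simp add: code_bca_def with_input_def code_with_input_def list_encode_Cons
      code_trans_Cons[unfolded code_trans_def] code_trans_def add.assoc
      del: list_encode.simps(2) flip: mult_2 add: mult.commute)

lemma computable_code_with_input: "computable 1 (\<lambda>xs. code_with_input (xs ! 0))"
  unfolding code_with_input_def
  by (intro computable_cons_code computable_add computable_code_chain computable_nth computable_const) simp_all

section \<open>Boldface analytic sets\<close>

text \<open>With an arbitrary relation \<open>Q\<close> the class is closed under countable unions
  and intersections, so one non-membership result disposes of all arithmetical levels and of the
  effective classes at once.\<close>

definition analytic :: "nat \<Rightarrow> (nat \<Rightarrow> nat) set \<Rightarrow> bool" where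
  "analytic k L \<longleftrightarrow> (\<exists>Q. L = {\<sigma> \<in> omega_words k. \<exists>\<tau>. \<forall>m. Q (prefix \<sigma> m) (prefix \<tau> m)})"

lemma take_prefix: "take i (prefix \<sigma> m) = prefix \<sigma> (min i m)"
  by (simp add: prefix_def take_map min_def)

lemma length_prefix [simp]: "length (prefix \<sigma> m) = m"
  by (simp add: prefix_def)

lemma nth_prefix: "i < m \<Longrightarrow> prefix \<sigma> m ! i = \<sigma> i"
  by (simp add: prefix_def)

lemma prefix_eq_iff: "prefix \<sigma> m = prefix \<sigma>' m \<longleftrightarrow> (\<forall>i<m. \<sigma> i = \<sigma>' i)"
  by (auto simp: prefix_def)

lemma prefix_Suc_Cons: "prefix \<sigma> (Suc m) = \<sigma> 0 # prefix (\<lambda>i. \<sigma> (Suc i)) m"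
  by (rule nth_equalityI) (auto simp: nth_prefix nth_Cons split: nat.split)

lemma analytic_prefix_determined:
  "analytic k {\<sigma> \<in> omega_words k. P (prefix \<sigma> n)}"
  unfolding analytic_def
proof (rule exI)
  show "{\<sigma> \<in> omega_words k. P (prefix \<sigma> n)} =
    {\<sigma> \<in> omega_words k. \<exists>\<tau>. \<forall>m. (\<lambda>s t. length s = n \<longrightarrow> P s) (prefix \<sigma> m) (prefix \<tau> m)}"
    by simp
qed

text \<open>The first entry of the witness names \<open>a\<close>. The word is shortened by
  \<open>butlast\<close> so that it keeps the length of the remaining witness.\<close>

lemma analytic_Union:
  assumes "\<And>a. analytic k {\<sigma> \<in> omega_words k. P a \<sigma>}"
  shows "analytic k {\<sigma> \<in> omega_words k. \<exists>a::nat. P a \<sigma>}"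
proof -
  have "\<forall>a. \<exists>Q. {\<sigma> \<in> omega_words k. P a \<sigma>} =
      {\<sigma> \<in> omega_words k. \<exists>\<tau>. \<forall>m. Q (prefix \<sigma> m) (prefix \<tau> m)}"
    using assms unfolding analytic_def by simp
  from choice[OF this] obtain Q where Q: "\<And>a. {\<sigma> \<in> omega_words k. P a \<sigma>} =
      {\<sigma> \<in> omega_words k. \<exists>\<tau>. \<forall>m. Q a (prefix \<sigma> m) (prefix \<tau> m)}"
    by auto
  let ?Q = "\<lambda>s t. t \<noteq> [] \<longrightarrow> Q (hd t) (butlast s) (tl t)"
  have tl: "hd (prefix \<tau> (Suc m)) = \<tau> 0" "tl (prefix \<tau> (Suc m)) = prefix (\<lambda>i. \<tau> (Suc i)) m"
    "butlast (prefix \<sigma> (Suc m)) = prefix \<sigma> m" for \<tau> \<sigma> m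
    by (simp_all add: prefix_Suc_Cons[of \<tau>]) (simp add: prefix_def)
  have ne: "prefix \<tau> m \<noteq> [] \<longleftrightarrow> (\<exists>n. m = Suc n)" for \<tau> m by (cases m) (simp_all add: prefix_def)
  have "(\<exists>a. P a \<sigma>) \<longleftrightarrow> (\<exists>\<tau>. \<forall>m. ?Q (prefix \<sigma> m) (prefix \<tau> m))" if "\<sigma> \<in> omega_words k" for \<sigma>
  proof -
    have "(\<exists>a. P a \<sigma>) \<longleftrightarrow> (\<exists>a \<tau>. \<forall>m. Q a (prefix \<sigma> m) (prefix \<tau> m))"
      using Q that by blast
    also have "\<dots> \<longleftrightarrow> (\<exists>\<tau>. \<forall>m. Q (\<tau> 0) (prefix \<sigma> m) (prefix (\<lambda>i. \<tau> (Suc i)) m))"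
    proof
      assume "\<exists>a \<tau>. \<forall>m. Q a (prefix \<sigma> m) (prefix \<tau> m)"
      then obtain a \<tau> where "\<forall>m. Q a (prefix \<sigma> m) (prefix \<tau> m)" by blast
      then show "\<exists>\<tau>. \<forall>m. Q (\<tau> 0) (prefix \<sigma> m) (prefix (\<lambda>i. \<tau> (Suc i)) m)"
        by (intro exI[of _ "case_nat a \<tau>"]) simp
    qed blast
    also have "\<dots> \<longleftrightarrow> (\<exists>\<tau>. \<forall>m. ?Q (prefix \<sigma> m) (prefix \<tau> m))"
    proof -
      have "(\<forall>m. Q (\<tau> 0) (prefix \<sigma> m) (prefix (\<lambda>i. \<tau> (Suc i)) m))
        \<longleftrightarrow> (\<forall>m. ?Q (prefix \<sigma> m) (prefix \<tau> m))" (is "?A \<longleftrightarrow> ?B") for \<tau>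
      proof
        assume ?A
        then show ?B by (auto simp: ne tl)
      next
        assume B: ?B
        show ?A
        proof
          fix m
          show "Q (\<tau> 0) (prefix \<sigma> m) (prefix (\<lambda>i. \<tau> (Suc i)) m)"
            using B[rule_format, of "Suc m"] by (simp add: ne tl)
        qed
      qed
      then show ?thesis by simp
    qed
    finally show ?thesis .
  qed
  then show ?thesis unfolding analytic_def by (intro exI[of _ ?Q]) blast
qed

text \<open>A single sequence interleaves the witnesses for all \<open>a\<close> by pairing; a
  finite part of it is tested against every condition whose entries it already contains.\<close>

lemma analytic_Inter:
  assumes "\<And>a. analytic k {\<sigma> \<in> omega_words k. P a \<sigma>}"
  shows "analytic k {\<sigma> \<in> omega_words k. \<forall>a::nat. P a \<sigma>}"
proof -
  have "\<forall>a. \<exists>Q. {\<sigma> \<in> omega_words k. P a \<sigma>} =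
      {\<sigma> \<in> omega_words k. \<exists>\<tau>. \<forall>m. Q (prefix \<sigma> m) (prefix \<tau> m)}"
    using assms unfolding analytic_def by simp
  from choice[OF this] obtain Q where Q: "\<And>a. {\<sigma> \<in> omega_words k. P a \<sigma>} =
      {\<sigma> \<in> omega_words k. \<exists>\<tau>. \<forall>m. Q a (prefix \<sigma> m) (prefix \<tau> m)}"
    by auto
  let ?Q = "\<lambda>s t. \<forall>a m. m \<le> length s \<longrightarrow> (\<forall>i<m. prod_encode (a, i) < length t) \<longrightarrow>
     Q a (take m s) (map (\<lambda>i. t ! prod_encode (a, i)) [0..<m])"
  have "(\<forall>a. P a \<sigma>) \<longleftrightarrow> (\<exists>\<tau>. \<forall>m. ?Q (prefix \<sigma> m) (prefix \<tau> m))" if "\<sigma> \<in> omega_words k" for \<sigma>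
  proof -
    have "(\<forall>a. P a \<sigma>) \<longleftrightarrow> (\<forall>a. \<exists>\<tau>. \<forall>m. Q a (prefix \<sigma> m) (prefix \<tau> m))"
      using Q that by blast
    also have "\<dots> \<longleftrightarrow> (\<exists>\<tau>. \<forall>a m. Q a (prefix \<sigma> m) (prefix (\<lambda>i. \<tau> (prod_encode (a, i))) m))"
    proof
      assume "\<forall>a. \<exists>\<tau>. \<forall>m. Q a (prefix \<sigma> m) (prefix \<tau> m)"
      then obtain \<tau> where "\<And>a. \<forall>m. Q a (prefix \<sigma> m) (prefix (\<tau> a) m)" by metis
      then show "\<exists>\<tau>. \<forall>a m. Q a (prefix \<sigma> m) (prefix (\<lambda>i. \<tau> (prod_encode (a, i))) m)"
        by (intro exI[of _ "\<lambda>n. \<tau> (fst (prod_decode n)) (snd (prod_decode n))"]) simp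
    qed blast
    also have "\<dots> \<longleftrightarrow> (\<exists>\<tau>. \<forall>m. ?Q (prefix \<sigma> m) (prefix \<tau> m))"
    proof -
      have "(\<forall>a m. Q a (prefix \<sigma> m) (prefix (\<lambda>i. \<tau> (prod_encode (a, i))) m))
        \<longleftrightarrow> (\<forall>m. ?Q (prefix \<sigma> m) (prefix \<tau> m))" for \<tau>
      proof
        assume *: "\<forall>a m. Q a (prefix \<sigma> m) (prefix (\<lambda>i. \<tau> (prod_encode (a, i))) m)"
        show "\<forall>m. ?Q (prefix \<sigma> m) (prefix \<tau> m)"
        proof (intro allI impI)
          fix M a m
          assume m: "m \<le> length (prefix \<sigma> M)" "\<forall>i<m. prod_encode (a, i) < length (prefix \<tau> M)"
          then have "take m (prefix \<sigma> M) = prefix \<sigma> m"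
            "map (\<lambda>i. prefix \<tau> M ! prod_encode (a, i)) [0..<m] = prefix (\<lambda>i. \<tau> (prod_encode (a, i))) m"
            by (auto simp: take_prefix min_def nth_prefix) (auto simp: prefix_def)
          then show "Q a (take m (prefix \<sigma> M)) (map (\<lambda>i. prefix \<tau> M ! prod_encode (a, i)) [0..<m])"
            using * by simp
        qed
      next
        assume *: "\<forall>m. ?Q (prefix \<sigma> m) (prefix \<tau> m)"
        show "\<forall>a m. Q a (prefix \<sigma> m) (prefix (\<lambda>i. \<tau> (prod_encode (a, i))) m)"
        proof (intro allI)
          fix a m
          define M where "M = Max (insert m ((\<lambda>i. Suc (prod_encode (a, i))) ` {..<m}))"
          have M: "m \<le> M" "\<And>i. i < m \<Longrightarrow> prod_encode (a, i) < M"
            unfolding M_def by (auto simp: Suc_le_eq[symmetric])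
          then have "take m (prefix \<sigma> M) = prefix \<sigma> m"
            "map (\<lambda>i. prefix \<tau> M ! prod_encode (a, i)) [0..<m] = prefix (\<lambda>i. \<tau> (prod_encode (a, i))) m"
            by (auto simp: take_prefix min_def nth_prefix) (auto simp: prefix_def)
          with *[rule_format, of m M a] M
          show "Q a (prefix \<sigma> m) (prefix (\<lambda>i. \<tau> (prod_encode (a, i))) m)" by simp
        qed
      qed
      then show ?thesis by simp
    qed
    finally show ?thesis .
  qed
  then show ?thesis unfolding analytic_def by (intro exI[of _ ?Q]) blast
qed

text \<open>Each number quantifier is absorbed by a countable union or intersection; once all
  numbers are fixed, only finitely many letters matter.\<close>

lemma analytic_alt:
  assumes "\<And>as. \<exists>m P. \<forall>\<sigma>\<in>omega_words k. R \<sigma> as \<longleftrightarrow> P (prefix \<sigma> m)"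
  shows "analytic k {\<sigma> \<in> omega_words k. alt e n (R \<sigma>)}"
  using assms
proof (induction n arbitrary: e R)
  case 0
  from 0[of "[]"] obtain m P where "\<forall>\<sigma>\<in>omega_words k. R \<sigma> [] \<longleftrightarrow> P (prefix \<sigma> m)" by blast
  then have "{\<sigma> \<in> omega_words k. alt e 0 (R \<sigma>)} = {\<sigma> \<in> omega_words k. P (prefix \<sigma> m)}" by auto
  then show ?case using analytic_prefix_determined by simp
next
  case (Suc n)
  have *: "analytic k {\<sigma> \<in> omega_words k. alt (\<not> e) n (\<lambda>as. R \<sigma> (a # as))}" for a
    by (rule Suc.IH[of "\<lambda>\<sigma> as. R \<sigma> (a # as)"]) (rule Suc.prems)
  show ?case
    using analytic_Union[OF *] analytic_Inter[OF *] by (cases e) simp_all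
qed

section \<open>The classes of the theorem: analytic complements and the trivial members\<close>

lemma not_alt: "(\<not> alt e n P) \<longleftrightarrow> alt (\<not> e) n (\<lambda>as. \<not> P as)"
  by (induction n arbitrary: e P) auto

lemma arith_Sigma_analytic:
  assumes "arith_Sigma n k L"
  shows "analytic k L" "analytic k (omega_words k - L)"
proof -
  obtain R where L: "L = {\<sigma> \<in> omega_words k. alt True n (\<lambda>as.
            list_encode [list_encode (butlast as), list_encode (prefix \<sigma> (last as + 1))] \<in> R)}"
    using assms unfolding arith_Sigma_def by blast
  show "analytic k L"
    unfolding L
  proof (rule analytic_alt)
    fix as
    show "\<exists>m P. \<forall>\<sigma>\<in>omega_words k.
      (list_encode [list_encode (butlast as), list_encode (prefix \<sigma> (last as + 1))] \<in> R) \<longleftrightarrow> P (prefix \<sigma> m)"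
      by (intro exI[of _ "last as + 1"] exI[of _ "\<lambda>s. list_encode [list_encode (butlast as), list_encode s] \<in> R"]) simp
  qed
  have "omega_words k - L = {\<sigma> \<in> omega_words k. alt False n (\<lambda>as.
      list_encode [list_encode (butlast as), list_encode (prefix \<sigma> (last as + 1))] \<notin> R)}"
    unfolding L using not_alt[of True n] by (auto simp del: list_encode.simps)
  moreover have "analytic k \<dots>"
  proof (rule analytic_alt)
    fix as
    show "\<exists>m P. \<forall>\<sigma>\<in>omega_words k.
      (list_encode [list_encode (butlast as), list_encode (prefix \<sigma> (last as + 1))] \<notin> R) \<longleftrightarrow> P (prefix \<sigma> m)"
      by (intro exI[of _ "last as + 1"] exI[of _ "\<lambda>s. list_encode [list_encode (butlast as), list_encode s] \<notin> R"]) simp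
  qed
  ultimately show "analytic k (omega_words k - L)" by simp
qed

lemma arith_Pi_analytic: "arith_Pi n k L \<Longrightarrow> analytic k (omega_words k - L)"
  unfolding arith_Pi_def using arith_Sigma_analytic by blast

lemma Delta11_analytic: "Delta11 k L \<Longrightarrow> analytic k (omega_words k - L)"
  unfolding Delta11_def Pi11_def Sigma11_def analytic_def
  by (elim conjE exE) (rule exI[of _ "\<lambda>s t. list_encode [list_encode s, list_encode t] \<in> R" for R], assumption)

lemma recursive_set_UNIV: "recursive_set UNIV"
proof -
  have "eval (Comp Sf [Zf]) [x] (Suc 0)" for x
    by (rule ev_Comp[where ys = "[0]"]) (auto intro: ev_Z ev_S)
  then show ?thesis unfolding recursive_set_def by auto
qed

lemma recursive_set_empty: "recursive_set {}"
proof -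
  have "eval Zf [x] 0" for x by (rule ev_Z)
  then show ?thesis unfolding recursive_set_def by auto
qed

lemma alt_const: "alt e n (\<lambda>_. b) = b"
  by (induction n arbitrary: e) auto

lemma arith_Sigma_trivial: "arith_Sigma n k (omega_words k)" "arith_Sigma n k {}"
proof -
  show "arith_Sigma n k (omega_words k)"
    unfolding arith_Sigma_def
    by (rule exI[of _ UNIV]) (simp add: alt_const recursive_set_UNIV)
  show "arith_Sigma n k {}"
    unfolding arith_Sigma_def
    by (rule exI[of _ "{}"]) (simp add: alt_const recursive_set_empty)
qed

lemma arith_Pi_trivial: "arith_Pi n k (omega_words k)"
  unfolding arith_Pi_def by (simp add: arith_Sigma_trivial)

lemma Delta11_trivial: "Delta11 k (omega_words k)"
proof -
  have "Sigma11 k (omega_words k)"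
    unfolding Sigma11_def by (rule exI[of _ UNIV]) (simp add: recursive_set_UNIV)
  moreover have "Sigma11 k {}"
    unfolding Sigma11_def by (rule exI[of _ "{}"]) (simp add: recursive_set_empty)
  ultimately show ?thesis unfolding Delta11_def Pi11_def by simp
qed

section \<open>Linear orders presented by insertion positions\<close>

text \<open>The Kleene--Brouwer order: an extension lies below its prefixes.\<close>
fun kb :: "nat list \<Rightarrow> nat list \<Rightarrow> bool" where
  "kb s [] \<longleftrightarrow> s \<noteq> []"
| "kb [] (b # t) \<longleftrightarrow> False"
| "kb (a # s) (b # t) \<longleftrightarrow> a < b \<or> a = b \<and> kb s t"

lemma kb_irrefl: "\<not> kb s s"
  by (induction s) auto

lemma kb_trans: "kb s t \<Longrightarrow> kb t u \<Longrightarrow> kb s u"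
proof (induction s u arbitrary: t rule: kb.induct)
  case (1 s)
  then show ?case by (cases s; cases t) auto
next
  case (2 b u)
  then show ?case by (cases t) auto
next
  case (3 a s b u)
  then show ?case by (cases t) auto
qed

lemma kb_total: "s \<noteq> t \<Longrightarrow> kb s t \<or> kb t s"
  by (induction s t rule: kb.induct) (auto simp: neq_Nil_conv)

lemma kb_append_left [simp]: "kb (w @ s) (w @ t) = kb s t"
  by (induction w) auto

lemma kb_not_Nil: "kb s t \<Longrightarrow> s \<noteq> []"
  by (cases t) auto

lemma kb_hd: "kb s t \<Longrightarrow> t \<noteq> [] \<Longrightarrow> hd s \<le> hd t"
  by (cases "(s, t)" rule: kb.cases) auto

definition prefix_closed :: "nat list set \<Rightarrow> bool" where
  "prefix_closed T \<longleftrightarrow> (\<forall>s u. s @ u \<in> T \<longrightarrow> s \<in> T)"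

lemma wf_children:
  assumes T: "prefix_closed T" and nb: "\<not> (\<exists>\<tau>. \<forall>m. prefix \<tau> m \<in> T)"
  shows "wf {(s @ [a], s) |s a. s @ [a] \<in> T}"
  unfolding wf_iff_no_infinite_down_chain
proof
  assume "\<exists>f. \<forall>i. (f (Suc i), f i) \<in> {(s @ [a], s) |s a. s @ [a] \<in> T}"
  then obtain f where f': "\<And>i. (f (Suc i), f i) \<in> {(s @ [a], s) |s a. s @ [a] \<in> T}" by blast
  have f: "\<exists>a. f (Suc i) = f i @ [a] \<and> f (Suc i) \<in> T" for i using f'[of i] by auto
  have len: "length (f i) = length (f 0) + i" for i
  proof (induction i)
    case (Suc i)
    then show ?case using f[of i] by auto
  qed simp
  have ext: "\<exists>u. f (i + k) = f i @ u" for i k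
  proof (induction k)
    case (Suc k)
    then show ?case using f[of "i + k"] by auto
  qed simp
  \<comment> \<open>Node \<open>f (Suc j)\<close> has more than \<open>j\<close> entries and all
    later nodes extend it, so this entry is final.\<close>
  define \<tau> where "\<tau> j = f (Suc j) ! j" for j
  have "prefix \<tau> m \<in> T" for m
  proof -
    have "prefix \<tau> m = take m (f (Suc m))"
    proof (rule nth_equalityI)
      fix j assume "j < length (prefix \<tau> m)"
      then have j: "j < m" by simp
      then obtain u where "f (Suc m) = f (Suc j) @ u" using ext[of "Suc j" "m - j"] by auto
      then show "prefix \<tau> m ! j = take m (f (Suc m)) ! j"
        using j len[of "Suc j"] by (simp add: nth_prefix \<tau>_def nth_append)
    qed (use len[of "Suc m"] in simp)
    moreover have "take m (f (Suc m)) @ drop m (f (Suc m)) \<in> T" using f[of m] by auto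
    ultimately show ?thesis using T unfolding prefix_closed_def by metis
  qed
  with nb show False by blast
qed

text \<open>Without a branch, well-founded induction over the nodes applies: in a descending
  sequence below \<open>s\<close> the entries that follow \<open>s\<close> never increase, so they
  are finally constant, and a tail of the sequence descends below one child of
  \<open>s\<close>.\<close>

lemma kb_descent_imp_branch:
  assumes T: "prefix_closed T" and f: "\<And>i. f i \<in> T" "\<And>i. kb (f (Suc i)) (f i)"
  shows "\<exists>\<tau>. \<forall>m. prefix \<tau> m \<in> T"
proof (rule ccontr)
  assume "\<not> ?thesis"
  from wf_children[OF T this] have wf: "wf {(s @ [a], s) |s a. s @ [a] \<in> T}" (is "wf ?R") .
  have "\<not> (\<forall>i. s @ g i \<in> T \<and> kb (g (Suc i)) (g i))" for s g
    using wf
  proof (induction s arbitrary: g rule: wf_induct_rule)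
    case (less s)
    show ?case
    proof
      assume *: "\<forall>i. s @ g i \<in> T \<and> kb (g (Suc i)) (g i)"
      \<comment> \<open>Only the first element can be empty, since whatever lies below another
        sequence is nonempty.\<close>
      define h where "h i = g (Suc i)" for i
      have h: "h i \<noteq> []" "kb (h (Suc i)) (h i)" "s @ h i \<in> T" for i
        using * kb_not_Nil unfolding h_def by blast+
      then have mono: "hd (h (Suc i)) \<le> hd (h i)" for i using kb_hd by blast
      define a where "a = (LEAST a. \<exists>i. hd (h i) = a)"
      have "\<exists>i. hd (h i) = a" unfolding a_def by (rule LeastI_ex) blast
      then obtain N where N: "hd (h N) = a" by blast
      have "hd (h (N + i)) = a" for i
      proof (rule antisym)
        show "hd (h (N + i)) \<le> a"
        proof (induction i)
          case (Suc i)
          then show ?case using mono[of "N + i"] by simp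
        qed (use N in simp)
        show "a \<le> hd (h (N + i))" unfolding a_def by (rule Least_le) blast
      qed
      then have ht: "h (N + i) = a # tl (h (N + i))" for i
        using h(1)[of "N + i"] by (metis list.collapse)
      define k where "k i = tl (h (N + i))" for i
      have "(s @ [a]) @ k i \<in> T" for i
        using h(3)[of "N + i"] ht[of i] by (simp add: k_def)
      moreover have "kb (k (Suc i)) (k i)" for i
      proof -
        have "kb (a # k (Suc i)) (a # k i)"
          using h(2)[of "N + i"] ht[of i] ht[of "Suc i"] unfolding k_def by simp
        then show ?thesis by simp
      qed
      moreover have "s @ [a] \<in> T"
        using calculation(1)[of 0] T unfolding prefix_closed_def by blast
      ultimately show False using less[of "s @ [a]" k] by blast
    qed
  qed
  from this[of "[]" f] f show False by simp
qed

lemma kb_prefix: "kb (prefix \<tau> (Suc m)) (prefix \<tau> m)"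
proof -
  have "prefix \<tau> (Suc m) = prefix \<tau> m @ [\<tau> m]" by (simp add: prefix_def)
  then show ?thesis using kb_append_left[of "prefix \<tau> m" "[\<tau> m]" "[]"] by simp
qed

text \<open>Numbers that do not code nodes are put above the tree in increasing order, so that they do not
  contribute infinite descents.\<close>
definition tree_less :: "nat list set \<Rightarrow> nat \<Rightarrow> nat \<Rightarrow> bool" where
  "tree_less T m n \<longleftrightarrow> (if list_decode m \<in> T
     then list_decode n \<in> T \<longrightarrow> kb (list_decode m) (list_decode n)
     else list_decode n \<notin> T \<and> m < n)"

definition strict_linear :: "(nat \<Rightarrow> nat \<Rightarrow> bool) \<Rightarrow> bool" where
  "strict_linear lt \<longleftrightarrow> (\<forall>a. \<not> lt a a) \<and> (\<forall>a b c. lt a b \<longrightarrow> lt b c \<longrightarrow> lt a c)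
     \<and> (\<forall>a b. a \<noteq> b \<longrightarrow> lt a b \<or> lt b a)"

lemma strict_linear_tree_less: "strict_linear (tree_less T)"
  unfolding strict_linear_def
proof (intro conjI allI impI)
  show "\<not> tree_less T a a" for a by (simp add: tree_less_def kb_irrefl)
  show "tree_less T a c" if "tree_less T a b" "tree_less T b c" for a b c
    using that kb_trans unfolding tree_less_def by (auto split: if_splits)
  show "tree_less T a b \<or> tree_less T b a" if "a \<noteq> b" for a b
  proof -
    have "list_decode a \<noteq> list_decode b" using that by (metis list_decode_inverse)
    then show ?thesis using kb_total that unfolding tree_less_def by auto
  qed
qed

definition descending :: "(nat \<Rightarrow> nat \<Rightarrow> bool) \<Rightarrow> (nat \<Rightarrow> nat) \<Rightarrow> bool" where
  "descending lt f \<longleftrightarrow> (\<forall>i. lt (f (Suc i)) (f i))"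

text \<open>A descent that reaches a node stays among nodes, where the order is Kleene--Brouwer; one
  that never does would descend in the natural numbers. Conversely the prefixes of a branch
  descend.\<close>

lemma tree_less_descending_iff_branch:
  assumes T: "prefix_closed T"
  shows "(\<exists>f. descending (tree_less T) f) \<longleftrightarrow> (\<exists>\<tau>. \<forall>m. prefix \<tau> m \<in> T)"
proof
  assume "\<exists>f. descending (tree_less T) f"
  then obtain f where f: "\<And>i. tree_less T (f (Suc i)) (f i)" unfolding descending_def by blast
  show "\<exists>\<tau>. \<forall>m. prefix \<tau> m \<in> T"
  proof (cases "\<exists>N. list_decode (f N) \<in> T")
    case True
    then obtain N where N: "list_decode (f N) \<in> T" ..
    have "list_decode (f (N + i)) \<in> T" for i
    proof (induction i)
      case (Suc i)
      then show ?case using f[of "N + i"] by (auto simp: tree_less_def split: if_splits)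
    qed (use N in simp)
    moreover from this have "kb (list_decode (f (N + Suc i))) (list_decode (f (N + i)))" for i
      using f[of "N + i"] by (auto simp: tree_less_def split: if_splits)
    ultimately show ?thesis by (intro kb_descent_imp_branch[OF T, of "\<lambda>i. list_decode (f (N + i))"])
  next
    case False
    then have "f (Suc i) < f i" for i using f[of i] by (auto simp: tree_less_def)
    then have False using wf_less_than unfolding wf_iff_no_infinite_down_chain by auto
    then show ?thesis ..
  qed
next
  assume "\<exists>\<tau>. \<forall>m. prefix \<tau> m \<in> T"
  then obtain \<tau> where "\<And>m. prefix \<tau> m \<in> T" by blast
  then have "descending (tree_less T) (\<lambda>m. list_encode (prefix \<tau> m))"
    by (simp add: descending_def tree_less_def kb_prefix)
  then show "\<exists>f. descending (tree_less T) f" by blast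
qed

text \<open>The rank of \<open>e\<close> among the first \<open>n\<close> elements. The numbers
  \<open>position lt n n\<close> are all that a word reveals of the order: the sorted list of
  \<open>{..<n}\<close> grows by inserting \<open>n\<close> at that place.\<close>

definition position :: "(nat \<Rightarrow> nat \<Rightarrow> bool) \<Rightarrow> nat \<Rightarrow> nat \<Rightarrow> nat" where
  "position lt n e = card {m. m < n \<and> lt m e}"

lemma position_Suc: "position lt (Suc n) e = position lt n e + (if lt n e then 1 else 0)"
proof -
  have "{m. m < Suc n \<and> lt m e} = (if lt n e then insert n {m. m < n \<and> lt m e} else {m. m < n \<and> lt m e})"
    by (auto simp: less_Suc_eq)
  then show ?thesis by (simp add: position_def)
qed

lemma position_le: "position lt n e \<le> n"
proof -
  have "card {m. m < n \<and> lt m e} \<le> card {..<n}" by (rule card_mono) auto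
  then show ?thesis by (simp add: position_def)
qed

lemma position_mono:
  assumes "strict_linear lt" "lt a b"
  shows "position lt n a \<le> position lt n b"
proof -
  have "{m. m < n \<and> lt m a} \<subseteq> {m. m < n \<and> lt m b}" 
    using assms unfolding strict_linear_def by blast
  then show ?thesis unfolding position_def by (intro card_mono) auto
qed

lemma position_strict_mono:
  assumes "strict_linear lt" "lt a b" "a < n"
  shows "position lt n a < position lt n b"
proof -
  have "{m. m < n \<and> lt m a} \<subset> {m. m < n \<and> lt m b}"
    using assms unfolding strict_linear_def by blast
  then show ?thesis unfolding position_def by (intro psubset_card_mono) auto
qed

lemma position_less:
  assumes "strict_linear lt" "e < n"
  shows "position lt n e < n"
proof -
  have "{m. m < n \<and> lt m e} \<subset> {..<n}" using assms unfolding strict_linear_def by blast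
  from psubset_card_mono[OF _ this] show ?thesis by (simp add: position_def)
qed

lemma ex_position:
  assumes lt: "strict_linear lt" and "c < n"
  shows "\<exists>e<n. position lt n e = c"
proof -
  have "inj_on (position lt n) {..<n}"
  proof (rule inj_onI, rule ccontr)
    fix a b assume *: "a \<in> {..<n}" "b \<in> {..<n}" "position lt n a = position lt n b" "a \<noteq> b"
    then have "lt a b \<or> lt b a" using lt unfolding strict_linear_def by blast
    then show False using position_strict_mono[OF lt] * by fastforce
  qed
  moreover have "position lt n ` {..<n} \<subseteq> {..<n}" using position_less[OF lt] by auto
  ultimately have "position lt n ` {..<n} = {..<n}" by (simp add: endo_inj_surj)
  then have "c \<in> position lt n ` {..<n}" using assms(2) by simp
  then show ?thesis by blast
qed

text \<open>A counter value \<open>c\<close> at stage \<open>n\<close> stands for the element at position \<open>c\<close> among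
  \<open>{..<n}\<close>, or for a dummy element above them if \<open>c \<ge> n\<close>; the measure is that element.\<close>
lemma position_measure:
  assumes lt: "strict_linear lt" and wf: "\<not> (\<exists>f. descending lt f)"
  shows "\<exists>(\<mu> :: nat \<Rightarrow> nat \<Rightarrow> nat \<times> nat \<times> nat) W. wf W \<and> Relation.trans W \<and>
    (\<forall>n c c'. c' \<le> c + (if position lt n n \<le> c then 1 else 0) \<longrightarrow>
       (\<mu> (Suc n) c', \<mu> n c) \<in> W\<^sup>= \<and>
       (position lt n n \<le> c \<longrightarrow> c' \<le> c \<longrightarrow> (\<mu> (Suc n) c', \<mu> n c) \<in> W))"
proof -
  note lin = lt[unfolded strict_linear_def]
  define el where "el n c = (SOME e. e < n \<and> position lt n e = c)" for n c
  have el: "el n c < n" "position lt n (el n c) = c" if "c < n" for n c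
    using someI_ex[OF ex_position[OF lt that, unfolded Bex_def, simplified]] unfolding el_def
    by auto
  define L where "L = {(a, b). lt a b}"
  have wfL: "wf L"
    using wf unfolding wf_iff_no_infinite_down_chain L_def descending_def by simp
  have trL: "Relation.trans L" by (rule transI) (use lin in \<open>auto simp: L_def\<close>)
  define \<mu> where "\<mu> n c = (if c < n then (0::nat, el n c, 0) else (1, 0, c - n))" for n c
  define W where "W = less_than <*lex*> L <*lex*> less_than"
  have "wf W" "Relation.trans W" unfolding W_def using wfL trL by (auto intro!: trans_lex_prod)
  moreover have "(\<mu> (Suc n) c', \<mu> n c) \<in> W\<^sup>= \<and>
       (position lt n n \<le> c \<longrightarrow> c' \<le> c \<longrightarrow> (\<mu> (Suc n) c', \<mu> n c) \<in> W)"
    if c': "c' \<le> c + (if position lt n n \<le> c then 1 else 0)" for n c c'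
  proof (cases "c < n")
    case False
    then show ?thesis using c' position_le[of lt n n]
      by (auto simp: \<mu>_def W_def split: if_splits)
  next
    case True
    let ?e = "el n c"
    have e: "?e < n" "position lt n ?e = c" using el[OF True] .
    \<comment> \<open>The one comparison a blind counter can certify thus tells whether the new
      element lies below the current one.\<close>
    have iff: "lt n ?e \<longleftrightarrow> position lt n n \<le> c"
    proof
      assume "lt n ?e"
      then show "position lt n n \<le> c" using position_mono[OF lt, of n ?e n] e(2) by simp
    next
      assume *: "position lt n n \<le> c"
      show "lt n ?e"
      proof (rule ccontr)
        assume "\<not> lt n ?e"
        then have "lt ?e n" using lin e(1) by (metis less_irrefl)
        from position_strict_mono[OF lt this e(1)] * e(2) show False by simp
      qed
    qed
    \<comment> \<open>An insertion below \<open>?e\<close> shifts its rank by one; a counter that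
      does not follow the shift points to a smaller element of the longer list.\<close>
    then have eS: "position lt (Suc n) ?e = c + (if position lt n n \<le> c then 1 else 0)"
      using e(2) by (simp add: position_Suc)
    have c'n: "c' < Suc n" using c' eS position_less[OF lt, of ?e "Suc n"] e(1) by linarith
    let ?d = "el (Suc n) c'"
    have d: "?d < Suc n" "position lt (Suc n) ?d = c'" using el[OF c'n] .
    have "\<not> lt ?e ?d" using position_strict_mono[OF lt, of ?e ?d "Suc n"] e(1) d(2) c' eS by auto
    then have le: "?d = ?e \<or> lt ?d ?e" using lin by blast
    moreover have "?d \<noteq> ?e" if "position lt n n \<le> c" "c' \<le> c"
      using that eS d(2) by auto
    ultimately show ?thesis using True c'n by (auto simp: \<mu>_def W_def L_def)
  qed
  ultimately show ?thesis by blast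
qed

text \<open>A descending sequence is injective, hence takes arbitrarily large values after each
  index. Selecting these yields a descent whose members are inserted in the order in which they are
  passed.\<close>

lemma descending_increasing:
  assumes lt: "strict_linear lt" and f: "descending lt f"
  shows "\<exists>e. strict_mono e \<and> descending lt e"
proof -
  note lin = lt[unfolded strict_linear_def]
  have le: "i < j \<Longrightarrow> lt (f j) (f i)" for i j
  proof (induction j)
    case (Suc j)
    have "lt (f (Suc j)) (f j)" using f unfolding descending_def by blast
    with Suc show ?case using lin by (metis less_Suc_eq)
  qed simp
  have inj: "inj f"
  proof (rule injI, rule ccontr)
    fix x y assume "f x = f y" "x \<noteq> y"
    then show False using le[of x y] le[of y x] lin by (metis linorder_neqE_nat)
  qed
  have step: "\<exists>j. i < j \<and> f i < f j" for i
  proof (rule ccontr)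
    assume "\<not> ?thesis"
    then have "f j \<le> f i" if "i < j" for j using that not_less by blast
    then have "f ` {i<..} \<subseteq> {..f i}" by auto
    then have "finite (f ` {i<..})" by (rule finite_subset) simp
    then have "finite {i<..}" using inj by (meson finite_imageD inj_on_subset subset_UNIV)
    then show False using infinite_Ioi by blast
  qed
  obtain s where s: "\<And>n. s n < s (Suc n) \<and> f (s n) < f (s (Suc n))"
    using dependent_nat_choice[of "\<lambda>_ _. True" "\<lambda>_ i j. i < j \<and> f i < f j"] step by auto
  have "strict_mono (f \<circ> s)" using s by (simp add: strict_mono_Suc_iff)
  moreover have "descending lt (f \<circ> s)" unfolding descending_def using s le by auto
  ultimately show ?thesis by blast
qed

text \<open>The counter stays at or above the rank of the current member of the descent. When the
  next member is inserted, a stage in \<open>M\<close>, the counter does not follow and thereby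
  moves on to that member. As only a lower bound is maintained, every sufficiently large initial
  value works.\<close>

lemma descending_imp_counter_run:
  assumes lt: "strict_linear lt" and f: "descending lt f"
  shows "\<exists>n0 M. 0 < n0 \<and> infinite M \<and> (\<forall>c0\<ge>n0. \<exists>C. C n0 = c0 \<and> (\<forall>n\<ge>n0.
     if n \<in> M then position lt n n \<le> C n \<and> C (Suc n) = C n
     else C (Suc n) = C n + (if position lt n n \<le> C n then 1 else 0)))"
proof -
  note lin = lt[unfolded strict_linear_def]
  obtain e where e: "strict_mono e" "descending lt e" using descending_increasing[OF assms] by blast
  have inf: "infinite (range e)" using e(1) by (simp add: finite_image_iff strict_mono_imp_inj_on)
  define n0 where "n0 = Suc (e 0)"
  have "\<exists>C. C n0 = c0 \<and> (\<forall>n\<ge>n0.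
     if n \<in> range e then position lt n n \<le> C n \<and> C (Suc n) = C n
     else C (Suc n) = C n + (if position lt n n \<le> C n then 1 else 0))" if c0: "c0 \<ge> n0" for c0
  proof -
    define D where "D = rec_nat c0 (\<lambda>i c. if n0 + i \<in> range e then c
       else c + (if position lt (n0 + i) (n0 + i) \<le> c then 1 else 0))"
    have D: "D 0 = c0" "\<And>i. D (Suc i) = (if n0 + i \<in> range e then D i
       else D i + (if position lt (n0 + i) (n0 + i) \<le> D i then 1 else 0))"
      by (simp_all add: D_def)
    \<comment> \<open>\<open>e j\<close> is the latest member of the descent that has been inserted;
      the initial stage \<open>n0\<close> comes right after the insertion of
      \<open>e 0\<close>.\<close>
    have inv: "\<exists>j. e j < n0 + i \<and> n0 + i \<le> e (Suc j) \<and> position lt (n0 + i) (e j) \<le> D i" for i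
    proof (induction i)
      case 0
      have "e 0 < e 1" using e(1) by (simp add: strict_mono_def)
      then show ?case using c0 position_le[of lt n0 "e 0"] D(1)
        by (intro exI[of _ 0]) (auto simp: n0_def)
    next
      case (Suc i)
      then obtain j where j: "e j < n0 + i" "n0 + i \<le> e (Suc j)" "position lt (n0 + i) (e j) \<le> D i"
        by blast
      let ?n = "n0 + i"
      show ?case
      proof (cases "?n = e (Suc j)")
        case True
        then have "lt ?n (e j)" using e(2) unfolding descending_def by simp
        then have "position lt ?n ?n \<le> D i" using position_mono[OF lt] j(3) le_trans by blast
        moreover have "position lt (Suc ?n) ?n = position lt ?n ?n"
          using lin by (simp add: position_Suc)
        moreover have "e (Suc j) < e (Suc (Suc j))" using e(1) by (simp add: strict_mono_def)
        moreover have "?n \<in> range e" using True by simp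
        ultimately show ?thesis using True D(2)[of i]
          by (intro exI[of _ "Suc j"]) simp
      next
        case False
        then have lt2: "?n < e (Suc j)" using j(2) by simp
        have notin: "?n \<notin> range e"
        proof
          assume "?n \<in> range e"
          then obtain k where k: "?n = e k" by blast
          then have "j < k" "k < Suc j" using j(1) lt2 e(1) by (simp_all add: strict_mono_less)
          then show False by simp
        qed
        have "position lt (Suc ?n) (e j) \<le> D (Suc i)"
        proof (cases "lt ?n (e j)")
          case True
          then have "position lt ?n ?n \<le> D i" using position_mono[OF lt] j(3) le_trans by blast
          then show ?thesis using True notin j(3) by (simp add: D(2) position_Suc)
        next
          case False
          then show ?thesis using notin j(3) by (simp add: D(2) position_Suc)
        qed
        then show ?thesis using j(1) lt2 by (intro exI[of _ j]) auto
      qed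
    qed
    define C where "C n = D (n - n0)" for n
    have "if n \<in> range e then position lt n n \<le> C n \<and> C (Suc n) = C n
     else C (Suc n) = C n + (if position lt n n \<le> C n then 1 else 0)" if "n \<ge> n0" for n
    proof -
      have "n = n0 + (n - n0)" using that by simp
      then obtain i where i: "n = n0 + i" by blast
      have Cn: "C n = D i" "C (Suc n) = D (Suc i)" by (simp_all add: C_def i Suc_diff_le)
      have "position lt n n \<le> D i" if "n \<in> range e"
      proof -
        obtain j where j: "e j < n0 + i" "n0 + i \<le> e (Suc j)" "position lt (n0 + i) (e j) \<le> D i"
          using inv by blast
        from that obtain k where k: "n = e k" by blast
        then have "j < k" "k \<le> Suc j" using j(1,2) i e(1)
          by (simp_all add: strict_mono_less strict_mono_less_eq)
        then have "k = Suc j" by simp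
        then have "lt n (e j)" using e(2) k unfolding descending_def by simp
        then show ?thesis using position_mono[OF lt] j(3) le_trans i by blast
      qed
      then show ?thesis using D(2)[of i] unfolding Cn by (simp add: i)
    qed
    moreover have "C n0 = c0" by (simp add: C_def D(1))
    ultimately show ?thesis by blast
  qed
  moreover have "0 < n0" by (simp add: n0_def)
  ultimately show ?thesis using inf by blast
qed

text \<open>Bounds the history used by the diagonal construction: whether the node coded by
  \<open>n\<close> is in the tree depends on at most \<open>n\<close> letters.\<close>

lemma length_list_decode_le: "length (list_decode n) \<le> n"
proof -
  have "length xs \<le> list_encode xs" for xs
  proof (induction xs)
    case (Cons x xs)
    then show ?case using le_prod_encode_2[of "list_encode xs" x] by simp
  qed simp
  from this[of "list_decode n"] show ?thesis by simp
qed

section \<open>Infinite paths and block decompositions of words\<close>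

lemma strict_mono_interval:
  assumes "strict_mono T" "T 0 = (0::nat)"
  shows "\<exists>k. T k \<le> i \<and> i < T (Suc k)"
proof (induction i)
  case 0
  have "T 0 < T (Suc 0)" using assms(1) by (simp add: strict_mono_def)
  then show ?case using assms(2) by (intro exI[of _ 0]) simp
next
  case (Suc i)
  then obtain k where k: "T k \<le> i" "i < T (Suc k)" by blast
  show ?case
  proof (cases "Suc i < T (Suc k)")
    case True
    then show ?thesis using k by (intro exI[of _ k]) simp
  next
    case False
    have "T (Suc k) < T (Suc (Suc k))" using assms(1) by (simp add: strict_mono_def)
    then show ?thesis using False k by (intro exI[of _ "Suc k"]) simp
  qed
qed

lemma strict_mono_interval_unique:
  assumes "strict_mono T" "T k \<le> (i::nat)" "i < T (Suc k)" "T l \<le> i" "i < T (Suc l)"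
  shows "k = l"
proof -
  have "k < Suc l" "l < Suc k" using assms by (meson le_less_trans strict_mono_less)+
  then show ?thesis by simp
qed

text \<open>Nonempty finite paths are concatenated. Every edge advances the time by one, so the
  result is indexed by time itself and passes through all the given points.\<close>

lemma infinite_path:
  fixes time :: "'a \<Rightarrow> nat"
  assumes E: "\<And>x y. (x, y) \<in> E \<Longrightarrow> time y = Suc (time x)"
    and F: "\<And>k. (F k, F (Suc k)) \<in> E\<^sup>+" and F0: "time (F 0) = 0"
  shows "\<exists>G. G 0 = F 0 \<and> (\<forall>i. time (G i) = i \<and> (G i, G (Suc i)) \<in> E) \<and> (\<forall>k. G (time (F k)) = F k)"
proof -
  have "\<exists>n f. n > 0 \<and> f 0 = F k \<and> f n = F (Suc k) \<and> (\<forall>i<n. (f i, f (Suc i)) \<in> E)" for k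
  proof -
    obtain n where "n > 0" "(F k, F (Suc k)) \<in> E ^^ n" using F[of k] by (meson trancl_power)
    then show ?thesis by (auto simp: relpow_fun_conv)
  qed
  then obtain n f where f: "\<And>k. n k > 0" "\<And>k. f k 0 = F k" "\<And>k. f k (n k) = F (Suc k)"
    "\<And>k i. i < n k \<Longrightarrow> (f k i, f k (Suc i)) \<in> E" by metis
  have time_f: "i \<le> n k \<Longrightarrow> time (f k i) = time (F k) + i" for k i
  proof (induction i)
    case (Suc i)
    then show ?case using E[OF f(4)[of i k]] by simp
  qed (simp add: f(2))
  define T where "T k = time (F k)" for k
  have T: "T (Suc k) = T k + n k" for k using time_f[of "n k" k] f(3)[of k] by (simp add: T_def)
  then have mono: "strict_mono T" using f(1) by (simp add: strict_mono_Suc_iff)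
  have T0: "T 0 = 0" using F0 by (simp add: T_def)
  define K where "K i = (SOME k. T k \<le> i \<and> i < T (Suc k))" for i
  have K: "T (K i) \<le> i" "i < T (Suc (K i))" for i
    using someI_ex[OF strict_mono_interval[OF mono T0, of i]] unfolding K_def by auto
  have K_eq: "K i = k" if "T k \<le> i" "i < T (Suc k)" for i k
    using strict_mono_interval_unique[OF mono K that] .
  define G where "G i = f (K i) (i - T (K i))" for i
  have GT: "G (T k) = F k" for k
  proof -
    have "K (T k) = k" by (rule K_eq) (use T f(1)[of k] in auto)
    then show ?thesis by (simp add: G_def f(2))
  qed
  have GS: "G (Suc i) = f (K i) (Suc i - T (K i))" for i
  proof (cases "Suc i < T (Suc (K i))")
    case True
    then have "K (Suc i) = K i" using K[of i] by (intro K_eq) auto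
    then show ?thesis by (simp add: G_def)
  next
    case False
    then have eq: "Suc i = T (Suc (K i))" using K[of i] by simp
    then have "G (Suc i) = F (Suc (K i))" using GT by simp
    moreover have "Suc i - T (K i) = n (K i)" using T eq by simp
    ultimately show ?thesis using f(3) by simp
  qed
  have lt: "i - T (K i) < n (K i)" for i using K[of i] T by simp
  have "(G i, G (Suc i)) \<in> E" for i
    using f(4)[OF lt] GS[of i] K(1)[of i] by (simp add: G_def Suc_diff_le)
  moreover have "time (G i) = i" for i
    using time_f[of "i - T (K i)" "K i"] lt[of i] K(1)[of i] by (simp add: G_def T_def)
  moreover have "G 0 = F 0" using GT[of 0] T0 by simp
  moreover have "G (time (F k)) = F k" for k using GT[of k] by (simp add: T_def)
  ultimately show ?thesis by blast
qed

text \<open>Triples of time, state and counter: runs become paths in a graph, and pieces of runs can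
  be joined with transitive closures.\<close>

definition letter_steps :: "bca \<Rightarrow> (nat \<Rightarrow> nat) \<Rightarrow> ((nat \<times> nat \<times> nat) \<times> (nat \<times> nat \<times> nat)) set" where
  "letter_steps A w = {((i, p, c), (Suc i, q, c')) |i p c q c'.
     \<exists>d. (p, w i, d, q) \<in> set (trans A) \<and> int c' = int c + int d - 1}"

lemma in_lang_if_infinite_path:
  assumes w: "w \<in> omega_words (alph A)"
    and f0: "((0, init A, 0), f 0) \<in> (letter_steps A w)\<^sup>+"
    and f: "\<And>k. (f k, f (Suc k)) \<in> (letter_steps A w)\<^sup>+"
    and acc: "\<And>k. fst (snd (f k)) \<in> set (acc A)"
  shows "w \<in> lang A"
proof -
  let ?E = "letter_steps A w"
  define F where "F = case_nat (0, init A, 0) f"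
  have tm: "(x, y) \<in> ?E \<Longrightarrow> fst y = Suc (fst x)" for x y by (auto simp: letter_steps_def)
  have Fs: "(F k, F (Suc k)) \<in> ?E\<^sup>+" for k
    by (cases k) (simp_all add: F_def f0 f)
  obtain G where G: "G 0 = F 0" "\<And>i. fst (G i) = i" "\<And>i. (G i, G (Suc i)) \<in> ?E"
    "\<And>k. G (fst (F k)) = F k"
    using infinite_path[of ?E fst F, OF tm Fs] by (auto simp: F_def)
  define \<rho> where "\<rho> i = fst (snd (G i))" for i
  define c where "c i = snd (snd (G i))" for i
  have "is_run A w \<rho> c"
    unfolding is_run_def
  proof (intro conjI allI)
    show "\<rho> 0 = init A" "c 0 = 0" by (simp_all add: \<rho>_def c_def G(1) F_def)
    show "\<exists>d. (\<rho> i, w i, d, \<rho> (Suc i)) \<in> set (bca.trans A) \<and> int (c (Suc i)) = int (c i) + int d - 1" for i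
      using G(3)[of i] G(2)[of i] by (auto simp: letter_steps_def \<rho>_def c_def)
  qed
  moreover have "\<exists>\<^sub>\<infinity>i. \<rho> i \<in> set (acc A)"
    unfolding INFM_nat_le
  proof
    fix m
    have step: "fst (F k) < fst (F (Suc k))" for k
    proof -
      have "(x, y) \<in> ?E\<^sup>+ \<Longrightarrow> fst x < fst y" for x y
        by (induction rule: trancl_induct) (auto dest!: tm)
      then show ?thesis using Fs by blast
    qed
    then have "strict_mono (\<lambda>k. fst (F k))" by (simp add: strict_mono_Suc_iff)
    then have "m \<le> fst (F m)" by (rule strict_mono_imp_increasing)
    then have "m \<le> fst (F (Suc m))" using step[of m] by simp
    moreover have "\<rho> (fst (F (Suc m))) \<in> set (acc A)"
      unfolding \<rho>_def G(4) by (simp add: F_def acc)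
    ultimately show "\<exists>n\<ge>m. \<rho> n \<in> set (acc A)" by blast
  qed
  ultimately show ?thesis using w unfolding lang_def by blast
qed

section \<open>Words as sequences of tally blocks with terminators\<close>

definition start :: "(nat \<Rightarrow> nat) \<Rightarrow> nat \<Rightarrow> nat" where
  "start v k = (\<Sum>j<k. v j + 1)"

lemma start_0 [simp]: "start v 0 = 0"
  and start_Suc: "start v (Suc k) = start v k + v k + 1"
  by (simp_all add: start_def)

lemma strict_mono_start: "strict_mono (start v)"
  by (simp add: strict_mono_Suc_iff start_Suc)

lemma le_start: "k \<le> start v k"
  by (rule strict_mono_imp_increasing[OF strict_mono_start])

definition blocks :: "(nat \<Rightarrow> nat) \<Rightarrow> (nat \<Rightarrow> nat) \<Rightarrow> (nat \<Rightarrow> nat) \<Rightarrow> bool" where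
  "blocks w v t \<longleftrightarrow> (\<forall>k. (\<forall>i<v k. w (start v k + i) = 1) \<and> w (start v k + v k) = t k)"

lemma ex_block: "\<exists>k j. i = start v k + j \<and> j \<le> v k"
proof -
  obtain k where "start v k \<le> i" "i < start v (Suc k)"
    using strict_mono_interval[OF strict_mono_start start_0] by blast
  then show ?thesis by (intro exI[of _ k] exI[of _ "i - start v k"]) (simp add: start_Suc)
qed

definition word :: "(nat \<Rightarrow> nat) \<Rightarrow> (nat \<Rightarrow> nat) \<Rightarrow> nat \<Rightarrow> nat" where
  "word v t i = (let k = (THE k. start v k \<le> i \<and> i < start v (Suc k)) in
     if i = start v k + v k then t k else 1)"

lemma word_eq:
  assumes "j \<le> v k"
  shows "word v t (start v k + j) = (if j = v k then t k else 1)"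
proof -
  have "(THE l. start v l \<le> start v k + j \<and> start v k + j < start v (Suc l)) = k"
  proof (rule the_equality)
    show "start v k \<le> start v k + j \<and> start v k + j < start v (Suc k)"
      using assms by (simp add: start_Suc)
    then show "l = k" if "start v l \<le> start v k + j \<and> start v k + j < start v (Suc l)" for l
      using strict_mono_interval_unique[OF strict_mono_start] that by blast
  qed
  then show ?thesis by (simp add: word_def)
qed

lemma blocks_word: "blocks (word v t) v t"
  unfolding blocks_def by (simp add: word_eq)

text \<open>A block has at least one letter, so the first \<open>n\<close> letters lie in the first
  \<open>n\<close> blocks.\<close>

lemma word_cong:
  assumes "\<And>j. j < n \<Longrightarrow> v j = v' j" "\<And>j. j < n \<Longrightarrow> t j = t' j" "i < n"
  shows "word v t i = word v' t' i"
proof -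
  obtain k j where kj: "i = start v k + j" "j \<le> v k" using ex_block by blast
  then have k: "k < n" using le_start[of k v] assms(3) by simp
  have "start v k = start v' k" unfolding start_def by (rule sum.cong) (use k assms(1) in auto)
  then show ?thesis
    using word_eq[of j v k t] word_eq[of j v' k t'] kj k assms by auto
qed

lemma word_in_omega_words: "(\<And>k. t k < n) \<Longrightarrow> 1 < n \<Longrightarrow> word v t \<in> omega_words n"
  unfolding omega_words_def
proof
  assume *: "\<And>k. t k < n" "1 < n"
  show "\<forall>i. word v t i < n"
  proof
    fix i
    obtain k j where kj: "i = start v k + j" "j \<le> v k" using ex_block by blast
    show "word v t i < n" using word_eq[of j v k t] kj * by simp
  qed
qed

lemma ex_blocks:
  assumes "infinite {i. w i \<noteq> 1}"
  shows "\<exists>v t. blocks w v t \<and> (\<forall>k. t k \<noteq> 1)"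
proof -
  let ?S = "{i. w i \<noteq> 1}"
  define e where "e = enumerate ?S"
  have e: "w (e k) \<noteq> 1" "e k < e (Suc k)" for k
    using enumerate_in_set[OF assms] enumerate_step[OF assms] by (auto simp: e_def)
  define v where "v k = (case k of 0 \<Rightarrow> e 0 | Suc l \<Rightarrow> e (Suc l) - e l - 1)" for k
  have st: "start v k + v k = e k" for k
  proof (induction k)
    case 0
    then show ?case by (simp add: v_def)
  next
    case (Suc k)
    then show ?case using e(2)[of k] by (simp add: start_Suc v_def[of "Suc k"])
  qed
  have gap: "w (start v k + i) = 1" if "i < v k" for k i
  proof (rule ccontr)
    assume "w (start v k + i) \<noteq> 1"
    then have "start v k + i \<in> ?S" by simp
    then obtain l where l: "e l = start v k + i"
      using enumerate_Ex[OF assms] unfolding e_def by metis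
    then have "e l < e k" using st[of k] that by simp
    then have lk: "l < k" using strict_mono_enumerate[OF assms] unfolding e_def
      by (simp add: strict_mono_less)
    have "e l < start v (Suc l)" using st[of l] by (simp add: start_Suc)
    moreover have "start v (Suc l) \<le> start v k"
      using lk strict_mono_start by (simp add: strict_mono_less_eq)
    ultimately show False using l by simp
  qed
  have "blocks w v (\<lambda>k. w (e k))" unfolding blocks_def using gap st by simp
  then show ?thesis using e(1) by (intro exI[of _ v] exI[of _ "\<lambda>k. w (e k)"]) simp
qed

section \<open>The automaton\<close>

text \<open>The continuations reachable from a program will be the finite control of the automaton.
  Elements of \<open>Q\<close> are exempt from closure because a loop has to be in the set before
  the continuations of its body, which return to it, are collected.\<close>

lemma ex_closed_extension:
  assumes "finite Q" "K \<in> Q"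
  shows "\<exists>Q'. finite Q' \<and> Q \<subseteq> Q' \<and> p @ K \<in> Q' \<and> (\<forall>L\<in>Q' - Q. \<forall>b. target L b \<in> Q')"
  using assms
proof (induction "size_list size p" arbitrary: p Q K rule: less_induct)
  case less
  show ?case
  proof (cases p)
    case Nil
    then show ?thesis using less.prems by (intro exI[of _ Q]) simp
  next
    case (Cons i p')
    then have "size_list size p' < size_list size p" by simp
    from less.hyps[OF this less.prems] obtain Q1 where Q1: "finite Q1" "Q \<subseteq> Q1" "p' @ K \<in> Q1"
      "\<forall>L\<in>Q1 - Q. \<forall>b. target L b \<in> Q1" by blast
    show ?thesis
    proof (cases i)
      case (Inc r)
      then show ?thesis using Q1 Cons by (intro exI[of _ "insert (p @ K) Q1"]) auto
    next
      case (While r q)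
      let ?L = "While r q # p' @ K"
      have "size_list size q < size_list size p" using Cons While by simp
      from less.hyps[OF this, of "insert ?L Q1" ?L] Q1(1) obtain Q2 where Q2: "finite Q2"
        "insert ?L Q1 \<subseteq> Q2" "q @ ?L \<in> Q2" "\<forall>L\<in>Q2 - insert ?L Q1. \<forall>b. target L b \<in> Q2" by auto
      have "target L b \<in> Q2" if "L \<in> Q2 - Q" for L b
      proof (cases "L = ?L")
        case True
        then show ?thesis using Q1(3) Q2 by auto
      next
        case False
        then show ?thesis using that Q1 Q2 by (cases "L \<in> Q1") auto
      qed
      then show ?thesis using Q1 Q2 Cons While by (intro exI[of _ Q2]) auto
    qed
  qed
qed

text \<open>Controls of one round: \<open>Start\<close> shows the input, fuel and instruction blocks
  alternate, \<open>End\<close> closes the round. A block shows the touched register before the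
  step; which register that is follows from the control, not from the block.\<close>

datatype ctl = Start | Fuel "instr list" | Exec "instr list" | End

text \<open>What a run does while following a round. \<open>Idle\<close> looks for a wrong end of
  the round or for halting; \<open>Zero r\<close> waits for a nonempty first block of an initially
  empty register; \<open>Down r\<close> holds the expected value of \<open>r\<close> and waits for a
  smaller one; \<open>Guess\<close> waits for a suspected increase; \<open>Up r e\<close> has paid a
  value of \<open>r\<close> and regains the next one, less one if \<open>e\<close>;
  \<open>Short\<close> pays for the first fuel block. The register \<open>None\<close> is the
  fuel.\<close>

datatype job = Idle | Zero "nat option" | Down "nat option" | Guess | Up "nat option" bool | Short

text \<open>\<open>INIT\<close> waits for a round to test, \<open>TOP\<close> accepts whatever
  follows, \<open>NH\<close> bets that no letter 2 or 3 comes any more, \<open>CHK\<close> tests the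
  input block. \<open>CG\<close> guesses a counter for transactions, \<open>TI\<close> waits between
  them, \<open>MARK\<close> records a completed one. \<open>S0\<close> guesses a position,
  \<open>S1\<close> holds it, \<open>S2\<close> holds it minus the last insertion position,
  \<open>SA\<close> records a strict descent.\<close>

datatype bst = INIT | TOP | NH | MARK | SA | CHK | Job ctl job | CG | TI | S0 | S1 | S2

text \<open>The first tally letter must already move the counter, so in a nonempty block the
  terminator and the transition are guessed in advance and kept in \<open>Mid\<close>.
  \<open>OMG\<close> bets that the tally letters never end.\<close>

datatype ls = At bst | Mid nat int int bst | OMG

instance instr :: countable by countable_datatype
instance ctl :: countable by countable_datatype
instance job :: countable by countable_datatype
instance bst :: countable by countable_datatype
instance ls :: countable by countable_datatype

text \<open>States to which the initial state, the accepting list and the input check refer by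
  number get the numbers 0 to 6.\<close>

definition num :: "ls \<Rightarrow> nat" where
  "num s = (if s = At TOP then 0 else if s = At NH then 1 else if s = At MARK then 2
     else if s = At SA then 3 else if s = OMG then 4 else if s = At CHK then 5
     else if s = At INIT then 6 else 7 + to_nat s)"

lemma num_eq_iff: "num s = num s' \<longleftrightarrow> s = s'"
  unfolding num_def by (auto split: if_splits)

lemma num_simps [simp]: "num (At TOP) = 0" "num (At NH) = 1" "num (At MARK) = 2" "num (At SA) = 3"
  "num OMG = 4" "num (At CHK) = 5" "num (At INIT) = 6"
  by (simp_all add: num_def)

lemma num_5: "num s = 5 \<longleftrightarrow> s = At CHK"
  using num_eq_iff[of s "At CHK"] by simp

fun touched :: "ctl \<Rightarrow> nat option" where
  "touched Start = Some 0"
| "touched (Fuel K) = None"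
| "touched (Exec K) = Some (reg K)"
| "touched End = None"

fun change :: "ctl \<Rightarrow> bool \<Rightarrow> int" where
  "change Start b = 0"
| "change (Fuel K) b = (if b then -1 else 0)"
| "change (Exec K) b = delta K b"
| "change End b = 0"

lemma change_bounds: "change q b \<in> {-1, 0, 1}"
proof (cases q)
  case (Exec K)
  then show ?thesis by (cases "(K, b)" rule: delta.cases) auto
qed auto

lemma change_nonneg: "0 \<le> int n + change q (0 < n)"
proof (cases q)
  case (Exec K)
  then show ?thesis by (cases "(K, 0 < n)" rule: delta.cases) auto
qed auto

fun passes :: "job \<Rightarrow> ctl \<Rightarrow> bool" where
  "passes Idle q = True"
| "passes Guess q = True"
| "passes (Zero r) q = (touched q \<noteq> r)"
| "passes (Down r) q = (touched q \<noteq> r)"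
| "passes (Up r e) q = (touched q \<noteq> r)"
| "passes Short q = (touched q \<noteq> None)"

section \<open>Control and transitions of the automaton\<close>

locale machine =
  fixes prog :: "instr list" and Q :: "instr list set"
  assumes finite_Q: "finite Q" and prog_Q: "prog \<in> Q" and target_Q: "K \<in> Q \<Longrightarrow> target K b \<in> Q"
begin

definition C :: "ctl set" where
  "C = {Start, End} \<union> Fuel ` Q \<union> Exec ` Q"

fun succ :: "ctl \<Rightarrow> bool \<Rightarrow> ctl" where
  "succ Start b = Fuel prog"
| "succ (Fuel K) b = (if b then Exec K else End)"
| "succ (Exec K) b = Fuel (target K b)"
| "succ End b = End"

lemma succ_C: "q \<in> C \<Longrightarrow> succ q b \<in> C"
  using prog_Q target_Q by (auto simp: C_def)

text \<open>\<open>Fuel []\<close> is the control of a program that has halted, so a live control is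
  one from which the round must go on.\<close>

definition live :: "ctl \<Rightarrow> bool" where
  "live q \<longleftrightarrow> q \<in> C \<and> q \<noteq> End \<and> q \<noteq> Fuel []"

lemma live_C: "live q \<Longrightarrow> q \<in> C"
  by (simp add: live_def)

text \<open>A transition from \<open>s\<close> to \<open>s'\<close> reads a block \<open>1\<^sup>v t\<close> where \<open>b\<close> tells whether \<open>v > 0\<close>, and
  adds \<open>sg * v + d\<close> to the counter.\<close>
inductive btr :: "bst \<Rightarrow> nat \<Rightarrow> bool \<Rightarrow> int \<Rightarrow> int \<Rightarrow> bst \<Rightarrow> bool" where
  b_init: "t \<in> {0, 2, 3} \<Longrightarrow> s' \<in> {INIT, NH, CG, S0} \<Longrightarrow> btr INIT t b 0 0 s'"
| b_nh: "btr NH 0 b 0 0 NH"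
| b_top: "t \<in> {0, 2, 3} \<Longrightarrow> btr TOP t b 0 0 TOP"
| b_round: "t \<in> {2, 3} \<Longrightarrow> j = Idle \<or> (\<exists>r. j = Zero r \<and> r \<in> touched ` C \<and> r \<noteq> None \<and> r \<noteq> Some 0) \<Longrightarrow>
    btr INIT t b 0 0 (Job Start j)"
| b_chk: "t \<in> {2, 3} \<Longrightarrow> btr INIT t b 0 0 CHK"
| b_walk: "live q \<Longrightarrow> passes j q \<Longrightarrow> j \<in> {Idle, Guess, Short} \<union> range Zero \<union> range Down \<union> {Up r e |r e. True} \<Longrightarrow>
    (\<forall>r. j = Zero r \<or> j = Down r \<or> (\<exists>e. j = Up r e) \<longrightarrow> r \<in> touched ` C) \<Longrightarrow>
    btr (Job q j) 0 b 0 0 (Job (succ q b) j)"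
| b_early: "q \<in> C \<Longrightarrow> q \<noteq> End \<Longrightarrow> t \<in> {2, 3} \<Longrightarrow> btr (Job q Idle) t b 0 0 TOP"
| b_late: "btr (Job End Idle) 0 b 0 0 TOP"
| b_halt: "Fuel [] \<in> C \<Longrightarrow> t \<in> {0, 2, 3} \<Longrightarrow> btr (Job (Fuel []) Idle) t b 0 0 TOP"
| b_zero: "live q \<Longrightarrow> btr (Job q (Zero (touched q))) 0 True 0 0 TOP"
| b_down1: "live q \<Longrightarrow> btr (Job q Idle) 0 b 1 (change q b) (Job (succ q b) (Down (touched q)))"
| b_down2: "live q \<Longrightarrow> btr (Job q (Down (touched q))) 0 b (-1) (-1) TOP"
| b_guess: "t \<in> {0, 2, 3} \<Longrightarrow> btr CG t b 0 1 CG"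
| b_guessed: "t \<in> {0, 2, 3} \<Longrightarrow> btr CG t b 0 0 TI"
| b_skip: "t \<in> {0, 2, 3} \<Longrightarrow> s \<in> {TI, MARK} \<Longrightarrow> btr s t b 0 0 TI"
| b_enter: "t \<in> {2, 3} \<Longrightarrow> s \<in> {TI, MARK} \<Longrightarrow> j \<in> {Guess, Short} \<Longrightarrow> btr s t b 0 0 (Job Start j)"
| b_up1: "live q \<Longrightarrow> btr (Job q Guess) 0 b (-1) (- change q b) (Job (succ q b) (Up (touched q) True))"
| b_up2: "live q \<Longrightarrow> btr (Job q (Up (touched q) e)) 0 b 1 (if e then -1 else 0) MARK"
| b_short0: "live q \<Longrightarrow> touched q = None \<Longrightarrow> btr (Job q Short) 0 False 0 0 MARK"
| b_short1: "live q \<Longrightarrow> touched q = None \<Longrightarrow> btr (Job q Short) 0 True (-1) 1 (Job (succ q True) (Up None False))"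
| b_s0: "t \<in> {0, 2, 3} \<Longrightarrow> btr S0 t b 0 1 S0"
| b_s01: "btr S0 3 b 0 0 S1"
| b_s1: "t \<in> {0, 2, 3} \<Longrightarrow> s \<in> {S1, SA} \<Longrightarrow> btr s t b 0 0 S1"
| b_s12: "s \<in> {S1, SA} \<Longrightarrow> btr s 2 b (-1) 0 S2"
| b_s2: "btr S2 0 b 0 0 S2"
| b_s21: "btr S2 3 b 1 1 S1"
| b_s2a: "btr S2 3 b 1 0 SA"

definition BS :: "bst set" where
  "BS = {INIT, TOP, NH, MARK, SA, CHK, CG, TI, S0, S1, S2} \<union> (\<lambda>(q, j). Job q j) `
     (C \<times> ({Idle, Guess, Short} \<union> Zero ` touched ` C \<union> Down ` touched ` C
        \<union> (\<lambda>(r, e). Up r e) ` (touched ` C \<times> UNIV)))"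

lemma finite_C: "finite C"
  unfolding C_def using finite_Q by simp

lemma finite_BS: "finite BS"
  unfolding BS_def using finite_C by (simp add: finite_image_iff[THEN iffD2] finite_cartesian_product)

lemma Job_BS: "Job q j \<in> BS \<longleftrightarrow> q \<in> C \<and> (case j of Idle \<Rightarrow> True | Guess \<Rightarrow> True | Short \<Rightarrow> True
   | Zero r \<Rightarrow> r \<in> touched ` C | Down r \<Rightarrow> r \<in> touched ` C | Up r e \<Rightarrow> r \<in> touched ` C)"
  by (cases j) (auto simp: BS_def image_iff)

lemma Start_C: "Start \<in> C" "End \<in> C"
  by (auto simp: C_def)

lemma btr_range:
  assumes "btr s t b sg d s'"
  shows "s \<in> BS \<and> s' \<in> BS \<and> t \<in> {0, 2, 3} \<and> sg \<in> {-1, 0, 1} \<and> d \<in> {-1, 0, 1}"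
  using assms
proof (cases rule: btr.cases)
  case (b_walk q j)
  then show ?thesis using succ_C live_C by (cases j) (auto simp: Job_BS)
next
  case (b_down1 q)
  then show ?thesis using succ_C live_C change_bounds[of q b] by (auto simp: Job_BS)
next
  case (b_up1 q)
  then show ?thesis using succ_C live_C change_bounds[of q b] by (auto simp: Job_BS)
next
  case (b_short1 q)
  then show ?thesis using succ_C live_C[of q] by (auto simp: Job_BS image_iff intro!: bexI[of _ q])
next
  case (b_zero q)
  then show ?thesis using live_C by (auto simp: Job_BS) (simp add: BS_def)
next
  case (b_down2 q)
  then show ?thesis using live_C by (auto simp: Job_BS) (simp add: BS_def)
next
  case (b_up2 q)
  then show ?thesis using live_C by (auto simp: Job_BS) (simp_all add: BS_def)
next
  case (b_round j)
  moreover from this have "Job Start j \<in> BS"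
    using Start_C unfolding Job_BS by (elim disjE exE conjE) simp_all
  ultimately show ?thesis by (simp add: BS_def)
next
  case (b_enter j)
  then show ?thesis using Start_C by (auto simp: Job_BS) (simp_all add: BS_def)
next
  case (b_early q)
  then show ?thesis by (auto simp: Job_BS) (simp_all add: BS_def)
next
  case (b_late)
  then show ?thesis using Start_C by (auto simp: Job_BS) (simp_all add: BS_def)
next
  case (b_halt)
  then show ?thesis by (auto simp: Job_BS) (simp_all add: BS_def)
next
  case (b_short0 q)
  then show ?thesis using live_C by (auto simp: Job_BS) (simp_all add: BS_def)
qed (auto simp: BS_def)

text \<open>Applying \<open>sg\<close> at each tally letter and \<open>d\<close> at the terminator
  realises the change \<open>sg * v + d\<close> in real time. \<open>TOP\<close> reads single
  letters because the input check may enter it in the middle of a block.\<close>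

inductive ltr :: "ls \<Rightarrow> nat \<Rightarrow> int \<Rightarrow> ls \<Rightarrow> bool" where
  l_empty: "btr s t False sg d s' \<Longrightarrow> ltr (At s) t d (At s')"
| l_first: "btr s t True sg d s' \<Longrightarrow> ltr (At s) 1 sg (Mid t sg d s')"
| l_more: "btr s t True sg d s' \<Longrightarrow> ltr (Mid t sg d s') 1 sg (Mid t sg d s')"
| l_last: "btr s t True sg d s' \<Longrightarrow> ltr (Mid t sg d s') t d (At s')"
| l_omg: "s \<in> {At INIT, OMG} \<Longrightarrow> ltr s 1 0 OMG"
| l_top: "l < 4 \<Longrightarrow> ltr (At TOP) l 0 (At TOP)"

definition LS :: "ls set" where
  "LS = At ` BS \<union> (\<lambda>(t, sg, d, s). Mid t sg d s) ` ({0, 2, 3} \<times> {-1, 0, 1} \<times> {-1, 0, 1} \<times> BS) \<union> {OMG}"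

lemma finite_LS: "finite LS"
  unfolding LS_def using finite_BS by simp

lemma At_LS: "At s \<in> LS \<longleftrightarrow> s \<in> BS"
  and OMG_LS: "OMG \<in> LS"
  and Mid_LS: "t \<in> {0, 2, 3} \<Longrightarrow> sg \<in> {-1, 0, 1} \<Longrightarrow> d \<in> {-1, 0, 1} \<Longrightarrow> s \<in> BS \<Longrightarrow> Mid t sg d s \<in> LS"
    by (auto simp: LS_def simp del: insert_iff) (auto simp: image_iff)

lemma ltr_range:
  assumes "ltr s l d s'"
  shows "s \<in> LS \<and> s' \<in> LS \<and> l < 4 \<and> d \<in> {-1, 0, 1}"
proof -
  have T: "t < 4" if "t \<in> {0, 2, 3}" for t :: nat using that by auto
  have I: "INIT \<in> BS" "TOP \<in> BS" by (simp_all add: BS_def)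
  from assms show ?thesis
  proof cases
    case l_omg
    then show ?thesis using I by (auto simp: At_LS OMG_LS)
  next
    case l_top
    then show ?thesis using I by (simp add: At_LS)
  next
    case (l_empty b sg b')
    then show ?thesis using btr_range[OF l_empty(3)] by (simp add: At_LS T)
  next
    case (l_first b t d' b')
    then show ?thesis using btr_range[OF l_first(4)] by (simp add: At_LS Mid_LS)
  next
    case (l_more b t d' b')
    then show ?thesis using btr_range[OF l_more(4)] by (simp add: Mid_LS)
  next
    case (l_last b sg b')
    then show ?thesis using btr_range[OF l_last(3)] by (simp add: At_LS Mid_LS T)
  qed
qed

definition base :: "(nat \<times> nat \<times> nat \<times> nat) list" where
  "base = (SOME xs. set xs = {(num s, l, nat (d + 1), num s') |s l d s'. ltr s l d s'})"

lemma set_base: "set base = {(num s, l, nat (d + 1), num s') |s l d s'. ltr s l d s'}"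
proof -
  have "{(num s, l, nat (d + 1), num s') |s l d s'. ltr s l d s'}
    \<subseteq> (\<lambda>(s, l, d, s'). (num s, l, nat (d + 1), num s')) ` (LS \<times> {..<4} \<times> {-1, 0, 1} \<times> LS)"
  proof clarify
    fix s l d s' assume "ltr s l d s'"
    from ltr_range[OF this] have "(s, l, d, s') \<in> LS \<times> {..<4} \<times> {-1, 0, 1} \<times> LS" by simp
    then show "(num s, l, nat (d + 1), num s') \<in>
      (\<lambda>(s, l, d, s'). (num s, l, nat (d + 1), num s')) ` (LS \<times> {..<4} \<times> {-1, 0, 1} \<times> LS)"
      by (rule rev_image_eqI) simp
  qed
  then have "finite {(num s, l, nat (d + 1), num s') |s l d s'. ltr s l d s'}"
    by (rule finite_subset) (simp add: finite_LS)
  from finite_list[OF this] show ?thesis unfolding base_def by (rule someI_ex)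
qed

definition X :: nat where
  "X = code_trans base"

definition A :: bca where
  "A = with_input X base"

end

section \<open>Well-formedness and code of the automaton\<close>

lemma less_list_encode: "x \<in> set xs \<Longrightarrow> x < list_encode xs"
proof (induction xs)
  case (Cons y ys)
  then show ?case using le_prod_encode_1[of y "list_encode ys"] le_prod_encode_2[of "list_encode ys" y]
    by auto
qed simp

text \<open>Hence \<open>X\<close> exceeds all state numbers in \<open>base\<close>, and the
  counting states \<open>X + i\<close> are new.\<close>

lemma less_code_trans:
  assumes "(p, a, d, q) \<in> set ts"
  shows "p < code_trans ts" "q < code_trans ts"
proof -
  have "code_tr (p, a, d, q) < code_trans ts"
    unfolding code_trans_def using assms by (intro less_list_encode) force
  moreover have "p < code_tr (p, a, d, q)" "q < code_tr (p, a, d, q)"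
    unfolding code_tr.simps by (rule less_list_encode; simp)+
  ultimately show "p < code_trans ts" "q < code_trans ts" by linarith+
qed

lemma set_chain:
  "set (chain X base n) = set base \<union> {(X + i, 1, 1, X + Suc i) |i. i < n} \<union> {(X + i, 0, 1, 0) |i. i < n}"
  by (induction n) (auto simp: less_Suc_eq)

context machine
begin

lemma base_less_X:
  assumes "ltr s l d s'"
  shows "num s < X" "num s' < X"
proof -
  have "(num s, l, nat (d + 1), num s') \<in> set base" using assms by (auto simp: set_base)
  then show "num s < X" "num s' < X" unfolding X_def by (rule less_code_trans)+
qed

lemma alph_A [simp]: "alph A = 4" and init_A [simp]: "init A = 6" and acc_A [simp]: "acc A = [0, 1, 2, 3, 4]"
  by (simp_all add: A_def with_input_def)

lemma trans_A: "set (bca.trans A) = {(5, 1, 1, X + 1), (5, 0, 1, 0), (X + X, 1, 1, 0)} \<union> set base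
    \<union> {(X + i, 1, 1, X + Suc i) |i. i < X} \<union> {(X + i, 0, 1, 0) |i. i < X}"
  by (auto simp: A_def with_input_def set_chain)

lemma X_pos: "6 < X"
proof -
  have "ltr (At INIT) 1 0 OMG" by (rule l_omg) simp
  from base_less_X(1)[OF this] show ?thesis by simp
qed

lemma wf_A: "wf_bca A"
proof -
  have "p < 3 * X + 10 \<and> a < 4 \<and> d \<le> 2 \<and> q < 3 * X + 10" if "(p, a, d, q) \<in> set (bca.trans A)" for p a d q
    using that unfolding trans_A set_base
  proof (elim UnE)
    assume "(p, a, d, q) \<in> {(num s, l, nat (d + 1), num s') |s l d s'. ltr s l d s'}"
    then obtain s l d' s' where *: "p = num s" "a = l" "d = nat (d' + 1)" "q = num s'" "ltr s l d' s'"
      by blast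
    then show ?thesis using ltr_range[OF *(5)] base_less_X[OF *(5)] by auto
  qed (use X_pos in auto)
  then show ?thesis unfolding wf_bca_def using X_pos
    by (auto simp: A_def with_input_def split: prod.splits)
qed

lemma code_A: "code_bca A = code_with_input X"
  unfolding A_def by (rule code_bca_with_input) (simp add: X_def)

end

lemma ex_machine: "\<exists>Q. machine prog Q"
proof -
  obtain Q where Q: "finite Q" "{[]} \<subseteq> Q" "prog @ [] \<in> Q" "\<forall>L\<in>Q - {[]}. \<forall>b. target L b \<in> Q"
    using ex_closed_extension[of "{[]}" "[]" prog] by auto
  have "target K b \<in> Q" if "K \<in> Q" for K b
    using Q that by (cases "K = []") auto
  then have "machine prog Q" using Q by (unfold_locales) auto
  then show ?thesis ..
qed

section \<open>Blocks and letters\<close>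

context machine
begin

text \<open>A whole block becomes one step. The intermediate inequality is stated separately because
  the counter has to survive the tally letters before \<open>d\<close> is added. The input check
  appears as a step of its own, since its counting states are not of type
  \<open>bst\<close>.\<close>

definition block_steps :: "(nat \<Rightarrow> nat) \<Rightarrow> (nat \<Rightarrow> nat) \<Rightarrow> ((nat \<times> bst \<times> nat) \<times> (nat \<times> bst \<times> nat)) set" where
  "block_steps v t = {((k, s, c), (Suc k, s', c')) |k s c s' c'.
     (\<exists>sg d. btr s (t k) (0 < v k) sg d s' \<and> 0 \<le> int c + sg * int (v k)
        \<and> int c' = int c + sg * int (v k) + d)
     \<or> s = CHK \<and> s' = TOP \<and> c' = c \<and> t k = 0 \<and> v k \<noteq> X}"

lemmas rtrancl_snoc = rtrancl.rtrancl_into_rtrancl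

abbreviation "steps \<equiv> letter_steps A"

lemma block_stepI:
  assumes "btr s (t k) (0 < v k) sg d s'" "0 \<le> int c + sg * int (v k)"
    "int c' = int c + sg * int (v k) + d"
  shows "((k, s, c), (Suc k, s', c')) \<in> block_steps v t"
  using assms unfolding block_steps_def by blast

lemma letter_stepI:
  assumes "ltr s l d s'" "w i = l" "int c' = int c + d"
  shows "((i, num s, c), (Suc i, num s', c')) \<in> steps w"
proof -
  have "(num s, w i, nat (d + 1), num s') \<in> set (bca.trans A)"
    using assms(1,2) by (auto simp: trans_A set_base)
  moreover have "int (nat (d + 1)) = d + 1" using ltr_range[OF assms(1)] by auto
  ultimately show ?thesis using assms(3) unfolding letter_steps_def by force
qed

lemma letter_stepI2:
  assumes "(p, w i, 1, q) \<in> set (bca.trans A)"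
  shows "((i, p, c), (Suc i, q, c)) \<in> steps w"
  using assms unfolding letter_steps_def by force

lemma top_path:
  assumes "w \<in> omega_words 4" "i \<le> j"
  shows "((i, 0, c), (j, 0, c)) \<in> (steps w)\<^sup>*"
  using assms(2)
proof (induction j rule: dec_induct)
  case (step j)
  have "ltr (At TOP) (w j) 0 (At TOP)" using assms(1) by (intro l_top) (simp add: omega_words_def)
  from letter_stepI[OF this, of w j c c] step show ?case by (simp add: rtrancl_snoc)
qed simp

lemma chain_path:
  assumes b: "blocks w v t" and j: "1 \<le> j" "j \<le> v k" "j \<le> X"
  shows "((start v k, 5, c), (start v k + j, X + j, c)) \<in> (steps w)\<^sup>+"
  using j
proof (induction j rule: dec_induct)
  case base
  have "w (start v k) = 1" using b base unfolding blocks_def by (metis add.right_neutral less_eq_Suc_le One_nat_def)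
  then have "((start v k, 5, c), (Suc (start v k), X + 1, c)) \<in> steps w"
    by (intro letter_stepI2) (simp add: trans_A)
  then show ?case by auto
next
  case (step j)
  have "w (start v k + j) = 1" using b step unfolding blocks_def by simp
  then have "((start v k + j, X + j, c), (Suc (start v k + j), X + Suc j, c)) \<in> steps w"
    using step by (intro letter_stepI2) (simp add: trans_A)
  then show ?case using step by (auto intro: trancl_into_trancl)
qed

lemma chk_path:
  assumes w: "w \<in> omega_words 4" and b: "blocks w v t" and "t k = 0" "v k \<noteq> X"
  shows "((start v k, 5, c), (start v (Suc k), 0, c)) \<in> (steps w)\<^sup>+"
proof (cases "v k < X")
  case True
  have last: "w (start v k + v k) = 0" using b assms(3) by (simp add: blocks_def)
  show ?thesis
  proof (cases "v k = 0")
    case True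
    then have "((start v k, 5, c), (Suc (start v k), 0, c)) \<in> steps w"
      using last by (intro letter_stepI2) (simp add: trans_A)
    then show ?thesis using True by (auto simp: start_Suc)
  next
    case False
    then have "((start v k, 5, c), (start v k + v k, X + v k, c)) \<in> (steps w)\<^sup>+"
      using True by (intro chain_path[OF b]) auto
    moreover have "((start v k + v k, X + v k, c), (Suc (start v k + v k), 0, c)) \<in> steps w"
      using last True by (intro letter_stepI2) (simp add: trans_A)
    ultimately show ?thesis by (simp add: start_Suc)
  qed
next
  case False
  then have X: "X < v k" using assms(4) by simp
  have "((start v k, 5, c), (start v k + X, X + X, c)) \<in> (steps w)\<^sup>+"
    using X X_pos by (intro chain_path[OF b]) auto
  moreover have "((start v k + X, X + X, c), (Suc (start v k + X), 0, c)) \<in> steps w"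
    using b X by (intro letter_stepI2) (simp add: trans_A blocks_def)
  moreover have "((Suc (start v k + X), 0, c), (start v (Suc k), 0, c)) \<in> (steps w)\<^sup>*"
    by (rule top_path[OF w]) (use X in \<open>simp add: start_Suc\<close>)
  ultimately show ?thesis by (meson trancl_into_trancl trancl_rtrancl_trancl)
qed

lemma btr_path:
  assumes b: "blocks w v t" and tr: "btr s (t k) (0 < v k) sg d s'"
    and c: "0 \<le> int c + sg * int (v k)" "int c' = int c + sg * int (v k) + d"
  shows "((start v k, num (At s), c), (start v (Suc k), num (At s'), c')) \<in> (steps w)\<^sup>+"
proof (cases "v k = 0")
  case True
  then have "w (start v k) = t k" using b unfolding blocks_def by (metis add.right_neutral)
  then have "((start v k, num (At s), c), (Suc (start v k), num (At s'), c')) \<in> steps w"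
    by (intro letter_stepI[OF l_empty]) (use tr True c in auto)
  then show ?thesis using True by (auto simp: start_Suc)
next
  case False
  then have tr: "btr s (t k) True sg d s'" using tr by simp
  let ?M = "num (Mid (t k) sg d s')"
  have sg: "sg \<in> {-1, 0, 1}" using btr_range[OF tr] by simp
  have nn: "0 \<le> int c + sg * int j" if "j \<le> v k" for j using sg c(1) that by auto
  have "((start v k, num (At s), c), (start v k + j, ?M, nat (int c + sg * int j))) \<in> (steps w)\<^sup>+"
    if "1 \<le> j" "j \<le> v k" for j
    using that
  proof (induction j rule: dec_induct)
    case base
    have "w (start v k) = 1" using b base unfolding blocks_def by (metis add.right_neutral less_eq_Suc_le One_nat_def)
    then have "((start v k, num (At s), c), (Suc (start v k), ?M, nat (int c + sg * int 1))) \<in> steps w"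
      using nn[OF base(1)] by (intro letter_stepI[OF l_first[OF tr]]) auto
    then show ?case by auto
  next
    case (step j)
    have "w (start v k + j) = 1" using b step unfolding blocks_def by simp
    then have "((start v k + j, ?M, nat (int c + sg * int j)), (Suc (start v k + j), ?M, nat (int c + sg * int (Suc j))))
      \<in> steps w"
      using nn[of j] nn[of "Suc j"] step
      by (intro letter_stepI[OF l_more[OF tr]]) (auto simp: algebra_simps)
    then show ?case using step by (auto intro: trancl_into_trancl)
  qed
  from this[of "v k"] False
  have "((start v k, num (At s), c), (start v k + v k, ?M, nat (int c + sg * int (v k)))) \<in> (steps w)\<^sup>+"
    by simp
  moreover have "((start v k + v k, ?M, nat (int c + sg * int (v k))), (Suc (start v k + v k), num (At s'), c'))
      \<in> steps w"
    using b c by (intro letter_stepI[OF l_last[OF tr]]) (auto simp: blocks_def)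
  ultimately show ?thesis by (simp add: start_Suc)
qed

definition at_block :: "(nat \<Rightarrow> nat) \<Rightarrow> nat \<times> bst \<times> nat \<Rightarrow> nat \<times> nat \<times> nat" where
  "at_block v = (\<lambda>(k, s, c). (start v k, num (At s), c))"

lemma block_step_imp_letter_path:
  assumes "w \<in> omega_words 4" "blocks w v t" "(x, y) \<in> block_steps v t"
  shows "(at_block v x, at_block v y) \<in> (steps w)\<^sup>+"
  using assms(3) btr_path[OF assms(2)] chk_path[OF assms(1,2)]
  unfolding block_steps_def at_block_def by auto

lemma block_path_imp_letter_path:
  assumes "w \<in> omega_words 4" "blocks w v t" "(x, y) \<in> (block_steps v t)\<^sup>+"
  shows "(at_block v x, at_block v y) \<in> (steps w)\<^sup>+"
  using assms(3)
  by (induction rule: trancl_induct)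
    (auto dest: block_step_imp_letter_path[OF assms(1,2)] intro: trancl_trans)

lemma in_lang_if_infinite_block_path:
  assumes "w \<in> omega_words 4" "blocks w v t"
    and "((0, INIT, 0), f 0) \<in> (block_steps v t)\<^sup>+"
    and "\<And>k. (f k, f (Suc k)) \<in> (block_steps v t)\<^sup>+"
    and "\<And>k. fst (snd (f k)) \<in> {TOP, NH, MARK, SA}"
  shows "w \<in> lang A"
proof (rule in_lang_if_infinite_path)
  show "w \<in> omega_words (alph A)" using assms(1) by simp
  show "((0, init A, 0), at_block v (f 0)) \<in> (steps w)\<^sup>+"
    using block_path_imp_letter_path[OF assms(1,2,3)] by (simp add: at_block_def)
  show "(at_block v (f k), at_block v (f (Suc k))) \<in> (steps w)\<^sup>+" for k
    by (rule block_path_imp_letter_path[OF assms(1,2,4)])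
  show "fst (snd (at_block v (f k))) \<in> set (acc A)" for k
    using assms(5)[of k] by (auto simp: at_block_def split: prod.splits)
qed

text \<open>Words ending in tally letters only are no infinite sequence of blocks; the part before
  is read in \<open>INIT\<close> and the rest in \<open>OMG\<close>.\<close>

lemma in_lang_if_finitely_many_blocks:
  assumes w: "w \<in> omega_words 4" and fin: "finite {i. w i \<noteq> 1}"
  shows "w \<in> lang A"
proof -
  let ?E = "steps w"
  have tr: "btr INIT t b 0 0 INIT" if "t \<in> {0, 2, 3}" for t b using that by (intro b_init) auto
  have wt: "w i \<in> {0, 2, 3}" if "w i \<noteq> 1" for i
  proof -
    have "w i < 4" using w by (simp add: omega_words_def)
    then show ?thesis using that by auto
  qed
  \<comment> \<open>Inside a block the run has already guessed the terminator, so the claim is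
    carried along for all three guesses.\<close>
  have "if i = 0 \<or> w (i - 1) \<noteq> 1 then ((0, 6, 0), (i, 6, 0)) \<in> ?E\<^sup>*
    else \<forall>t\<in>{0, 2, 3}. ((0, 6, 0), (i, num (Mid t 0 0 INIT), 0)) \<in> ?E\<^sup>*" for i
  proof (induction i)
    case (Suc i)
    show ?case
    proof (cases "i = 0 \<or> w (i - 1) \<noteq> 1")
      case True
      then have IH: "((0, 6, 0), (i, 6, 0)) \<in> ?E\<^sup>*" using Suc by simp
      show ?thesis
      proof (cases "w i = 1")
        case True
        then have "((i, num (At INIT), 0), (Suc i, num (Mid t 0 0 INIT), 0)) \<in> ?E" if "t \<in> {0, 2, 3}" for t
          by (intro letter_stepI[OF l_first[OF tr[OF that]]]) auto
        then show ?thesis using True IH by (auto intro: rtrancl_snoc)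
      next
        case False
        then have "((i, num (At INIT), 0), (Suc i, num (At INIT), 0)) \<in> ?E"
          by (intro letter_stepI[OF l_empty[OF tr[OF wt]]]) auto
        then show ?thesis using False IH by (auto intro: rtrancl_snoc)
      qed
    next
      case False
      have IH: "((0, 6, 0), (i, num (Mid t 0 0 INIT), 0)) \<in> ?E\<^sup>*" if "t \<in> {0, 2, 3}" for t
        using Suc.IH that unfolding if_not_P[OF False] by (rule bspec)
      show ?thesis
      proof (cases "w i = 1")
        case True
        then have "((i, num (Mid t 0 0 INIT), 0), (Suc i, num (Mid t 0 0 INIT), 0)) \<in> ?E" if "t \<in> {0, 2, 3}" for t
          by (intro letter_stepI[OF l_more[OF tr[OF that]]]) auto
        then have "((0, 6, 0), (Suc i, num (Mid t 0 0 INIT), 0)) \<in> ?E\<^sup>*" if "t \<in> {0, 2, 3}" for t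
          using IH[OF that] that by (meson rtrancl_snoc)
        then show ?thesis using True by simp
      next
        case False
        then have "((i, num (Mid (w i) 0 0 INIT), 0), (Suc i, num (At INIT), 0)) \<in> ?E"
          by (intro letter_stepI[OF l_last[OF tr[OF wt]]]) auto
        then show ?thesis using False IH[OF wt[OF False]] by (auto intro: rtrancl_snoc)
      qed
    qed
  qed simp
  note init = this
  obtain N where N: "\<And>i. N \<le> i \<Longrightarrow> w i = 1" "N = 0 \<or> w (N - 1) \<noteq> 1"
  proof (cases "{i. w i \<noteq> 1} = {}")
    case True
    then show ?thesis using that[of 0] by auto
  next
    case False
    let ?m = "Max {i. w i \<noteq> 1}"
    have "?m \<in> {i. w i \<noteq> 1}" using fin False by (rule Max_in)
    moreover have "w i = 1" if "Suc ?m \<le> i" for i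
    proof (rule ccontr)
      assume "w i \<noteq> 1"
      then have "i \<le> ?m" using fin by (intro Max_ge) auto
      then show False using that by simp
    qed
    ultimately show ?thesis using that[of "Suc ?m"] by simp
  qed
  have omg: "((i, num s, c), (Suc i, 4, c)) \<in> ?E" if "N \<le> i" "s \<in> {At INIT, OMG}" for i s c
    using letter_stepI[OF l_omg[OF that(2)], of w i c c] N(1)[OF that(1)] by simp
  show ?thesis
  proof (rule in_lang_if_infinite_path[where f = "\<lambda>k. (Suc N + k, 4, 0)"])
    show "w \<in> omega_words (alph A)" using w by simp
    have "((0, 6, 0), (N, 6, 0)) \<in> ?E\<^sup>*" using init[of N] N(2) by simp
    moreover have "((N, 6, 0), (Suc N, 4, 0)) \<in> ?E" using omg[of N "At INIT" 0] by simp
    ultimately show "((0, init A, 0), (Suc N + 0, 4, 0)) \<in> ?E\<^sup>+" by simp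
    show "((Suc N + k, 4, 0), (Suc N + Suc k, 4, 0)) \<in> ?E\<^sup>+" for k
      using omg[of "Suc N + k" OMG 0] by auto
  qed simp
qed

lemma base_bounds: "(p, l, d, q) \<in> set base \<Longrightarrow> p < X \<and> q < X"
  unfolding X_def using less_code_trans by blast

lemma run_step_cases:
  assumes "(num s, l, d, q) \<in> set (bca.trans A)" "num s < X" "s \<noteq> At CHK"
  shows "\<exists>d' s'. ltr s l d' s' \<and> d = nat (d' + 1) \<and> q = num s'"
proof -
  have "num s \<noteq> 5" using assms(3) num_5 by simp
  then have "(num s, l, d, q) \<in> set base" using assms(1,2) by (auto simp: trans_A)
  then show ?thesis by (auto simp: set_base num_eq_iff)
qed

inductive_cases ltr_AtE: "ltr (At s) l d s'"
inductive_cases ltr_MidE: "ltr (Mid t sg d s) l d' s'"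
inductive_cases ltr_OMGE: "ltr OMG l d s'"

text \<open>Inside a block a surviving run is in a \<open>Mid\<close> state, which is not accepting:
  \<open>OMG\<close> cannot read a terminator, and the input check gets stuck on a correct input
  block. Acceptance can therefore be judged at block boundaries.\<close>

lemma run_imp_block_step:
  assumes b: "blocks w v t" and t1: "t k \<noteq> 1" and run: "is_run A w \<rho> c"
    and s: "\<rho> (start v k) = num (At s)" "num (At s) < X" "s \<noteq> TOP"
    and chk: "s = CHK \<longrightarrow> v k = X \<and> t k = 0"
  shows "\<exists>s'. \<rho> (start v (Suc k)) = num (At s') \<and> num (At s') < X \<and>
    ((k, s, c (start v k)), (Suc k, s', c (start v (Suc k)))) \<in> block_steps v t \<and>
    (\<forall>j. 0 < j \<and> j \<le> v k \<longrightarrow> \<rho> (start v k + j) \<notin> set (acc A))"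
proof -
  let ?i = "start v k"
  have rstep: "\<exists>d. (\<rho> i, w i, d, \<rho> (Suc i)) \<in> set (bca.trans A) \<and> int (c (Suc i)) = int (c i) + int d - 1" for i
    using run unfolding is_run_def by blast
  have lstep: "\<exists>d s'. ltr s (w i) d s' \<and> \<rho> (Suc i) = num s' \<and> num s' < X \<and> int (c (Suc i)) = int (c i) + d"
    if "\<rho> i = num s" "num s < X" "s \<noteq> At CHK" for i s
  proof -
    obtain d where d: "(\<rho> i, w i, d, \<rho> (Suc i)) \<in> set (bca.trans A)" "int (c (Suc i)) = int (c i) + int d - 1"
      using rstep by blast
    with run_step_cases[of s "w i" d "\<rho> (Suc i)"] that obtain d' s' where
      *: "ltr s (w i) d' s'" "d = nat (d' + 1)" "\<rho> (Suc i) = num s'" by auto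
    moreover have "int d = d' + 1" using ltr_range[OF *(1)] *(2) by auto
    ultimately show ?thesis using d(2) base_less_X[OF *(1)] by (intro exI[of _ d'] exI[of _ s']) auto
  qed
  have ones: "w (?i + j) = 1" if "j < v k" for j using b that by (simp add: blocks_def)
  have last: "w (?i + v k) = t k" using b by (simp add: blocks_def)
  show ?thesis
  proof (cases "s = CHK")
    case True
    have "\<rho> (?i + j) = X + j" if "1 \<le> j" "j \<le> X" for j
      using that
    proof (induction j rule: dec_induct)
      case base
      obtain d where d: "(5, 1, d, \<rho> (Suc ?i)) \<in> set (bca.trans A)"
        using rstep[of ?i] ones[of 0] chk True s(1) X_pos by auto
      have "\<not> ltr (At CHK) l d s'" for l d s'
        by (auto elim!: ltr_AtE btr.cases)
      then have "(5, 1, d, \<rho> (Suc ?i)) \<notin> set base" for d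
        unfolding set_base by (auto simp: num_5 eq_commute[of 5])
      then show ?case using d X_pos by (auto simp: trans_A)
    next
      case (step j)
      then obtain d where d: "(X + j, 1, d, \<rho> (Suc (?i + j))) \<in> set (bca.trans A)"
        using rstep[of "?i + j"] ones[of j] chk True by auto
      then show ?case using step X_pos by (auto simp: trans_A dest!: base_bounds)
    qed
    then have "\<rho> (?i + v k) = X + X" using chk True X_pos by simp
    with rstep[of "?i + v k"] last chk True obtain d q where "(X + X, 0, d, q) \<in> set (bca.trans A)" by auto
    then have False using X_pos by (auto simp: trans_A dest!: base_bounds)
    then show ?thesis ..
  next
    case False
    then have nchk: "At s \<noteq> At CHK" by simp
    show ?thesis
    proof (cases "v k = 0")
      case True
      then have "w ?i = t k" using last by simp
      with lstep[OF s(1,2) nchk] obtain d s' where d: "ltr (At s) (t k) d s'" "\<rho> (Suc ?i) = num s'"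
        "num s' < X" "int (c (Suc ?i)) = int (c ?i) + d" by auto
      from d(1) t1 s(3) obtain sg b' where "s' = At b'" "btr s (t k) False sg d b'"
        by (auto elim: ltr_AtE)
      then show ?thesis using True d unfolding block_steps_def by (auto simp: start_Suc)
    next
      case v: False
      with lstep[OF s(1,2) nchk] ones[of 0] obtain d0 s0 where d0: "ltr (At s) 1 d0 s0" "\<rho> (Suc ?i) = num s0"
        "num s0 < X" "int (c (Suc ?i)) = int (c ?i) + d0" by auto
      have "\<not> btr s 1 b sg d s'" for b sg d s' using btr_range by force
      with d0(1) s(3) consider (omg) "s0 = OMG" | (mid) t' d s' where "s0 = Mid t' d0 d s'" "btr s t' True d0 d s'"
        by (auto elim: ltr_AtE)
      then show ?thesis
      proof cases
        case omg
        have "\<rho> (?i + j) = num OMG" if "1 \<le> j" "j \<le> v k" for j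
          using that
        proof (induction j rule: dec_induct)
          case base
          then show ?case using d0(2) omg by simp
        next
          case (step j)
          then have *: "\<rho> (?i + j) = num OMG" by simp
          obtain d s' where "ltr OMG (w (?i + j)) d s'" "\<rho> (Suc (?i + j)) = num s'"
            using lstep[OF *] d0(3) omg by auto
          then show ?case by (auto elim: ltr_OMGE)
        qed
        then have *: "\<rho> (?i + v k) = num OMG" using v by simp
        obtain d s' where "ltr OMG (w (?i + v k)) d s'" using lstep[OF *] d0(3) omg by auto
        then have False using last t1 by (auto elim: ltr_OMGE)
        then show ?thesis ..
      next
        case mid
        have "\<rho> (?i + j) = num (Mid t' d0 d s') \<and> int (c (?i + j)) = int (c ?i) + d0 * int j"
          if "1 \<le> j" "j \<le> v k" for j
          using that
        proof (induction j rule: dec_induct)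
          case base
          then show ?case using d0(2,4) mid by simp
        next
          case (step j)
          then have *: "\<rho> (?i + j) = num (Mid t' d0 d s')" and c: "int (c (?i + j)) = int (c ?i) + d0 * int j" by auto
          obtain d2 s2 where "ltr (Mid t' d0 d s') 1 d2 s2" "\<rho> (Suc (?i + j)) = num s2"
            "int (c (Suc (?i + j))) = int (c (?i + j)) + d2"
            using lstep[OF *] d0(3) mid ones[of j] step by auto
          moreover from this(1) have "t' \<noteq> 1 \<longrightarrow> s2 = Mid t' d0 d s' \<and> d2 = d0" by (auto elim: ltr_MidE)
          moreover have "t' \<noteq> 1" using btr_range[OF mid(2)] by auto
          ultimately show ?case using c by (simp add: algebra_simps)
        qed
        note mids = this
        then have *: "\<rho> (?i + v k) = num (Mid t' d0 d s')" and c: "int (c (?i + v k)) = int (c ?i) + d0 * int (v k)"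
          using v by auto
        obtain d2 s2 where d2: "ltr (Mid t' d0 d s') (t k) d2 s2" "\<rho> (Suc (?i + v k)) = num s2" "num s2 < X"
          "int (c (Suc (?i + v k))) = int (c (?i + v k)) + d2"
          using lstep[OF *] d0(3) mid last by auto
        then have "t' = t k" "d2 = d" and s2: "s2 = At s'" using t1 by (auto elim: ltr_MidE)
        moreover have "0 \<le> int (c ?i) + d0 * int (v k)" using c by linarith
        ultimately have "((k, s, c ?i), (Suc k, s', c (start v (Suc k)))) \<in> block_steps v t"
          using d2(4) mid(2) v c by (intro block_stepI[of _ _ _ _ d0 d]) (auto simp: start_Suc)
        moreover have "\<rho> (?i + j) \<notin> set (acc A)" if "0 < j" "j \<le> v k" for j
          using mids[of j] that by (simp add: num_def)
        ultimately show ?thesis using d2(2,3) unfolding s2 by (auto simp: start_Suc)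
      qed
    qed
  qed
qed

end

section \<open>If the machine halts, every word is accepted\<close>

locale rejected = machine +
  fixes w v t :: "nat \<Rightarrow> nat"
  assumes w: "w \<in> omega_words 4" and b: "blocks w v t" and t: "t k \<in> {0, 2, 3}"
    and rej: "w \<notin> lang A"
begin

abbreviation "B \<equiv> block_steps v t"

lemma no_accepting_path:
  "((0, INIT, 0), f 0) \<in> B\<^sup>+ \<Longrightarrow> (\<And>k. (f k, f (Suc k)) \<in> B\<^sup>+) \<Longrightarrow>
   (\<And>k. fst (snd (f k)) \<in> {TOP, NH, MARK, SA}) \<Longrightarrow> False"
  using in_lang_if_infinite_block_path[OF w b] rej by blast

lemma stepI0: "btr s (t k) (0 < v k) 0 0 s' \<Longrightarrow> ((k, s, c), (Suc k, s', c)) \<in> B"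
  by (rule block_stepI) auto

lemma loop_path:
  assumes "\<And>k. m \<le> k \<Longrightarrow> k < n \<Longrightarrow> btr s (t k) (0 < v k) 0 0 s" "m \<le> n"
  shows "((m, s, c), (n, s, c)) \<in> B\<^sup>*"
  using assms(2,1)
proof (induction n rule: dec_induct)
  case (step n)
  then have "((n, s, c), (Suc n, s, c)) \<in> B" by (intro stepI0) auto
  with step show ?case by (meson less_Suc_eq rtrancl_snoc)
qed simp

lemma init_path: "((0, INIT, 0), (k, INIT, 0)) \<in> B\<^sup>*"
  by (rule loop_path) (auto intro!: b_init[OF t])

text \<open>All tests with immediate verdict are exploited through this: on a rejected word they
  must fail, which forces the blocks to be correct.\<close>

lemma not_top: "((0, INIT, 0), (k, TOP, c)) \<notin> B\<^sup>*"
proof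
  assume *: "((0, INIT, 0), (k, TOP, c)) \<in> B\<^sup>*"
  have step: "((n, TOP, c), (Suc n, TOP, c)) \<in> B" for n
    by (rule stepI0) (auto intro!: b_top[OF t])
  show False
    by (rule no_accepting_path[of "\<lambda>i. (Suc k + i, TOP, c)"])
      (use * step in \<open>auto intro: rtrancl_into_trancl1\<close>)
qed

lemma infinite_hashes: "\<exists>k>n. t k \<noteq> 0"
proof (rule ccontr)
  assume *: "\<not> ?thesis"
  have step: "((k, NH, 0), (Suc k, NH, 0)) \<in> B" if "k > n" for k
    by (rule stepI0) (use * that in \<open>auto simp: b_nh\<close>)
  have "((n, INIT, 0), (Suc n, NH, 0)) \<in> B"
    by (rule stepI0) (auto intro!: b_init[OF t])
  with init_path[of n] have 1: "((0, INIT, 0), (Suc n, NH, 0)) \<in> B\<^sup>+" by (rule rtrancl_into_trancl1)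
  show False
    by (rule no_accepting_path[of "\<lambda>i. (Suc n + i, NH, 0)"]) (use 1 step in auto)
qed

text \<open>Otherwise a run guesses \<open>c0\<close> in \<open>CG\<close>, waits in
  \<open>TI\<close> for these rounds, and passes through \<open>MARK\<close> in infinitely many of
  them without dropping below \<open>c0\<close>.\<close>

lemma no_profitable_rounds:
  assumes "\<And>n. \<exists>k0>n. t k0 \<noteq> 0 \<and> (\<forall>c\<ge>c0. \<exists>k' c'. c' \<ge> c0 \<and> ((k0, TI, c), (k', MARK, c')) \<in> B\<^sup>+)"
  shows False
proof -
  have ti: "((m, TI, c), (n, TI, c)) \<in> B\<^sup>*" if "m \<le> n" for m n c
    by (rule loop_path[OF _ that]) (auto intro!: b_skip[OF t])
  have next_mark: "\<exists>k' c'. c' \<ge> c0 \<and> ((k, TI, c), (k', MARK, c')) \<in> B\<^sup>+" if c: "c \<ge> c0" for k c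
  proof -
    obtain k0 k' c' where "k0 > k" "c' \<ge> c0" "((k0, TI, c), (k', MARK, c')) \<in> B\<^sup>+"
      using assms[of k] c by blast
    then show ?thesis using ti[of k k0 c] by (meson less_imp_le rtrancl_trancl_trancl)
  qed
  have next_mark': "\<exists>y. (fst (snd y) = MARK \<and> snd (snd y) \<ge> c0) \<and> (x, y) \<in> B\<^sup>+"
    if x: "fst (snd x) = MARK \<and> snd (snd x) \<ge> c0" for x
  proof -
    obtain k c where x': "x = (k, MARK, c)" "c \<ge> c0" using x by (cases x) auto
    have "(x, (Suc k, TI, c)) \<in> B"
      unfolding x' by (rule stepI0) (auto intro!: b_skip[OF t])
    moreover obtain k' c' where "c' \<ge> c0" "((Suc k, TI, c), (k', MARK, c')) \<in> B\<^sup>+"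
      using next_mark[OF x'(2)] by blast
    ultimately show ?thesis by (intro exI[of _ "(k', MARK, c')"]) (auto intro: trancl_into_trancl2)
  qed
  have cg: "((0, INIT, 0), (Suc n, CG, n)) \<in> B\<^sup>+" for n
  proof (induction n)
    case 0
    show ?case by (rule r_into_trancl, rule stepI0) (auto intro!: b_init[OF t])
  next
    case (Suc n)
    have "((Suc n, CG, n), (Suc (Suc n), CG, Suc n)) \<in> B"
      by (rule block_stepI[of _ _ _ _ 0 1]) (auto intro!: b_guess[OF t])
    with Suc show ?case by (rule trancl_into_trancl)
  qed
  have "((Suc c0, CG, c0), (Suc (Suc c0), TI, c0)) \<in> B"
    by (rule stepI0) (auto intro!: b_guessed[OF t])
  with cg[of c0] have 1: "((0, INIT, 0), (Suc (Suc c0), TI, c0)) \<in> B\<^sup>+" by (rule trancl_into_trancl)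
  obtain k1 c1 where 2: "c1 \<ge> c0" "((Suc (Suc c0), TI, c0), (k1, MARK, c1)) \<in> B\<^sup>+"
    using next_mark[of c0] by blast
  let ?P = "\<lambda>y. fst (snd y) = MARK \<and> snd (snd y) \<ge> c0"
  obtain g where g: "g 0 = (k1, MARK, c1)" "\<And>i. ?P (g i)" "\<And>i. (g i, g (Suc i)) \<in> B\<^sup>+"
  proof -
    define nxt where "nxt x = (SOME y. ?P y \<and> (x, y) \<in> B\<^sup>+)" for x
    have nxt: "?P (nxt x) \<and> (x, nxt x) \<in> B\<^sup>+" if "?P x" for x
      unfolding nxt_def by (rule someI_ex) (rule next_mark'[OF that])
    define g where "g i = (nxt ^^ i) (k1, MARK, c1)" for i
    have P: "?P (g i)" for i by (induction i) (use nxt 2 in \<open>auto simp: g_def\<close>)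
    show ?thesis
      by (rule that[of g]) (use nxt P in \<open>auto simp: g_def\<close>)
  qed
  show False
    by (rule no_accepting_path[of g]) (use g 1 2 in \<open>auto intro: trancl_trans\<close>)
qed

text \<open>The control in the round opened at block \<open>k0\<close>, where branches follow the
  blocks actually present rather than true register contents.\<close>

fun tr :: "nat \<Rightarrow> nat \<Rightarrow> ctl" where
  "tr k0 0 = Start"
| "tr k0 (Suc i) = succ (tr k0 i) (0 < v (Suc k0 + i))"

abbreviation val :: "nat \<Rightarrow> nat \<Rightarrow> nat" where
  "val k0 i \<equiv> v (Suc k0 + i)"

abbreviation at :: "nat \<Rightarrow> nat \<Rightarrow> job \<Rightarrow> nat \<Rightarrow> nat \<times> bst \<times> nat" where
  "at k0 i j c \<equiv> (Suc k0 + i, Job (tr k0 i) j, c)"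

text \<open>The value that a register ought to show: the one last shown, after the change made
  there. For the fuel the initial 0 is a mere default; the word is free to choose the first fuel
  block, and later comparisons presuppose an earlier touch.\<close>

fun cv :: "nat \<Rightarrow> nat \<Rightarrow> nat option \<Rightarrow> int" where
  "cv k0 0 r = (if r = Some 0 then int X else 0)"
| "cv k0 (Suc i) r = (if touched (tr k0 i) = r
     then int (val k0 i) + change (tr k0 i) (0 < val k0 i) else cv k0 i r)"

definition before_end :: "nat \<Rightarrow> nat \<Rightarrow> bool" where
  "before_end k0 i \<longleftrightarrow> (\<forall>j<i. tr k0 j \<noteq> End)"

lemma before_end_Suc: "before_end k0 (Suc i) \<longleftrightarrow> before_end k0 i \<and> tr k0 i \<noteq> End"
  unfolding before_end_def by (auto simp: less_Suc_eq)

lemma tr_C: "tr k0 i \<in> C"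
  by (induction i) (auto simp: Start_C succ_C)

lemma cv_nonneg: "0 \<le> cv k0 i r"
  by (induction i) (auto simp: change_nonneg)

text \<open>A premature letter 2 or 3, or a halted program, would let the idle run enter
  \<open>TOP\<close>; so a rejected word follows the control up to \<open>End\<close>.\<close>

lemma walk_Idle:
  assumes k0: "t k0 \<noteq> 0" and i: "before_end k0 i"
  shows "((0, INIT, 0), at k0 i Idle 0) \<in> B\<^sup>* \<and>
    (\<forall>j<i. live (tr k0 j) \<and> t (Suc k0 + j) = 0)"
  using i
proof (induction i)
  case 0
  have "((k0, INIT, 0), (Suc k0, Job Start Idle, 0)) \<in> B"
    by (rule stepI0) (use t[of k0] k0 in \<open>auto intro!: b_round\<close>)
  with init_path[of k0] show ?case by (auto intro: rtrancl_snoc)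
next
  case (Suc i)
  then have IH: "((0, INIT, 0), at k0 i Idle 0) \<in> B\<^sup>*"
    "\<forall>j<i. live (tr k0 j) \<and> t (Suc k0 + j) = 0" and ne: "tr k0 i \<noteq> End"
    by (auto simp: before_end_Suc)
  let ?k = "Suc k0 + i"
  have no_top: "((?k, Job (tr k0 i) Idle, 0), (Suc ?k, TOP, 0)) \<notin> B"
    using IH(1) not_top[of "Suc ?k" 0] by (meson rtrancl_snoc)
  have live: "live (tr k0 i)"
  proof (rule ccontr)
    assume "\<not> live (tr k0 i)"
    then have "tr k0 i = Fuel []" using ne tr_C by (simp add: live_def)
    then show False using no_top stepI0[OF b_halt] t tr_C by metis
  qed
  have t0: "t ?k = 0"
  proof (rule ccontr)
    assume "t ?k \<noteq> 0"
    then have "t ?k \<in> {2, 3}" using t[of ?k] by auto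
    then show False using no_top stepI0[OF b_early[OF tr_C ne]] by metis
  qed
  have "((?k, Job (tr k0 i) Idle, 0), (Suc ?k, Job (tr k0 (Suc i)) Idle, 0)) \<in> B"
    by (rule stepI0) (use live t0 in \<open>auto intro!: b_walk\<close>)
  with IH live t0 show ?case by (auto simp: less_Suc_eq intro: rtrancl_snoc)
qed

lemma walk:
  assumes k0: "t k0 \<noteq> 0" "before_end k0 n" and mn: "m \<le> n"
    and p: "\<And>i. m \<le> i \<Longrightarrow> i < n \<Longrightarrow> passes j (tr k0 i)"
    and j: "j \<in> {Idle, Guess, Short} \<union> range Zero \<union> range Down \<union> {Up r e |r e. True}"
      "\<forall>r. j = Zero r \<or> j = Down r \<or> (\<exists>e. j = Up r e) \<longrightarrow> r \<in> touched ` C"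
  shows "(at k0 m j c, at k0 n j c) \<in> B\<^sup>*"
  using mn k0(2) p
proof (induction n rule: dec_induct)
  case (step n)
  have "live (tr k0 n)" "t (Suc k0 + n) = 0" using walk_Idle[OF k0(1) step(4)] by auto
  then have "(at k0 n j c, (Suc (Suc k0 + n), Job (tr k0 (Suc n)) j, c)) \<in> B"
    by (intro stepI0) (use step.prems(2)[of n] step.hyps j in \<open>auto intro!: b_walk\<close>)
  moreover have "(at k0 m j c, at k0 n j c) \<in> B\<^sup>*"
    by (rule step.IH) (use step.prems in \<open>auto simp: before_end_Suc\<close>)
  ultimately show ?case by (auto intro: rtrancl_snoc)
qed simp

lemma touched_C: "touched (tr k0 i) \<in> touched ` C"
  using tr_C by blast

lemma cv_untouched:
  assumes "m \<le> n" "\<And>i. m \<le> i \<Longrightarrow> i < n \<Longrightarrow> touched (tr k0 i) \<noteq> r"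
  shows "cv k0 n r = cv k0 m r"
  using assms by (induction n rule: dec_induct) auto

lemma last_touch:
  assumes "\<exists>j<i. touched (tr k0 j) = r"
  obtains j where "j < i" "touched (tr k0 j) = r" "\<And>l. Suc j \<le> l \<Longrightarrow> l < i \<Longrightarrow> touched (tr k0 l) \<noteq> r"
    "cv k0 i r = int (val k0 j) + change (tr k0 j) (0 < val k0 j)"
proof -
  let ?S = "{j. j < i \<and> touched (tr k0 j) = r}"
  have S: "finite ?S" "?S \<noteq> {}" using assms by auto
  define j where "j = Max ?S"
  have j: "j < i" "touched (tr k0 j) = r" using Max_in[OF S] by (auto simp: j_def)
  moreover have ge: "touched (tr k0 l) \<noteq> r" if "Suc j \<le> l" "l < i" for l
  proof
    assume "touched (tr k0 l) = r"
    then have "l \<le> j" unfolding j_def using that(2) S(1) by (intro Max_ge) auto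
    then show False using that by simp
  qed
  moreover have "cv k0 i r = cv k0 (Suc j) r" by (rule cv_untouched) (use j ge in auto)
  ultimately show ?thesis using that[of j] by simp
qed

lemma val_Start:
  assumes k0: "t k0 \<noteq> 0"
  shows "val k0 0 = X"
proof (rule ccontr)
  assume ne: "val k0 0 \<noteq> X"
  have "before_end k0 1" by (simp add: before_end_def)
  from walk_Idle[OF k0 this] have t0: "t (Suc k0) = 0" by simp
  have "((k0, INIT, 0), (Suc k0, CHK, 0)) \<in> B"
    by (rule stepI0) (use t[of k0] k0 in \<open>auto intro!: b_chk\<close>)
  moreover have "((Suc k0, CHK, 0), (Suc (Suc k0), TOP, 0)) \<in> B"
    using ne t0 unfolding block_steps_def by auto
  ultimately have "((0, INIT, 0), (Suc (Suc k0), TOP, 0)) \<in> B\<^sup>*"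
    using init_path[of k0] by (meson rtrancl_snoc)
  with not_top show False by blast
qed

lemma first_touch:
  assumes k0: "t k0 \<noteq> 0" "before_end k0 (Suc i)" and r: "touched (tr k0 i) = Some r" "r \<noteq> 0"
    and un: "\<And>j. j < i \<Longrightarrow> touched (tr k0 j) \<noteq> Some r"
  shows "val k0 i = 0"
proof (rule ccontr)
  assume nz: "val k0 i \<noteq> 0"
  have C: "Some r \<in> touched ` C" using touched_C[of k0 i] r by simp
  have "((k0, INIT, 0), (Suc k0, Job Start (Zero (Some r)), 0)) \<in> B"
    by (rule stepI0) (use t[of k0] k0 C r in \<open>auto intro!: b_round\<close>)
  moreover have "(at k0 0 (Zero (Some r)) 0, at k0 i (Zero (Some r)) 0) \<in> B\<^sup>*"
    by (rule walk[OF k0(1)]) (use k0 un C in \<open>auto simp: before_end_Suc\<close>)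
  moreover have "live (tr k0 i)" "t (Suc k0 + i) = 0" using walk_Idle[OF k0] by auto
  then have "(at k0 i (Zero (Some r)) 0, (Suc (Suc k0 + i), TOP, 0)) \<in> B"
    using nz b_zero[of "tr k0 i"] r by (intro stepI0) simp
  ultimately have "((0, INIT, 0), (Suc (Suc k0 + i), TOP, 0)) \<in> B\<^sup>*"
    using init_path[of k0] by (auto intro: rtrancl_snoc rtrancl_trans)
  with not_top show False by blast
qed

text \<open>\<open>Down\<close> collects the expected value and then subtracts the shown one plus
  one. This succeeds exactly for a value that is too small, and leads to \<open>TOP\<close>.\<close>

lemma no_loss:
  assumes k0: "t k0 \<noteq> 0" "before_end k0 (Suc i)" and ex: "\<exists>j<i. touched (tr k0 j) = touched (tr k0 i)"
  shows "cv k0 i (touched (tr k0 i)) \<le> int (val k0 i)"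
proof (rule ccontr)
  let ?r = "touched (tr k0 i)"
  assume less: "\<not> ?thesis"
  obtain j where j: "j < i" "touched (tr k0 j) = ?r" "\<And>l. Suc j \<le> l \<Longrightarrow> l < i \<Longrightarrow> touched (tr k0 l) \<noteq> ?r"
    "cv k0 i ?r = int (val k0 j) + change (tr k0 j) (0 < val k0 j)"
    using last_touch[OF ex] by blast
  have bj: "before_end k0 j" using k0(2) j(1) by (auto simp: before_end_def)
  let ?c = "nat (cv k0 i ?r)"
  have l: "live (tr k0 l)" "t (Suc k0 + l) = 0" if "l \<le> i" for l using walk_Idle[OF k0] that by auto
  have "((0, INIT, 0), at k0 j Idle 0) \<in> B\<^sup>*" using walk_Idle[OF k0(1) bj] by simp
  moreover have "(at k0 j Idle 0, at k0 (Suc j) (Down ?r) ?c) \<in> B"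
    unfolding add_Suc_right
    by (rule block_stepI[of _ _ _ _ 1 "change (tr k0 j) (0 < val k0 j)"])
      (use b_down1[of "tr k0 j" "0 < val k0 j"] l[of j] j(1,2,4) cv_nonneg[of k0 i ?r] in auto)
  moreover have "(at k0 (Suc j) (Down ?r) ?c, at k0 i (Down ?r) ?c) \<in> B\<^sup>*"
    by (rule walk[OF k0(1)]) (use k0 j touched_C in \<open>auto simp: before_end_Suc\<close>)
  moreover have "(at k0 i (Down ?r) ?c, (Suc (Suc k0 + i), TOP, ?c - val k0 i - 1)) \<in> B"
    by (rule block_stepI[of _ _ _ _ "-1" "-1"])
      (use b_down2[of "tr k0 i" "0 < val k0 i"] l[of i] less in auto)
  ultimately have "((0, INIT, 0), (Suc (Suc k0 + i), TOP, ?c - val k0 i - 1)) \<in> B\<^sup>*"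
    by (meson rtrancl_snoc rtrancl_trans)
  with not_top show False by blast
qed

definition gain :: "nat \<Rightarrow> int \<Rightarrow> bool" where
  "gain k0 N \<longleftrightarrow> (\<exists>i. before_end k0 (Suc i) \<and> (\<exists>j<i. touched (tr k0 j) = touched (tr k0 i))
     \<and> cv k0 i (touched (tr k0 i)) \<le> N \<and> cv k0 i (touched (tr k0 i)) < int (val k0 i))"

text \<open>The expected value is paid and a larger one, less one, comes back, so nothing is lost.
  The bound is \<open>Suc N\<close> because the block subtracted during the payment exceeds the
  expected value by one if the register was decremented there.\<close>

lemma gain_profitable:
  assumes k0: "t k0 \<noteq> 0" and g: "gain k0 (int N)" and c: "c \<ge> Suc N"
  shows "\<exists>k' c'. c' \<ge> c \<and> ((k0, TI, c), (k', MARK, c')) \<in> B\<^sup>+"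
proof -
  obtain i where i: "before_end k0 (Suc i)" "\<exists>j<i. touched (tr k0 j) = touched (tr k0 i)"
    "cv k0 i (touched (tr k0 i)) \<le> int N" "cv k0 i (touched (tr k0 i)) < int (val k0 i)"
    using g unfolding gain_def by blast
  let ?r = "touched (tr k0 i)"
  obtain j where j: "j < i" "touched (tr k0 j) = ?r" "\<And>l. Suc j \<le> l \<Longrightarrow> l < i \<Longrightarrow> touched (tr k0 l) \<noteq> ?r"
    "cv k0 i ?r = int (val k0 j) + change (tr k0 j) (0 < val k0 j)"
    using last_touch[OF i(2)] by blast
  have bj: "before_end k0 j" using i(1) j(1) by (auto simp: before_end_def)
  have l: "live (tr k0 l)" "t (Suc k0 + l) = 0" if "l \<le> i" for l using walk_Idle[OF k0 i(1)] that by auto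
  let ?d = "c - nat (cv k0 i ?r)"
  have d: "int ?d = int c - cv k0 i ?r" using i(3) c cv_nonneg[of k0 i ?r] by simp
  have "((k0, TI, c), at k0 0 Guess c) \<in> B"
    unfolding add_0_right by (rule stepI0) (use t[of k0] k0 in \<open>auto intro!: b_enter\<close>)
  moreover have "(at k0 0 Guess c, at k0 j Guess c) \<in> B\<^sup>*"
    by (rule walk[OF k0 bj]) auto
  moreover have "(at k0 j Guess c, at k0 (Suc j) (Up ?r True) ?d) \<in> B"
    unfolding add_Suc_right
    by (rule block_stepI[of _ _ _ _ "-1" "- change (tr k0 j) (0 < val k0 j)"])
      (use b_up1[of "tr k0 j" "0 < val k0 j"] l[of j] j(1,2,4) d i(3) c change_bounds[of "tr k0 j" "0 < val k0 j"] in auto)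
  moreover have "(at k0 (Suc j) (Up ?r True) ?d, at k0 i (Up ?r True) ?d) \<in> B\<^sup>*"
    by (rule walk[OF k0]) (use i(1) j touched_C in \<open>auto simp: before_end_Suc\<close>)
  moreover have "(at k0 i (Up ?r True) ?d, (Suc (Suc k0 + i), MARK, ?d + val k0 i - 1)) \<in> B"
    by (rule block_stepI[of _ _ _ _ 1 "-1"])
      (use b_up2[of "tr k0 i" True "0 < val k0 i"] l[of i] i(4) cv_nonneg[of k0 i ?r] in auto)
  ultimately have "((k0, TI, c), (Suc (Suc k0 + i), MARK, ?d + val k0 i - 1)) \<in> B\<^sup>+"
    by (meson rtrancl_into_trancl1 rtrancl_into_trancl2 rtrancl_trans trancl_rtrancl_trancl trancl_into_trancl)
  moreover have "c \<le> ?d + val k0 i - 1" using d i(4) cv_nonneg[of k0 i ?r] by linarith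
  ultimately show ?thesis by blast
qed

lemma eventually_no_gain: "\<exists>n. \<forall>k0>n. t k0 \<noteq> 0 \<longrightarrow> \<not> gain k0 (int N)"
proof (rule ccontr)
  assume "\<not> ?thesis"
  then have *: "\<exists>k0>n. t k0 \<noteq> 0 \<and> gain k0 (int N)" for n by blast
  show False
  proof (rule no_profitable_rounds[of "Suc N"])
    fix n
    obtain k0 where "k0 > n" "t k0 \<noteq> 0" "gain k0 (int N)" using * by blast
    then show "\<exists>k0>n. t k0 \<noteq> 0 \<and> (\<forall>c\<ge>Suc N. \<exists>k' c'. c' \<ge> Suc N \<and> ((k0, TI, c), (k', MARK, c')) \<in> B\<^sup>+)"
      using gain_profitable le_trans by meson
  qed
qed

text \<open>By \<open>no_loss\<close> the second fuel block is at least the first minus one. Paying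
  the first minus one and regaining the second is therefore free, provided that the counter can
  cover the first.\<close>

lemma short_profitable:
  assumes k0: "t k0 \<noteq> 0" and s: "val k0 1 \<le> N" and c: "c \<ge> Suc N"
  shows "\<exists>k' c'. c' \<ge> c \<and> ((k0, TI, c), (k', MARK, c')) \<in> B\<^sup>+"
proof -
  have be1: "before_end k0 1" "before_end k0 (Suc 1)" by (simp_all add: before_end_def less_Suc_eq)
  have l1: "live (tr k0 1)" "t (Suc k0 + 1) = 0" using walk_Idle[OF k0 be1(2)] by auto
  have tr1: "tr k0 1 = Fuel prog" by simp
  have "((k0, TI, c), at k0 0 Short c) \<in> B"
    unfolding add_0_right by (rule stepI0) (use t[of k0] k0 in \<open>auto intro!: b_enter\<close>)
  moreover have "(at k0 0 Short c, at k0 1 Short c) \<in> B\<^sup>*"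
    by (rule walk[OF k0 be1(1)]) auto
  ultimately have enter: "((k0, TI, c), at k0 1 Short c) \<in> B\<^sup>+"
    by (rule rtrancl_into_trancl2)
  show ?thesis
  proof (cases "val k0 1 = 0")
    case True
    have "(at k0 1 Short c, (Suc (Suc k0 + 1), MARK, c)) \<in> B"
      by (rule stepI0) (use b_short0[of "tr k0 1"] l1 tr1 True in auto)
    with enter have "((k0, TI, c), (Suc (Suc k0 + 1), MARK, c)) \<in> B\<^sup>+" by (rule trancl_into_trancl)
    then show ?thesis by blast
  next
    case False
    then have tr2: "tr k0 2 = Exec prog" by (simp add: numeral_2_eq_2)
    then have tr3: "tr k0 3 = Fuel (target prog (0 < val k0 2))" by (simp add: numeral_3_eq_3 numeral_2_eq_2)
    have be: "before_end k0 (Suc 3)"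
      using tr2 tr3 unfolding before_end_def by (auto simp: less_Suc_eq numeral_3_eq_3 numeral_2_eq_2)
    have l: "live (tr k0 l)" "t (Suc k0 + l) = 0" if "l \<le> 3" for l using walk_Idle[OF k0 be] that by auto
    let ?d = "c - val k0 1 + 1"
    have "(at k0 1 Short c, (Suc (Suc k0 + 1), Job (succ (tr k0 1) True) (Up None False), ?d)) \<in> B"
      by (rule block_stepI[of _ _ _ _ "-1" 1]) (use b_short1[of "tr k0 1"] l1 tr1 False s c in auto)
    moreover have "Suc (Suc k0 + 1) = Suc k0 + 2" "succ (tr k0 1) True = tr k0 2"
      using tr1 tr2 by simp_all
    ultimately have "(at k0 1 Short c, at k0 2 (Up None False) ?d) \<in> B"
      by simp
    moreover have "(at k0 2 (Up None False) ?d, at k0 3 (Up None False) ?d) \<in> B\<^sup>*"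
    proof (rule walk[OF k0])
      show "before_end k0 3" using be by (simp add: before_end_def)
      fix i :: nat assume "2 \<le> i" "i < 3"
      then have "i = 2" by simp
      then show "passes (Up None False) (tr k0 i)" using tr2 by simp
    qed (use touched_C[of k0 1] tr1 in auto)
    moreover have "(at k0 3 (Up None False) ?d, (Suc (Suc k0 + 3), MARK, ?d + val k0 3)) \<in> B"
      by (rule block_stepI[of _ _ _ _ 1 0])
        (use b_up2[of "tr k0 3" False "0 < val k0 3"] l[of 3] tr3 in auto)
    ultimately have "((k0, TI, c), (Suc (Suc k0 + 3), MARK, ?d + val k0 3)) \<in> B\<^sup>+"
      using enter by (meson trancl_rtrancl_trancl trancl_into_trancl)
    moreover have "c \<le> ?d + val k0 3"
    proof -
      have "cv k0 3 None = int (val k0 1) - 1"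
        using False tr1 tr2 by (simp add: numeral_3_eq_3 numeral_2_eq_2)
      moreover have "\<exists>j<3. touched (tr k0 j) = touched (tr k0 3)"
        by (rule exI[of _ 1]) (use tr1 tr3 in simp)
      ultimately show ?thesis using no_loss[OF k0 be] tr3 s c by auto
    qed
    ultimately show ?thesis by blast
  qed
qed

lemma eventually_long: "\<exists>n. \<forall>k0>n. t k0 \<noteq> 0 \<longrightarrow> N < val k0 1"
proof (rule ccontr)
  assume "\<not> ?thesis"
  then have *: "\<exists>k0>n. t k0 \<noteq> 0 \<and> val k0 1 \<le> N" for n by (meson not_less)
  show False
  proof (rule no_profitable_rounds[of "Suc N"])
    fix n
    obtain k0 where "k0 > n" "t k0 \<noteq> 0" "val k0 1 \<le> N" using * by blast
    then show "\<exists>k0>n. t k0 \<noteq> 0 \<and> (\<forall>c\<ge>Suc N. \<exists>k' c'. c' \<ge> Suc N \<and> ((k0, TI, c), (k', MARK, c')) \<in> B\<^sup>+)"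
      using short_profitable le_trans by meson
  qed
qed

text \<open>In the \<open>T\<close> steps up to halting all registers stay at most
  \<open>X + T\<close>. A late round shows such values exactly and has more than \<open>T\<close>
  units of fuel, so it simulates the whole computation and arrives at \<open>Fuel []\<close>,
  contrary to \<open>walk_Idle\<close>.\<close>

lemma not_halts: "\<not> halts prog (input X)"
proof
  let ?s0 = "input X"
  assume "halts prog ?s0"
  then obtain T where T: "fst ((mstep ^^ T) (prog, ?s0)) = []" unfolding halts_def by blast
  define K where "K m = fst ((mstep ^^ m) (prog, ?s0))" for m
  define S where "S m = snd ((mstep ^^ m) (prog, ?s0))" for m
  have KS: "K (Suc m) = target (K m) (0 < S m (reg (K m)))"
    "S (Suc m) = (S m)(reg (K m) := nat (int (S m (reg (K m))) + delta (K m) (0 < S m (reg (K m)))))" for m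
    by (simp_all add: K_def S_def mstep_def Let_def split_beta)
  have bound: "S m r \<le> X + m" for m r
  proof (induction m arbitrary: r)
    case (Suc m)
    have "delta (K m) b \<le> 1" for b by (cases "(K m, b)" rule: delta.cases) auto
    then have "int (S m (reg (K m))) + delta (K m) (0 < S m (reg (K m))) \<le> int (X + Suc m)"
      using Suc[of "reg (K m)"] by (smt (verit) of_nat_Suc of_nat_add of_nat_le_iff)
    then show ?case using Suc[of r] by (auto simp: KS)
  qed (simp add: S_def)
  obtain n1 n2 where n1: "\<And>k0. k0 > n1 \<Longrightarrow> t k0 \<noteq> 0 \<Longrightarrow> \<not> gain k0 (int (X + T))"
    and n2: "\<And>k0. k0 > n2 \<Longrightarrow> t k0 \<noteq> 0 \<Longrightarrow> T < val k0 1"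
    using eventually_no_gain eventually_long by meson
  obtain k0 where "k0 > max n1 n2" and k0: "t k0 \<noteq> 0" using infinite_hashes by blast
  then have ng: "\<not> gain k0 (int (X + T))" and long: "T < val k0 1" using n1 n2 by auto
  \<comment> \<open>Losses are excluded always, gains below the bound in late rounds; a register not
    yet touched is settled by the input check or by the test for empty registers.\<close>
  have exact: "int (val k0 i) = cv k0 i (Some r)"
    if "before_end k0 (Suc i)" "touched (tr k0 i) = Some r" "cv k0 i (Some r) \<le> int (X + T)" for i r
  proof (cases "\<exists>j<i. touched (tr k0 j) = Some r")
    case True
    then have "\<not> cv k0 i (Some r) < int (val k0 i)" using ng that unfolding gain_def by metis
    moreover have "cv k0 i (Some r) \<le> int (val k0 i)" using no_loss[OF k0 that(1)] True that(2) by simp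
    ultimately show ?thesis by simp
  next
    case False
    then have cv: "cv k0 i (Some r) = cv k0 0 (Some r)" by (intro cv_untouched) auto
    show ?thesis
    proof (cases "r = 0")
      case True
      have "i = 0"
      proof (rule ccontr)
        assume "i \<noteq> 0"
        then show False using False True by auto
      qed
      then show ?thesis using cv True val_Start[OF k0] by simp
    next
      case r: False
      then have "val k0 i = 0" using first_touch[OF k0 that(1,2)] False by blast
      then show ?thesis using cv r by simp
    qed
  qed
  \<comment> \<open>One machine step takes a fuel block and an instruction block, after the block of
    \<open>Start\<close>. For the fuel there is only a lower bound, since increases of large values
    may go unnoticed.\<close>
  have sim: "before_end k0 (1 + 2 * m) \<and> tr k0 (1 + 2 * m) = Fuel (K m) \<and> (\<forall>r. cv k0 (1 + 2 * m) (Some r) = int (S m r))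
    \<and> (m > 0 \<longrightarrow> int (val k0 1) - int m \<le> cv k0 (1 + 2 * m) None)" if "m \<le> T" for m
    using that
  proof (induction m)
    case 0
    show ?case using val_Start[OF k0] by (simp add: before_end_def K_def S_def)
  next
    case (Suc m)
    define i where "i = 1 + 2 * m"
    from Suc have IH: "before_end k0 i" "tr k0 i = Fuel (K m)" "\<And>r. cv k0 i (Some r) = int (S m r)"
      "m > 0 \<Longrightarrow> int (val k0 1) - int m \<le> cv k0 i None"  by (auto simp: i_def)
    have b1: "before_end k0 (Suc i)" unfolding before_end_Suc using IH by simp
    have fuel: "int (val k0 1) - int m \<le> int (val k0 i)"
    proof (cases "m = 0")
      case False
      have "\<exists>j<i. touched (tr k0 j) = touched (tr k0 i)"
        unfolding IH(2) by (rule exI[of _ 1]) (use False in \<open>simp add: i_def\<close>)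
      from no_loss[OF k0 b1 this] IH(4) False show ?thesis unfolding IH(2) by simp
    qed (simp add: i_def)
    then have pos: "0 < val k0 i" using long Suc.prems by linarith
    then have tr1: "tr k0 (Suc i) = Exec (K m)" by (simp only: tr.simps IH(2) succ.simps if_True)
    have b2: "before_end k0 (Suc (Suc i))" using b1 tr1 unfolding before_end_Suc[of _ "Suc i"] by simp
    have cv1: "cv k0 (Suc i) (Some r) = int (S m r)" for r
      using IH(3)[of r] by (simp only: cv.simps IH(2) touched.simps) simp
    have cvN: "cv k0 (Suc i) None = int (val k0 i) - 1"
      using pos by (simp only: cv.simps IH(2) touched.simps change.simps) simp
    let ?r = "reg (K m)"
    have v2: "val k0 (Suc i) = S m ?r"
      using exact[OF b2, of ?r] tr1 cv1[of ?r] bound[of m ?r] Suc.prems by simp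
    have tr2: "tr k0 (Suc (Suc i)) = Fuel (K (Suc m))"
      using v2 unfolding tr.simps(2)[of k0 "Suc i"] tr1 KS by simp
    have cv2: "cv k0 (Suc (Suc i)) (Some r) = int (S (Suc m) r)" for r
      using cv1[of r] v2 change_nonneg[of "S m ?r" "Exec (K m)"]
      unfolding cv.simps(2)[of k0 "Suc i"] tr1 KS by (auto simp del: cv.simps tr.simps)
    have cvN2: "cv k0 (Suc (Suc i)) None = int (val k0 i) - 1"
      using cvN unfolding cv.simps(2)[of k0 "Suc i"] tr1 by (simp del: cv.simps tr.simps)
    have "1 + 2 * Suc m = Suc (Suc i)" by (simp add: i_def)
    then show ?case using b2 tr2 cv2 cvN2 fuel by (simp only:) simp
  qed
  from sim[of T] T have "before_end k0 (1 + 2 * T)" "tr k0 (1 + 2 * T) = Fuel []" by (auto simp: K_def)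
  then have "before_end k0 (Suc (1 + 2 * T))" "\<not> live (tr k0 (1 + 2 * T))"
    unfolding before_end_Suc live_def by simp_all
  with walk_Idle[OF k0] show False by blast
qed

end

lemma (in machine) universal_if_halts:
  assumes "halts prog (input X)"
  shows "lang A = omega_words 4"
proof
  show "lang A \<subseteq> omega_words 4" unfolding lang_def by auto
  show "omega_words 4 \<subseteq> lang A"
  proof (rule subsetI, rule ccontr)
    fix w assume w: "w \<in> omega_words 4" and rej: "w \<notin> lang A"
    then have "infinite {i. w i \<noteq> 1}" using in_lang_if_finitely_many_blocks by blast
    from ex_blocks[OF this] obtain v t where vt: "blocks w v t" "\<And>k. t k \<noteq> 1" by blast
    have "t k \<in> {0, 2, 3}" for k
    proof -
      have "t k < 4" using vt(1) w unfolding blocks_def omega_words_def by (metis mem_Collect_eq)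
      then show ?thesis using vt(2)[of k] by auto
    qed
    then interpret rejected prog Q w v t by unfold_locales (use w rej vt in auto)
    show False using not_halts assms by blast
  qed
qed

section \<open>Correct words of a diverging machine\<close>

text \<open>Course-of-values recursion: \<open>H n\<close> already has the final values below
  \<open>n\<close>, which are all that \<open>F\<close> consults at \<open>n\<close>.\<close>

lemma ex_fixpoint_of_history:
  fixes F :: "(nat \<Rightarrow> nat) \<Rightarrow> nat \<Rightarrow> nat"
  assumes F: "\<And>h h' j. (\<And>i. i < j \<Longrightarrow> h i = h' i) \<Longrightarrow> F h j = F h' j"
  shows "\<exists>h. \<forall>j. h j = F h j"
proof -
  define H where "H = rec_nat (\<lambda>_. 0) (\<lambda>n g. g(n := F g n))"
  have H: "H (Suc n) = (H n)(n := F (H n) n)" for n by (simp add: H_def)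
  define h where "h n = H (Suc n) n" for n
  have *: "H m i = h i" if "i < m" for m i
    using that by (induction m) (auto simp: H h_def less_Suc_eq)
  have "h j = F h j" for j
  proof -
    have "F (H j) j = F h j" by (rule F) (simp add: *)
    then show ?thesis by (simp add: h_def H)
  qed
  then show ?thesis by blast
qed

lemma no_infinite_descent:
  assumes wf: "wf W" and tr: "Relation.trans W"
    and le: "\<And>k. k0 \<le> k \<Longrightarrow> (M (Suc k), M k) \<in> W\<^sup>="
    and inf: "\<And>n. \<exists>k\<ge>n. (M (Suc k), M k) \<in> W"
  shows False
proof -
  have mono: "(M n, M m) \<in> W\<^sup>=" if "k0 \<le> m" "m \<le> n" for m n
    using that(2)
  proof (induction n rule: dec_induct)
    case (step n)
    then show ?case using le[of n] that(1) tr by (auto dest: transD)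
  qed simp
  have "\<exists>n>m. (M n, M m) \<in> W" if "k0 \<le> m" for m
  proof -
    obtain k where k: "k \<ge> m" "(M (Suc k), M k) \<in> W" using inf by blast
    then have "(M (Suc k), M m) \<in> W" using mono[OF that k(1)] tr by (auto dest: transD)
    then show ?thesis using k(1) by (intro exI[of _ "Suc k"]) simp
  qed
  then obtain nxt where nxt: "\<And>m. k0 \<le> m \<Longrightarrow> nxt m > m \<and> (M (nxt m), M m) \<in> W" by metis
  define g where "g i = (nxt ^^ i) k0" for i
  have g: "k0 \<le> g i" for i
  proof (induction i)
    case (Suc i)
    then show ?case using nxt[of "g i"] by (simp add: g_def)
  qed (simp add: g_def)
  have "(M (g (Suc i)), M (g i)) \<in> W" for i using nxt[OF g[of i]] by (simp add: g_def)
  then have "\<exists>f. \<forall>i. (f (Suc i), f i) \<in> W" by (intro exI[of _ "\<lambda>i. M (g i)"]) simp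
  with wf show False unfolding wf_iff_no_infinite_down_chain by simp
qed

section \<open>The successive rounds of a correct word\<close>

context machine
begin

text \<open>\<open>n\<close> will be the number of the round, so the initial fuel tends to
  infinity.\<close>

definition reset :: "nat \<Rightarrow> nat option \<Rightarrow> nat" where
  "reset n = (\<lambda>r. case r of None \<Rightarrow> n | Some i \<Rightarrow> if i = 0 then X else 0)"

text \<open>Block 0 closes an empty round 0; thus the closing blocks carry the round numbers 0, 1, 2
  and so on.\<close>

fun cfg :: "nat \<Rightarrow> ctl \<times> (nat option \<Rightarrow> nat) \<times> nat" where
  "cfg 0 = (End, \<lambda>_. 0, 0)"
| "cfg (Suc k) = (case cfg k of (q, s, r) \<Rightarrow>
     if q = End then (Start, reset (Suc r), Suc r)
     else (succ q (0 < s (touched q)),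
       s(touched q := nat (int (s (touched q)) + change q (0 < s (touched q)))), r))"

definition ctrl :: "nat \<Rightarrow> ctl" where "ctrl k = fst (cfg k)"
definition regs :: "nat \<Rightarrow> nat option \<Rightarrow> nat" where "regs k = fst (snd (cfg k))"
definition rnd :: "nat \<Rightarrow> nat" where "rnd k = snd (snd (cfg k))"

lemma cfg_0: "ctrl 0 = End" "rnd 0 = 0"
  by (simp_all add: ctrl_def rnd_def)

lemma cfg_End: "ctrl k = End \<Longrightarrow> ctrl (Suc k) = Start" "ctrl k = End \<Longrightarrow> regs (Suc k) = reset (Suc (rnd k))"
  "ctrl k = End \<Longrightarrow> rnd (Suc k) = Suc (rnd k)"
  by (cases "cfg k"; simp add: ctrl_def regs_def rnd_def)+

lemma cfg_step:
  assumes "ctrl k \<noteq> End"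
  shows "ctrl (Suc k) = succ (ctrl k) (0 < regs k (touched (ctrl k)))"
    "regs (Suc k) = (regs k)(touched (ctrl k) :=
       nat (int (regs k (touched (ctrl k))) + change (ctrl k) (0 < regs k (touched (ctrl k)))))"
    "rnd (Suc k) = rnd k"
  using assms by (cases "cfg k"; simp add: ctrl_def regs_def rnd_def)+

lemma rnd_Suc: "rnd (Suc k) = (if ctrl k = End then Suc (rnd k) else rnd k)"
  by (simp add: cfg_End cfg_step)

lemma rnd_le: "rnd k \<le> k"
  by (induction k) (auto simp: cfg_0 rnd_Suc)

lemma rnd_mono: "j \<le> k \<Longrightarrow> rnd j \<le> rnd k"
  by (rule lift_Suc_mono_le[of rnd]) (simp_all add: rnd_Suc)

lemma ctrl_C: "ctrl k \<in> C"
proof (induction k)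
  case (Suc k)
  then show ?case by (cases "ctrl k = End") (auto simp: cfg_End cfg_step Start_C succ_C)
qed (simp add: cfg_0 Start_C)

lemma ex_End: "\<exists>k\<ge>n. ctrl k = End"
proof -
  \<comment> \<open>The fuel drops only at \<open>Fuel\<close> controls with nonempty fuel, which
    lead to \<open>Exec\<close>; the factor 2 and the summands 1 and 2 make the steps back to
    \<open>Fuel\<close> decrease as well.\<close>
  define \<mu> where "\<mu> k = 2 * regs k None + (case ctrl k of Fuel _ \<Rightarrow> 1 | _ \<Rightarrow> 2)" for k
  show ?thesis
  proof (induction "\<mu> n" arbitrary: n rule: less_induct)
    case less
    show ?case
    proof (cases "ctrl n = End \<or> ctrl (Suc n) = End")
      case True
      then show ?thesis by (metis Suc_n_not_le_n le_refl nat_le_linear)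
    next
      case False
      then have "ctrl n \<noteq> End" by simp
      note st = cfg_step[OF this]
      have "\<mu> (Suc n) < \<mu> n"
      proof (cases "ctrl n")
        case (Fuel K)
        then show ?thesis using False st by (auto simp: \<mu>_def split: if_splits)
      qed (use False st in \<open>auto simp: \<mu>_def\<close>)
      from less[OF this] show ?thesis by (meson Suc_leD)
    qed
  qed
qed

end

section \<open>Invariants of runs on correct words\<close>

locale diverging = machine +
  assumes diverges: "\<not> halts prog (input X)"
begin

lemma regs_simulate:
  "case ctrl k of
     Start \<Rightarrow> (\<lambda>i. regs k (Some i)) = input X
   | Fuel K \<Rightarrow> (\<exists>m. (K, \<lambda>i. regs k (Some i)) = (mstep ^^ m) (prog, input X))
   | Exec K \<Rightarrow> (\<exists>m. (K, \<lambda>i. regs k (Some i)) = (mstep ^^ m) (prog, input X))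
   | End \<Rightarrow> True"
proof (induction k)
  case (Suc k)
  show ?case
  proof (cases "ctrl k = End")
    case True
    then show ?thesis by (simp add: cfg_End reset_def)
  next
    case False
    note st = cfg_step[OF False]
    show ?thesis
    proof (cases "ctrl k")
      case Start
      then have "(prog, \<lambda>i. regs (Suc k) (Some i)) = (mstep ^^ 0) (prog, input X)"
        using Suc st by (simp add: fun_eq_iff)
      moreover have "ctrl (Suc k) = Fuel prog" using Start st by simp
      ultimately show ?thesis by (simp only: ctl.case) blast
    next
      case (Fuel K)
      then have "(\<lambda>i. regs (Suc k) (Some i)) = (\<lambda>i. regs k (Some i))" using st by (simp add: fun_eq_iff)
      then show ?thesis using Fuel Suc st(1) by simp
    next
      case (Exec K)
      then obtain m where m: "(K, \<lambda>i. regs k (Some i)) = (mstep ^^ m) (prog, input X)"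
        using Suc by auto
      have "(target K (0 < regs k (Some (reg K))), \<lambda>i. regs (Suc k) (Some i)) = mstep (K, \<lambda>i. regs k (Some i))"
        using st Exec by (auto simp: mstep_def Let_def fun_eq_iff)
      also have "\<dots> = (mstep ^^ Suc m) (prog, input X)" by (simp add: m)
      finally show ?thesis using st(1) Exec by (simp del: funpow.simps) blast
    qed (use False in simp)
  qed
qed (simp add: cfg_0)

lemma live_ctrl: "ctrl k \<noteq> End \<Longrightarrow> live (ctrl k)"
proof -
  have "ctrl k \<noteq> Fuel []"
  proof
    assume "ctrl k = Fuel []"
    then obtain m where "([], \<lambda>i. regs k (Some i)) = (mstep ^^ m) (prog, input X)"
      using regs_simulate[of k] by auto
    then have "fst ((mstep ^^ m) (prog, input X)) = []" by (metis fst_conv)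
    then show False using diverges unfolding halts_def by blast
  qed
  then show "ctrl k \<noteq> End \<Longrightarrow> live (ctrl k)" using ctrl_C by (simp add: live_def)
qed

definition hv :: "(nat \<Rightarrow> nat) \<Rightarrow> nat \<Rightarrow> nat" where
  "hv h k = (if ctrl k = End then h (rnd k) else regs k (touched (ctrl k)))"

text \<open>The alternation of 2 and 3 lets a run distinguish the copy of a position to subtract
  from the copy to add back.\<close>

definition ht :: "nat \<Rightarrow> nat" where
  "ht k = (if ctrl k = End then if even (rnd k) then 2 else 3 else 0)"

lemma ht_cases: "ht k \<in> {0, 2, 3}" "ht k \<noteq> 1" "ht k = 0 \<longleftrightarrow> ctrl k \<noteq> End"
  by (auto simp: ht_def)

lemma regs_Suc_touched:
  "ctrl k \<noteq> End \<Longrightarrow> int (regs (Suc k) (touched (ctrl k))) =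
     int (regs k (touched (ctrl k))) + change (ctrl k) (0 < regs k (touched (ctrl k)))"
  using change_nonneg by (simp add: cfg_step)

lemma regs_Suc_untouched:
  "ctrl k \<noteq> End \<Longrightarrow> touched (ctrl k) \<noteq> r \<Longrightarrow> regs (Suc k) r = regs k r"
  by (simp add: cfg_step)

text \<open>What a job holds agrees with the true registers, so no test with immediate verdict can
  succeed. The clauses for \<open>Short\<close> and \<open>Up r False\<close> record that the fuel
  test pays the full round number, hence needs a counter at least that large.\<close>

fun consistent :: "nat \<Rightarrow> bst \<Rightarrow> nat \<Rightarrow> bool" where
  "consistent k INIT c \<longleftrightarrow> c = 0"
| "consistent k TOP c \<longleftrightarrow> False"
| "consistent k CHK c \<longleftrightarrow> ctrl k = Start"
| "consistent k (Job q Idle) c \<longleftrightarrow> q = ctrl k \<and> c = 0"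
| "consistent k (Job q (Zero r)) c \<longleftrightarrow> q = ctrl k \<and> r \<noteq> None \<and> regs k r = 0"
| "consistent k (Job q (Down r)) c \<longleftrightarrow> q = ctrl k \<and> c = regs k r"
| "consistent k (Job q Guess) c \<longleftrightarrow> q = ctrl k"
| "consistent k (Job q Short) c \<longleftrightarrow> q = ctrl k \<and> regs k None = rnd k"
| "consistent k (Job q (Up r e)) c \<longleftrightarrow> q = ctrl k \<and> (e \<or> rnd k \<le> c + regs k r)"
| "consistent k S2 c \<longleftrightarrow> odd (rnd k)"
| "consistent k s c \<longleftrightarrow> True"

text \<open>While a transaction is pending, the paid value is still expected back; on correct words the
  potential never grows and drops whenever a transaction of type \<open>Up r True\<close> is completed.\<close>
fun potential :: "nat \<Rightarrow> bst \<Rightarrow> nat \<Rightarrow> nat" where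
  "potential k (Job q (Up r e)) c = c + regs k r"
| "potential k s c = c"

definition tmode :: "bst \<Rightarrow> bool" where
  "tmode s \<longleftrightarrow> s \<in> {TI, MARK} \<or> (\<exists>q j. s = Job q j \<and> j \<in> {Guess, Short} \<union> {Up r e |r e. True})"

text \<open>Completing \<open>Up r True\<close> costs one unit when the registers are right.
  Completing a fuel test costs nothing but presupposes a potential of at least the round number,
  which the hypothesis \<open>potential k s c < rnd k\<close> excludes.\<close>

lemma honest_step:
  assumes "((k, s, c), (k', s', c')) \<in> block_steps (hv h) ht" and con: "consistent k s c"
  shows "consistent k' s' c' \<and> k' = Suc k
    \<and> (tmode s \<longrightarrow> tmode s' \<and> potential k' s' c' \<le> potential k s c \<and>
        (s' = MARK \<and> potential k s c < rnd k \<longrightarrow> potential k' s' c' < potential k s c))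
    \<and> (s \<in> {S1, S2, SA} \<longrightarrow> s' \<in> {S1, S2, SA})
    \<and> (s' = MARK \<longrightarrow> tmode s) \<and> (s' = SA \<longrightarrow> s = S2)
    \<and> (s = NH \<longrightarrow> s' = NH \<and> ctrl k \<noteq> End)"
proof -
  have hE: "ctrl k = End" if "ht k \<in> {2, 3}" using that by (auto simp: ht_def split: if_splits)
  have h0: "ctrl k \<noteq> End" "hv h k = regs k (touched (ctrl k))" if "ht k = 0"
    using that by (auto simp: ht_def hv_def split: if_splits)
  have h23: "ht k = 2 \<Longrightarrow> even (rnd k)" "ht k = 3 \<Longrightarrow> odd (rnd k)"
    by (auto simp: ht_def split: if_splits)
  have k': "k' = Suc k" using assms(1) unfolding block_steps_def by auto
  have startS: "ctrl (Suc k) = Start" "regs (Suc k) = reset (Suc (rnd k))" "rnd (Suc k) = Suc (rnd k)"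
    if "ctrl k = End" using cfg_End[OF that] by auto
  have step0: "ctrl (Suc k) = succ (ctrl k) (0 < hv h k)" "rnd (Suc k) = rnd k" if "ht k = 0"
    using cfg_step[OF h0(1)[OF that]] h0(2)[OF that] by auto
  from assms(1) consider
      (chk) "s = CHK" "s' = TOP" "ht k = 0" "hv h k \<noteq> X"
    | (btr) sg d where "btr s (ht k) (0 < hv h k) sg d s'" "0 \<le> int c + sg * int (hv h k)"
       "int c' = int c + sg * int (hv h k) + d"
    unfolding block_steps_def by auto
  then show ?thesis
  proof cases
    case chk
    then have "ctrl k = Start" using con by simp
    then have "regs k (Some 0) = X" using fun_cong[of _ _ 0] regs_simulate[of k] by simp metis
    then have False using chk h0(2)[OF chk(3)] \<open>ctrl k = Start\<close> by simp
    then show ?thesis ..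
  next
    case btr
    from btr(1) show ?thesis
    proof cases
      case (b_walk q j)
      note 0 = b_walk(2)
      have "r \<noteq> touched (ctrl k) \<Longrightarrow> regs (Suc k) r = regs k r" for r
        using regs_Suc_untouched[OF h0(1)[OF 0]] by metis
      then show ?thesis using b_walk con k' step0[OF 0] btr(3)
        by (cases j) (auto simp: tmode_def)
    next
      case (b_round j)
      then show ?thesis using hE startS k' btr(3) con by (auto simp: tmode_def reset_def split: option.splits)
    next
      case (b_enter j)
      then show ?thesis using hE startS k' btr(3) con by (auto simp: tmode_def reset_def)
    next
      case (b_early q)
      then show ?thesis using hE con by auto
    next
      case b_late
      then show ?thesis using h0 con by auto
    next
      case b_halt
      then have "ctrl k = Fuel []" using con by simp
      then show ?thesis using live_ctrl[of k] by (simp add: live_def)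
    next
      case (b_zero q)
      then show ?thesis using h0 con by auto
    next
      case (b_down1 q)
      then show ?thesis using h0 con k' step0 regs_Suc_touched[of k] btr(3) by (auto simp: tmode_def)
    next
      case (b_down2 q)
      then show ?thesis using h0 con btr by auto
    next
      case (b_up1 q)
      then show ?thesis using h0 con k' step0 regs_Suc_touched[of k] btr(3) by (auto simp: tmode_def)
    next
      case (b_up2 q e)
      then show ?thesis using h0 con k' btr(3) by (auto simp: tmode_def split: if_splits)
    next
      case (b_short0 q)
      then show ?thesis using h0 con k' btr by (auto simp: tmode_def)
    next
      case (b_short1 q)
      then have q: "q = ctrl k" using con by simp
      have "ctrl k \<noteq> End" "touched (ctrl k) = None" using b_short1 q h0 by auto
      then obtain K where K: "ctrl k = Fuel K" by (cases "ctrl k") auto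
      have "0 < hv h k" "ht k = 0" using b_short1 by simp_all
      then show ?thesis using b_short1(1,4-6) q K h0 con k' step0 regs_Suc_touched[of k] btr(2,3)
        by (auto simp: tmode_def)
    next
      case b_chk
      then show ?thesis using hE startS k' con by (auto simp: tmode_def)
    next
      case b_nh
      then show ?thesis using h0 k' by (auto simp: tmode_def)
    next
      case b_s12
      then show ?thesis using h23 hE startS k' by (auto simp: tmode_def)
    next
      case b_s2
      then show ?thesis using step0 k' con by (auto simp: tmode_def)
    qed (use k' btr(3) con in \<open>auto simp: tmode_def\<close>)
  qed
qed

end

section \<open>Acceptance of correct words\<close>

lemma (in machine) rnd_unbounded: "\<exists>k\<ge>m. n < rnd k"
proof (induction n)
  case 0
  obtain k where k: "k \<ge> m" "ctrl k = End" using ex_End by blast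
  then have "0 < rnd (Suc k)" by (simp add: rnd_Suc)
  then show ?case using k by (intro exI[of _ "Suc k"]) simp
next
  case (Suc n)
  then obtain k where k: "k \<ge> m" "n < rnd k" by blast
  obtain l where l: "l \<ge> k" "ctrl l = End" using ex_End by blast
  then have "rnd k \<le> rnd l" by (intro rnd_mono)
  then have "Suc n < rnd (Suc l)" using k l by (simp add: rnd_Suc)
  then show ?case using k l by (intro exI[of _ "Suc l"]) simp
qed

context diverging
begin

lemma Start_block: "ctrl k = Start \<Longrightarrow> hv h k = X \<and> ht k = 0"
proof -
  assume *: "ctrl k = Start"
  then have "(\<lambda>i. regs k (Some i)) = input X" using regs_simulate[of k] by simp
  from fun_cong[OF this, of 0] * show ?thesis by (simp add: hv_def ht_def)
qed

lemma run_states: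
  assumes b: "blocks w (hv h) ht" and run: "is_run A w \<rho> c"
  obtains st where "st 0 = INIT"
    "\<And>k. \<rho> (start (hv h) k) = num (At (st k))"
    "\<And>k. consistent k (st k) (c (start (hv h) k))"
    "\<And>k. ((k, st k, c (start (hv h) k)), (Suc k, st (Suc k), c (start (hv h) (Suc k)))) \<in> block_steps (hv h) ht"
    "\<And>k j. 0 < j \<Longrightarrow> j \<le> hv h k \<Longrightarrow> \<rho> (start (hv h) k + j) \<notin> set (acc A)"
proof -
  let ?s = "start (hv h)"
  have step: "\<exists>s'. \<rho> (?s (Suc k)) = num (At s') \<and> num (At s') < X \<and> consistent (Suc k) s' (c (?s (Suc k)))
      \<and> ((k, s, c (?s k)), (Suc k, s', c (?s (Suc k)))) \<in> block_steps (hv h) ht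
      \<and> (\<forall>j. 0 < j \<and> j \<le> hv h k \<longrightarrow> \<rho> (?s k + j) \<notin> set (acc A))"
    if H: "\<rho> (?s k) = num (At s)" "num (At s) < X" "consistent k s (c (?s k))" for k s
  proof -
    have "s \<noteq> TOP" using H(3) by auto
    moreover have "s = CHK \<longrightarrow> hv h k = X \<and> ht k = 0" using H(3) Start_block by auto
    ultimately obtain s' where s': "\<rho> (?s (Suc k)) = num (At s')" "num (At s') < X"
      "((k, s, c (?s k)), (Suc k, s', c (?s (Suc k)))) \<in> block_steps (hv h) ht"
      "\<forall>j. 0 < j \<and> j \<le> hv h k \<longrightarrow> \<rho> (?s k + j) \<notin> set (acc A)"
      using run_imp_block_step[OF b ht_cases(2) run H(1,2)] by blast
    with honest_step[OF s'(3) H(3)] show ?thesis by blast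
  qed
  have ex: "\<exists>s. \<rho> (?s k) = num (At s) \<and> num (At s) < X \<and> consistent k s (c (?s k))" for k
  proof (induction k)
    case 0
    show ?case using run X_pos unfolding is_run_def by (intro exI[of _ INIT]) simp
  next
    case (Suc k)
    then show ?case using step by blast
  qed
  define st where "st k = (SOME s. \<rho> (?s k) = num (At s) \<and> num (At s) < X \<and> consistent k s (c (?s k)))" for k
  have st: "\<rho> (?s k) = num (At (st k))" "num (At (st k)) < X" "consistent k (st k) (c (?s k))" for k
    using someI_ex[OF ex[of k]] unfolding st_def by auto
  have st_eq: "st k = s" if "\<rho> (?s k) = num (At s)" for k s
    using st(1)[of k] that by (simp add: num_eq_iff)
  show thesis
  proof (rule that[of st])
    show "st 0 = INIT" using run by (intro st_eq) (simp add: is_run_def)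
    show "((k, st k, c (?s k)), (Suc k, st (Suc k), c (?s (Suc k)))) \<in> block_steps (hv h) ht" for k
      using step[OF st[of k]] st_eq by blast
    show "\<rho> (?s k + j) \<notin> set (acc A)" if "0 < j" "j \<le> hv h k" for k j
      using step[OF st[of k]] that by blast
  qed (use st in auto)
qed

text \<open>The three cases are: a block inside a round, a closing block with the first copy of a
  position, and one with the second copy.\<close>

lemma s_step:
  assumes "((k, s, c), (Suc k, s', c')) \<in> block_steps (hv h) ht" "s \<in> {S1, S2, SA}"
  shows "(ctrl k \<noteq> End \<and> c' = c \<and> (s' = S2 \<longleftrightarrow> s = S2) \<and> s' \<noteq> SA)
    \<or> (ctrl k = End \<and> even (rnd k) \<and> s \<noteq> S2 \<and> s' \<noteq> SA \<and> (if s' = S2 then c = c' + hv h k else c' = c))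
    \<or> (ctrl k = End \<and> odd (rnd k) \<and> s' \<noteq> S2 \<and>
        (if s = S2 then c' = c + hv h k + (if s' = SA then 0 else 1) else s' \<noteq> SA \<and> c' = c))"
proof -
  obtain sg d where btr: "btr s (ht k) (0 < hv h k) sg d s'" "0 \<le> int c + sg * int (hv h k)"
       "int c' = int c + sg * int (hv h k) + d"
    using assms unfolding block_steps_def by auto
  from btr(1) assms(2) show ?thesis
    by cases (use btr(2,3) in \<open>auto simp: ht_def split: if_splits\<close>)
qed

text \<open>Acceptance needs infinitely many visits to \<open>MARK\<close> or \<open>SA\<close>. The
  first would make the potential drop forever; without a descent in \<open>lt\<close>, the second
  would do so for the measure of \<open>position_measure\<close>.\<close>

lemma accepted_imp_descending:
  assumes lt: "strict_linear lt" and h: "\<And>j. h j = position lt (j div 2) (j div 2)"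
    and acc: "word (hv h) ht \<in> lang A"
  shows "\<exists>f. descending lt f"
proof (rule ccontr)
  assume nd: "\<not> ?thesis"
  define w where "w = word (hv h) ht"
  let ?s = "start (hv h)"
  have b: "blocks w (hv h) ht" unfolding w_def by (rule blocks_word)
  obtain \<rho> c where run: "is_run A w \<rho> c" and inf: "\<exists>\<^sub>\<infinity>i. \<rho> i \<in> set (acc A)"
    using acc unfolding lang_def w_def by blast
  obtain st where st: "st 0 = INIT"
    "\<And>k. \<rho> (?s k) = num (At (st k))"
    "\<And>k. consistent k (st k) (c (?s k))"
    "\<And>k. ((k, st k, c (?s k)), (Suc k, st (Suc k), c (?s (Suc k)))) \<in> block_steps (hv h) ht"
    "\<And>k j. 0 < j \<Longrightarrow> j \<le> hv h k \<Longrightarrow> \<rho> (?s k + j) \<notin> set (acc A)"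
    by (rule run_states[OF b run], rule that)
  note hs = honest_step[OF st(4) st(3)]
  have not_nh: "st k \<noteq> NH" for k
  proof
    assume *: "st k = NH"
    have nh: "st (k + j) = NH" for j
    proof (induction j)
      case (Suc j)
      then show ?case using hs[of "k + j"] by simp
    qed (use * in simp)
    obtain l where l: "l \<ge> k" "ctrl l = End" using ex_End by blast
    then show False using hs[of l] nh[of "l - k"] by simp
  qed
  have visits: "\<exists>k\<ge>n. st k \<in> {MARK, SA}" for n
  proof -
    obtain i where i: "i \<ge> ?s n" "\<rho> i \<in> set (acc A)" using inf unfolding INFM_nat_le by blast
    obtain k j where kj: "i = ?s k + j" "j \<le> hv h k" using ex_block by blast
    have "j = 0" using st(5)[of j k] kj i(2) by (cases "j = 0") simp_all
    then have "num (At (st k)) \<in> {0, 1, 2, 3, 4}" using i(2) kj(1) st(2) by simp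
    moreover have "st k \<noteq> TOP" using st(3)[of k] by auto
    ultimately have "st k \<in> {MARK, SA}" using not_nh[of k] by (auto simp: num_def split: if_splits)
    moreover have "n \<le> k"
    proof -
      have "?s n \<le> ?s k" using i(1) kj(1) \<open>j = 0\<close> by simp
      then show ?thesis using strict_mono_less_eq[OF strict_mono_start] by blast
    qed
    ultimately show ?thesis by blast
  qed
  show False
  proof (cases "\<exists>k0. tmode (st k0)")
    case True
    then obtain k0 where k0: "tmode (st k0)" ..
    define M where "M k = potential k (st k) (c (?s k))" for k
    have t: "tmode (st (k0 + j)) \<and> M (k0 + j) \<le> M k0" for j
    proof (induction j)
      case (Suc j)
      then show ?case using hs[of "k0 + j"] unfolding M_def by auto
    qed (use k0 in simp)
    have t': "tmode (st k)" "M k \<le> M k0" if "k0 \<le> k" for k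
      using t[of "k - k0"] that by auto
    \<comment> \<open>From here on the round number exceeds the potential, so each visit to
      \<open>MARK\<close> makes it drop.\<close>
    obtain k1 where k1: "k1 \<ge> k0" "M k0 < rnd k1" using rnd_unbounded by blast
    show False
    proof (rule no_infinite_descent[of less_than k1 M])
      show "wf less_than" "Relation.trans less_than" by simp_all
      show "(M (Suc k), M k) \<in> less_than\<^sup>=" if "k1 \<le> k" for k
      proof -
        have "M (Suc k) \<le> M k" using hs[of k] t'(1)[of k] that k1(1) unfolding M_def by simp
        then show ?thesis by auto
      qed
      show "\<exists>k\<ge>n. (M (Suc k), M k) \<in> less_than" for n
      proof -
        obtain k where k: "k \<ge> Suc (max n k1)" "st k \<in> {MARK, SA}" using visits by blast
        then obtain l where l: "k = Suc l" "l \<ge> n" "l \<ge> k1" by (cases k) auto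
        have "tmode (st k)" using t' l k1 by simp
        then have "st k = MARK" using k(2) by (auto simp: tmode_def)
        moreover have "M l < rnd l" using t'(2)[of l] rnd_mono[OF l(3)] k1 l(3) by simp
        ultimately have "M (Suc l) < M l"
          using hs[of l] t'(1)[of l] l k1(1) unfolding M_def by auto
        then show ?thesis using l(2) by auto
      qed
    qed
  next
    case False
    have not_mark: "st k \<noteq> MARK" for k using False by (auto simp: tmode_def)
    obtain k0 where k0: "st k0 = SA" using visits[of 0] not_mark by blast
    have s: "st (k0 + j) \<in> {S1, S2, SA}" for j
    proof (induction j)
      case (Suc j)
      then show ?case using hs[of "k0 + j"] by simp
    qed (use k0 in simp)
    have s': "st k \<in> {S1, S2, SA}" if "k0 \<le> k" for k using s[of "k - k0"] that by simp
    obtain \<mu> :: "nat \<Rightarrow> nat \<Rightarrow> nat \<times> nat \<times> nat" and W where W: "wf W" "Relation.trans W"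
      and step: "\<forall>n c c'. c' \<le> c + (if position lt n n \<le> c then 1 else 0) \<longrightarrow>
       (\<mu> (Suc n) c', \<mu> n c) \<in> W\<^sup>= \<and>
       (position lt n n \<le> c \<longrightarrow> c' \<le> c \<longrightarrow> (\<mu> (Suc n) c', \<mu> n c) \<in> W)"
      using position_measure[OF lt nd] by (elim exE conjE)
    \<comment> \<open>The counter with the position that is currently subtracted in
      \<open>S2\<close> put back.\<close>
    define orig where "orig k = c (?s k) + (if st k = S2 then position lt (rnd k div 2) (rnd k div 2) else 0)" for k
    define M where "M k = \<mu> (rnd k div 2) (orig k)" for k
    have M: "(M (Suc k), M k) \<in> W\<^sup>= \<and> (st (Suc k) = SA \<longrightarrow> (M (Suc k), M k) \<in> W)" if "k0 \<le> k" for k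
    proof -
      let ?n = "rnd k div 2"
      have hvk: "hv h k = position lt ?n ?n" if "ctrl k = End" using that h by (simp add: hv_def)
      have od: "Suc (rnd k) div 2 = Suc ?n" if "odd (rnd k)" using that by (auto elim: oddE)
      have ev: "Suc (rnd k) div 2 = ?n" if "even (rnd k)" using that by (auto elim: evenE)
      from s_step[OF st(4)[of k] s'[OF that]] show ?thesis
      proof (elim disjE conjE)
        assume "ctrl k \<noteq> End" "c (?s (Suc k)) = c (?s k)" "(st (Suc k) = S2) = (st k = S2)" "st (Suc k) \<noteq> SA"
        then show ?thesis by (simp add: M_def orig_def rnd_Suc)
      next
        assume *: "ctrl k = End" "even (rnd k)" "st k \<noteq> S2" "st (Suc k) \<noteq> SA"
          "if st (Suc k) = S2 then c (?s k) = c (?s (Suc k)) + hv h k else c (?s (Suc k)) = c (?s k)"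
        then have "orig (Suc k) = orig k" using hvk by (simp add: orig_def rnd_Suc ev split: if_splits)
        then show ?thesis using * by (simp add: M_def rnd_Suc ev)
      next
        assume *: "ctrl k = End" "odd (rnd k)" "st (Suc k) \<noteq> S2"
          "if st k = S2 then c (?s (Suc k)) = c (?s k) + hv h k + (if st (Suc k) = SA then 0 else 1)
           else st (Suc k) \<noteq> SA \<and> c (?s (Suc k)) = c (?s k)"
        then have le: "orig (Suc k) \<le> orig k + (if position lt ?n ?n \<le> orig k then 1 else 0)"
          and sa: "st (Suc k) = SA \<Longrightarrow> orig (Suc k) \<le> orig k \<and> position lt ?n ?n \<le> orig k"
          using hvk[OF *(1)] by (auto simp: orig_def split: if_splits)
        have "M (Suc k) = \<mu> (Suc ?n) (orig (Suc k))" using * by (simp add: M_def rnd_Suc od)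
        then show ?thesis
          using step[THEN spec, THEN spec, THEN spec, THEN mp, OF le] sa unfolding M_def[of k] by auto
      qed
    qed
    show False
    proof (rule no_infinite_descent[OF W(1,2), of k0 M])
      show "(M (Suc k), M k) \<in> W\<^sup>=" if "k0 \<le> k" for k using M[OF that] by blast
      show "\<exists>k\<ge>n. (M (Suc k), M k) \<in> W" for n
      proof -
        obtain k where k: "k \<ge> Suc (max n k0)" "st k \<in> {MARK, SA}" using visits by blast
        then obtain l where l: "k = Suc l" "l \<ge> n" "l \<ge> k0" by (cases k) auto
        then have "(M (Suc l), M l) \<in> W" using M[of l] k(2) not_mark[of k] by auto
        then show ?thesis using l(2) by blast
      qed
    qed
  qed
qed

lemma ex_hash_positions:
  "\<exists>hb. hb 0 = 0 \<and> (\<forall>j. ctrl (hb j) = End \<and> rnd (hb j) = j \<and> hb j + 2 \<le> hb (Suc j)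
     \<and> (\<forall>k. hb j < k \<longrightarrow> k < hb (Suc j) \<longrightarrow> ctrl k \<noteq> End))"
proof -
  define nxt where "nxt k = (LEAST l. k < l \<and> ctrl l = End)" for k
  have nxt: "k < nxt k" "ctrl (nxt k) = End" "\<And>l. k < l \<Longrightarrow> l < nxt k \<Longrightarrow> ctrl l \<noteq> End" for k
  proof -
    have "\<exists>l. k < l \<and> ctrl l = End" using ex_End[of "Suc k"] by (auto simp: Suc_le_eq)
    from LeastI_ex[OF this] show "k < nxt k" "ctrl (nxt k) = End" unfolding nxt_def by auto
    show "\<And>l. k < l \<Longrightarrow> l < nxt k \<Longrightarrow> ctrl l \<noteq> End" unfolding nxt_def using not_less_Least by blast
  qed
  define hb where "hb j = (nxt ^^ j) 0" for j
  have hb: "hb 0 = 0" "hb (Suc j) = nxt (hb j)" for j by (simp_all add: hb_def)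
  have E: "ctrl (hb j) = End" for j by (cases j) (simp_all add: hb cfg_0 nxt)
  have between: "ctrl k \<noteq> End" if "hb j < k" "k < hb (Suc j)" for j k using nxt(3) that hb by simp
  have "rnd (hb j) = j" for j
  proof (induction j)
    case (Suc j)
    have "rnd k = Suc j" if "Suc (hb j) \<le> k" "k \<le> hb (Suc j)" for k
      using that
    proof (induction k rule: dec_induct)
      case base
      show ?case using Suc E[of j] by (simp add: rnd_Suc)
    next
      case (step k)
      then show ?case using between[of j k] by (simp add: rnd_Suc)
    qed
    then show ?case using nxt(1)[of "hb j"] by (simp add: hb)
  qed (simp add: hb cfg_0)
  moreover have "hb j + 2 \<le> hb (Suc j)" for j
  proof -
    have "ctrl (Suc (hb j)) \<noteq> End" using cfg_End(1)[OF E[of j]] by simp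
    then have "hb (Suc j) \<noteq> Suc (hb j)" using E[of "Suc j"] by auto
    then show ?thesis using nxt(1)[of "hb j"] by (simp add: hb)
  qed
  ultimately show ?thesis using hb(1) E between by blast
qed

lemma descending_imp_accepted:
  assumes lt: "strict_linear lt" and h: "\<And>j. h j = position lt (j div 2) (j div 2)"
    and f: "descending lt f"
  shows "word (hv h) ht \<in> lang A"
proof -
  let ?B = "block_steps (hv h) ht"
  obtain n0 N where n0: "0 < n0" and N: "infinite N" and run: "\<And>c0. c0 \<ge> n0 \<Longrightarrow> \<exists>D. D n0 = c0 \<and> (\<forall>n\<ge>n0.
     if n \<in> N then position lt n n \<le> D n \<and> D (Suc n) = D n
     else D (Suc n) = D n + (if position lt n n \<le> D n then 1 else 0))"
    using descending_imp_counter_run[OF lt f] by metis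
  obtain hb where hb: "hb 0 = 0" "\<And>j. ctrl (hb j) = End" "\<And>j. rnd (hb j) = j"
    "\<And>j. hb j + 2 \<le> hb (Suc j)" "\<And>j k. hb j < k \<Longrightarrow> k < hb (Suc j) \<Longrightarrow> ctrl k \<noteq> End"
    using ex_hash_positions by metis
  have hb_ge: "2 * j \<le> hb j" for j
  proof (induction j)
    case (Suc j)
    then show ?case using hb(4)[of j] by simp
  qed simp
  have stepI0: "((k, s, c), (Suc k, s', c)) \<in> ?B" if "btr s (ht k) (0 < hv h k) 0 0 s'" for k s s' c
    using that by (intro block_stepI[of s ht k "hv h" 0 0 s']) auto
  have stay: "((n, s, c), (k, s, c)) \<in> ?B\<^sup>*"
    if "s \<in> {S1, S2}" "hb j < n" "n \<le> k" "k \<le> hb (Suc j)" for j s c n k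
    using that(3,4)
  proof (induction k rule: dec_induct)
    case (step k)
    have "ht k = 0" using hb(5)[of j k] step that(2) by (simp add: ht_def)
    then have "((k, s, c), (Suc k, s, c)) \<in> ?B"
      using that(1) by (intro stepI0) (auto intro!: b_s1 b_s2)
    then show ?case using step by (auto intro: rtrancl_snoc)
  qed simp
  \<comment> \<open>At least the block of \<open>Start\<close> lies between two closing blocks;
    reading it, \<open>SA\<close> falls back to \<open>S1\<close>.\<close>
  have arrive: "((Suc (hb j), s, c), (hb (Suc j), S1, c)) \<in> ?B\<^sup>+" if "s \<in> {S1, SA}" for j s c
  proof -
    let ?k = "Suc (hb j)"
    have "ht ?k = 0" using hb(5)[of j ?k] hb(4)[of j] by (simp add: ht_def)
    then have "((?k, s, c), (Suc ?k, S1, c)) \<in> ?B"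
      using that by (intro stepI0) (auto intro!: b_s1)
    moreover have "((Suc ?k, S1, c), (hb (Suc j), S1, c)) \<in> ?B\<^sup>*"
      by (rule stay[of _ j]) (use hb(4)[of j] in auto)
    ultimately show ?thesis by (rule rtrancl_into_trancl2)
  qed
  \<comment> \<open>The counter of a run that enters \<open>S0\<close> at block 0 and adds one at
    each later block until it leaves \<open>S0\<close> at the closing block of round
    \<open>2 * n0 - 1\<close>, whose letter is 3.\<close>
  define c0 where "c0 = hb (2 * n0 - 1) - 1"
  have c0: "n0 \<le> c0" using hb_ge[of "2 * n0 - 1"] n0 unfolding c0_def by linarith
  obtain D where D0: "D n0 = c0" and D: "\<And>n. n \<ge> n0 \<Longrightarrow>
     (if n \<in> N then position lt n n \<le> D n \<and> D (Suc n) = D n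
     else D (Suc n) = D n + (if position lt n n \<le> D n then 1 else 0))"
    using run[OF c0] by blast
  \<comment> \<open>The point right after the closing block of round \<open>2 * n - 1\<close>,
    before the two copies that insert \<open>n\<close>; the state is \<open>SA\<close> if the
    preceding insertion was a strict descent.\<close>
  define F where "F n = (Suc (hb (2 * n - 1)), if n0 < n \<and> n - 1 \<in> N then SA else S1, D n)" for n
  have F: "(F n, F (Suc n)) \<in> ?B\<^sup>+" if n: "n0 \<le> n" for n
  proof -
    let ?s = "if n0 < n \<and> n - 1 \<in> N then SA else S1"
    let ?s' = "if n \<in> N then SA else S1"
    let ?p = "position lt n n"
    have hv: "hv h (hb (2 * n)) = ?p" "hv h (hb (Suc (2 * n))) = ?p"
      using hb(2,3) h by (simp_all add: hv_def)
    have t: "ht (hb (2 * n)) = 2" "ht (hb (Suc (2 * n))) = 3" using hb(2,3) by (simp_all add: ht_def)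
    have "Suc (2 * n - 1) = 2 * n" using n n0 by simp
    with arrive[of ?s "2 * n - 1" "D n"] have 1: "(F n, (hb (2 * n), S1, D n)) \<in> ?B\<^sup>+"
      by (simp add: F_def)
    have "((hb (2 * n), S1, D n), (Suc (hb (Suc (2 * n))), ?s', D (Suc n))) \<in> ?B\<^sup>*"
    proof (cases "?p \<le> D n")
      case True
      have "((hb (2 * n), S1, D n), (Suc (hb (2 * n)), S2, D n - ?p)) \<in> ?B"
        by (rule block_stepI[of _ _ _ _ "-1" 0]) (use True t hv in \<open>auto intro!: b_s12\<close>)
      moreover have "((Suc (hb (2 * n)), S2, D n - ?p), (hb (Suc (2 * n)), S2, D n - ?p)) \<in> ?B\<^sup>*"
        by (rule stay[of _ "2 * n"]) (use hb(4)[of "2 * n"] in auto)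
      moreover have "((hb (Suc (2 * n)), S2, D n - ?p), (Suc (hb (Suc (2 * n))), ?s', D (Suc n))) \<in> ?B"
      proof (cases "n \<in> N")
        case True
        then show ?thesis using D[OF n] t hv \<open>?p \<le> D n\<close>
          by (intro block_stepI[of _ _ _ _ 1 0]) (auto intro!: b_s2a)
      next
        case False
        then show ?thesis using D[OF n] t hv \<open>?p \<le> D n\<close>
          by (intro block_stepI[of _ _ _ _ 1 1]) (auto intro!: b_s21)
      qed
      ultimately show ?thesis by (meson converse_rtrancl_into_rtrancl rtrancl_snoc)
    next
      case False
      then have "n \<notin> N" "D (Suc n) = D n" using D[OF n] by (auto split: if_splits)
      moreover have "((hb (2 * n), S1, D n), (Suc (hb (2 * n)), S1, D n)) \<in> ?B"
        by (rule stepI0) (use t in \<open>auto intro!: b_s1\<close>)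
      moreover have "((Suc (hb (2 * n)), S1, D n), (hb (Suc (2 * n)), S1, D n)) \<in> ?B\<^sup>*"
        by (rule stay[of _ "2 * n"]) (use hb(4)[of "2 * n"] in auto)
      moreover have "((hb (Suc (2 * n)), S1, D n), (Suc (hb (Suc (2 * n))), S1, D n)) \<in> ?B"
        by (rule stepI0) (use t in \<open>auto intro!: b_s1\<close>)
      ultimately show ?thesis
        by simp
    qed
    moreover have "F (Suc n) = (Suc (hb (Suc (2 * n))), ?s', D (Suc n))" using n by (simp add: F_def)
    ultimately show ?thesis using 1 by (metis trancl_rtrancl_trancl)
  qed
  have F': "(F m, F n) \<in> ?B\<^sup>+" if "n0 \<le> m" "Suc m \<le> n" for m n
    using that(2)
  proof (induction n rule: dec_induct)
    case base
    show ?case by (rule F[OF that(1)])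
  next
    case (step n)
    then show ?case using F[of n] that(1) by (auto intro: trancl_trans)
  qed
  have s0: "((0, INIT, 0), (Suc k, S0, k)) \<in> ?B\<^sup>+" for k
  proof (induction k)
    case 0
    show ?case by (rule r_into_trancl, rule stepI0) (auto intro!: b_init[OF ht_cases(1)])
  next
    case (Suc k)
    have "((Suc k, S0, k), (Suc (Suc k), S0, Suc k)) \<in> ?B"
      by (rule block_stepI[of _ _ _ _ 0 1]) (auto intro!: b_s0[OF ht_cases(1)])
    with Suc show ?case by (rule trancl_into_trancl)
  qed
  have init: "((0, INIT, 0), F n0) \<in> ?B\<^sup>+"
  proof -
    let ?k = "hb (2 * n0 - 1)"
    have "Suc c0 = ?k" using c0 n0 unfolding c0_def by simp
    moreover have "((?k, S0, c0), F n0) \<in> ?B"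
    proof -
      have "odd (2 * n0 - 1)" using n0 by simp
      then have "ht ?k = 3" using hb(2,3) by (simp add: ht_def)
      then show ?thesis unfolding F_def using D0 by (simp, intro stepI0) (auto intro!: b_s01)
    qed
    ultimately show ?thesis using s0[of c0] by (metis trancl_into_trancl)
  qed
  define N' where "N' = {n \<in> N. n0 \<le> n}"
  have "N \<subseteq> N' \<union> {..<n0}" by (auto simp: N'_def)
  then have N': "infinite N'" using N finite_subset[of N "N' \<union> {..<n0}"] by auto
  define e where "e i = Suc (enumerate N' i)" for i
  have e: "n0 < e i" "e i - 1 \<in> N" "e i < e (Suc i)" for i
    using enumerate_in_set[OF N', of i] enumerate_step[OF N', of i] by (auto simp: e_def N'_def)
  show ?thesis
  proof (rule in_lang_if_infinite_block_path[OF _ blocks_word, of _ _ "\<lambda>i. F (e i)"])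
    show "word (hv h) ht \<in> omega_words 4" by (rule word_in_omega_words) (auto simp: ht_def)
    show "((0, INIT, 0), F (e 0)) \<in> ?B\<^sup>+" using init F'[of n0 "e 0"] e(1)[of 0] by (auto intro: trancl_trans)
    show "(F (e i), F (e (Suc i))) \<in> ?B\<^sup>+" for i using F'[of "e i" "e (Suc i)"] e[of i] by simp
    show "fst (snd (F (e i))) \<in> {TOP, NH, MARK, SA}" for i using e[of i] by (simp add: F_def)
  qed
qed

lemma complement_not_analytic: "\<not> analytic 4 (omega_words 4 - lang A)"
proof
  assume "analytic 4 (omega_words 4 - lang A)"
  then obtain R where R: "omega_words 4 - lang A =
      {\<sigma> \<in> omega_words 4. \<exists>\<tau>. \<forall>m. R (prefix \<sigma> m) (prefix \<tau> m)}"
    unfolding analytic_def by blast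
  define W where "W h = word (hv h) ht" for h
  \<comment> \<open>The condition is imposed on all prefixes of a node so that the tree is closed
    under prefixes.\<close>
  define T where "T h = {s. \<forall>j\<le>length s. R (prefix (W h) j) (take j s)}" for h
  define F where "F h j = position (tree_less (T h)) (j div 2) (j div 2)" for h j
  \<comment> \<open>Codes up to \<open>j div 2\<close> stand for nodes of at most that length; they
    consult as many letters, which lie in as many blocks, and the round numbers of these blocks are
    below \<open>j\<close>. So \<open>F h j\<close> looks only at \<open>h\<close> below
    \<open>j\<close>.\<close>
  have "F h j = F h' j" if eq: "\<And>i. i < j \<Longrightarrow> h i = h' i" for h h' j
  proof -
    let ?n = "j div 2"
    have w: "W h i = W h' i" if "i < ?n" for i
      unfolding W_def
    proof (rule word_cong[of ?n])
      fix k assume "k < ?n"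
      then have "rnd k < j" using rnd_le[of k] by linarith
      then show "hv h k = hv h' k" using eq by (simp add: hv_def)
    qed (use that in simp_all)
    have pre: "prefix (W h) i = prefix (W h') i" if "i \<le> ?n" for i
      using w that by (simp add: prefix_eq_iff)
    have "list_decode m \<in> T h \<longleftrightarrow> list_decode m \<in> T h'" if "m \<le> ?n" for m
      using pre length_list_decode_le[of m] that unfolding T_def by simp
    then have "tree_less (T h) m ?n = tree_less (T h') m ?n" if "m < ?n" for m
      using that unfolding tree_less_def by simp
    then have "{m. m < ?n \<and> tree_less (T h) m ?n} = {m. m < ?n \<and> tree_less (T h') m ?n}" by blast
    then show ?thesis by (simp add: F_def position_def)
  qed
  from ex_fixpoint_of_history[of F, OF this] obtain h where h: "\<And>j. h j = F h j" by blast
  let ?lt = "tree_less (T h)"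
  have pos: "h j = position ?lt (j div 2) (j div 2)" for j using h[of j] by (simp add: F_def)
  have lin: "strict_linear ?lt" by (rule strict_linear_tree_less)
  have closed: "prefix_closed (T h)"
    unfolding prefix_closed_def
  proof (intro allI impI)
    fix s u assume su: "s @ u \<in> T h"
    have "R (prefix (W h) j) (take j s)" if "j \<le> length s" for j
      using su that unfolding T_def by (auto dest!: spec[of _ j])
    then show "s \<in> T h" by (simp add: T_def)
  qed
  have "W h \<in> lang A \<longleftrightarrow> (\<exists>f. descending ?lt f)"
    using accepted_imp_descending[OF lin pos] descending_imp_accepted[OF lin pos]
    unfolding W_def by blast
  also have "\<dots> \<longleftrightarrow> (\<exists>\<tau>. \<forall>m. prefix \<tau> m \<in> T h)"
    by (rule tree_less_descending_iff_branch[OF closed])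
  also have "\<dots> \<longleftrightarrow> (\<exists>\<tau>. \<forall>m. R (prefix (W h) m) (prefix \<tau> m))"
  proof -
    have "(\<forall>m. prefix \<tau> m \<in> T h) \<longleftrightarrow> (\<forall>m. R (prefix (W h) m) (prefix \<tau> m))" for \<tau>
    proof
      assume *: "\<forall>m. prefix \<tau> m \<in> T h"
      show "\<forall>m. R (prefix (W h) m) (prefix \<tau> m)"
      proof
        fix m
        have "prefix \<tau> m \<in> T h" using * ..
        then have "\<forall>j\<le>m. R (prefix (W h) j) (take j (prefix \<tau> m))" unfolding T_def by simp
        then have "R (prefix (W h) m) (take m (prefix \<tau> m))" by blast
        then show "R (prefix (W h) m) (prefix \<tau> m)" by (simp add: take_prefix)
      qed
    next
      assume "\<forall>m. R (prefix (W h) m) (prefix \<tau> m)"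
      then show "\<forall>m. prefix \<tau> m \<in> T h" by (simp add: T_def take_prefix min_def)
    qed
    then show ?thesis by simp
  qed
  also have "\<dots> \<longleftrightarrow> W h \<notin> lang A"
  proof -
    have "W h \<in> omega_words 4" unfolding W_def by (rule word_in_omega_words) (auto simp: ht_def)
    then show ?thesis using R by blast
  qed
  finally show False by blast
qed

end

section \<open>Undecidability\<close>

text \<open>A decider yields a program that halts on \<open>x\<close> iff it says no about the
  automaton with input \<open>x\<close>. On its own \<open>X\<close>, halting makes the language
  universal and \<open>P\<close> true, divergence makes the complement non-analytic and
  \<open>P\<close> false; the decider errs in both cases. All three families satisfy the two
  hypotheses.\<close>

lemma undecidable_if_separating:
  assumes triv: "\<And>A. lang A = omega_words (alph A) \<Longrightarrow> P A"
    and ana: "\<And>A. P A \<Longrightarrow> analytic (alph A) (omega_words (alph A) - lang A)"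
  shows "\<not> decidable_bca_prop P"
proof
  assume "decidable_bca_prop P"
  then obtain D where "recursive_set D" and D: "\<And>A. wf_bca A \<Longrightarrow> code_bca A \<in> D \<longleftrightarrow> P A"
    unfolding decidable_bca_prop_def by blast
  then obtain p where p: "\<And>x. eval p [x] (if x \<in> D then 1 else 0)"
    unfolding recursive_set_def by blast
  obtain g where g: "\<And>xs. length xs = 1 \<Longrightarrow> eval g xs (code_with_input (xs ! 0))"
    using computable_code_with_input unfolding computable_def by blast
  have "eval (Comp p [g]) [x] (if code_with_input x \<in> D then 1 else 0)" for x
    by (rule ev_Comp[where ys = "[code_with_input x]"]) (use g[of "[x]"] p in auto)
  from machine_for_zero_test[OF this] obtain prog where
    "\<forall>x. halts prog (input x) \<longleftrightarrow> (if code_with_input x \<in> D then 1 else 0) = (0::nat)"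
    by blast
  then have prog: "halts prog (input x) \<longleftrightarrow> code_with_input x \<notin> D" for x by simp
  obtain Q where "machine prog Q" using ex_machine by blast
  then interpret machine prog Q .
  have PA: "P A \<longleftrightarrow> code_with_input X \<in> D" using D[OF wf_A] code_A by simp
  show False
  proof (cases "halts prog (input X)")
    case True
    then have "P A" using triv[of A] universal_if_halts by simp
    then show False using PA prog True by blast
  next
    case False
    then interpret diverging prog Q by unfold_locales
    have "\<not> P A" using ana[of A] complement_not_analytic by auto
    then show False using PA prog False by blast
  qed
qed

theorem mainTheorem12:
  shows "\<not> decidable_bca_prop (\<lambda>A. Delta11 (alph A) (lang A))
     \<and> (\<forall>n\<ge>1. \<not> decidable_bca_prop (\<lambda>A. arith_Sigma n (alph A) (lang A)))
     \<and> (\<forall>n\<ge>1. \<not> decidable_bca_prop (\<lambda>A. arith_Pi n (alph A) (lang A)))"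
proof (intro conjI allI impI; rule undecidable_if_separating)
qed (simp_all add: Delta11_trivial arith_Sigma_trivial arith_Pi_trivial
    Delta11_analytic arith_Sigma_analytic arith_Pi_analytic)

end
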